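(* Let $n\ge1$ and let $P_n$ be the set of partitions of $n$. Then there exists a map $\mathrm{st}:\mathfrak{S}_n\to P_n$ which is invariant under rotation and equidistributed with the Robinson--Schensted shape, that is, $$\mathrm{st}\circ\mathrm{rot}=\mathrm{st}\qquad\text{and}\qquad \sum_{\sigma\in\mathfrak{S}_n}s_{\mathrm{st}(\sigma)}(\mathbf{x})=\sum_{\sigma\in\mathfrak{S}_n}s_{\mathrm{sh}(\sigma)}(\mathbf{x}),$$ and moreover such that, with $\mathfrak{S}_n^\lambda:=\{\sigma\in\mathfrak{S}_n\mid \mathrm{st}(\sigma)=\lambda\}$, for every $\lambda\in P_n$ the triple $$\left(\mathfrak{S}_n^\lambda,\ \langle\mathrm{rot}\rangle,\ f^\lambda(q)^2\right)$$ exhibits the cyclic sieving phenomenon (for the cyclic group of order $n$).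
   Context: $\mathfrak{S}_n$ is the symmetric group. The rotation $\mathrm{rot}\,\sigma$ of $\sigma\in\mathfrak{S}_n$ is the permutation obtained from $\sigma$ by conjugating with the long cycle $(1,2,\dots,n)$. The shape $\mathrm{sh}(\sigma)$ is the common shape of the two standard Young tableaux $P,Q$ corresponding to $\sigma$ under the Robinson--Schensted correspondence. $s_\lambda(\mathbf{x})$ is the Schur function. $\mathrm{SYT}(\lambda)$ is the set of standard Young tableaux of shape $\lambda\vdash n$ (English notation). A descent of $T\in\mathrm{SYT}(\lambda)$ is $j\in\{1,\dots,n-1\}$ such that $j+1$ appears in a row of strictly larger index (strictly lower) than $j$; $\mathrm{maj}(T)$ is the sum of descents, and $f^\lambda(q)=\sum_{T\in\mathrm{SYT}(\lambda)}q^{\mathrm{maj}(T)}$. Cyclic sieving: let $X$ be a finite set, $\rho$ a generator of an action of the cyclic group of order $n$ on $X$ (so $\rho^n$ acts as the identity; not necessarily faithful), and $f(q)\in\mathbb{N}[q]$. The triple $(X,\langle\rho\rangle,f(q))$ exhibits the cyclic sieving phenomenon if for all $d\in\mathbb{Z}$, $\#\{x\in X:\rho^d\cdot x=x\}=f(\xi^d)$, where $\xi$ is a primitive $n$-th root of unity. *)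

theory Defs
  imports
    Complex_Main
    "HOL-Library.Multiset"
    "HOL-Library.FuncSet"
    "HOL-Library.Function_Algebras"
    "HOL-Combinatorics.Permutations"
    "HOL-Combinatorics.Cycles"
    "HOL-Computational_Algebra.Polynomial"
    "HOL-Algebra.Bij"
begin

section \<open>Partitions and tableaux\<close>

definition partitions :: "nat \<Rightarrow> nat list set" where
  "partitions n = {lam. sorted_wrt (\<ge>) lam \<and> 0 \<notin> set lam \<and> sum_list lam = n}"

text \<open>A tableau is the list of its rows, from top to bottom (English notation).\<close>

type_synonym tableau = "nat list list"

definition shape :: "tableau \<Rightarrow> nat list" where
  "shape T = map length T"

definition column_strict :: "tableau \<Rightarrow> bool" where
  "column_strict T \<longleftrightarrow>
     (\<forall>i j. Suc i < length T \<and> j < length (T ! i) \<and> j < length (T ! Suc i)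
        \<longrightarrow> T ! i ! j < T ! Suc i ! j)"

definition SYT :: "nat list \<Rightarrow> tableau set" where
  "SYT lam = {T. shape T = lam \<and> mset (concat T) = mset [1..<Suc (sum_list lam)]
                 \<and> (\<forall>r\<in>set T. sorted_wrt (<) r) \<and> column_strict T}"

definition SSYT :: "nat list \<Rightarrow> tableau set" where
  "SSYT lam = {T. shape T = lam \<and> (\<forall>r\<in>set T. sorted_wrt (\<le>) r) \<and> column_strict T}"

lemma finite_shape_content:
  "finite {T. shape T = lam \<and> mset (concat T) = m}"
proof (rule finite_subset)
  let ?R = "{r. set r \<subseteq> set_mset m \<and> length r \<le> sum_list lam}"
  show "{T. shape T = lam \<and> mset (concat T) = m} \<subseteq> {T. set T \<subseteq> ?R \<and> length T = length lam}"
  proof clarify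
    fix T assume T: "lam = shape T" "m = mset (concat T)"
    have "r \<in> ?R" if r: "r \<in> set T" for r
    proof -
      have "length r \<in> set lam" using T r by (auto simp: shape_def)
      then have "length r \<le> sum_list lam" by (simp add: member_le_sum_list)
      moreover have "set r \<subseteq> set_mset m" using T r by auto
      ultimately show ?thesis by simp
    qed
    then show "set T \<subseteq> {r. set r \<subseteq> set_mset (mset (concat T)) \<and> length r \<le> sum_list (shape T)}
        \<and> length T = length (shape T)"
      using T by (auto simp: shape_def)
  qed
  show "finite {T. set T \<subseteq> ?R \<and> length T = length lam}"
    by (intro finite_lists_length_eq finite_lists_length_le) simp
qed

lemma finite_SYT: "finite (SYT lam)"
  by (rule finite_subset[OF _ finite_shape_content[of lam "mset [1..<Suc (sum_list lam)]"]])
     (auto simp: SYT_def)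

lemma finite_SSYT_content: "finite {T \<in> SSYT lam. mset (concat T) = m}"
  by (rule finite_subset[OF _ finite_shape_content[of lam m]]) (auto simp: SSYT_def)


section \<open>Schur functions\<close>

text \<open>A formal power series with integer coefficients in the variables
  \<open>x\<^sub>0, x\<^sub>1, x\<^sub>2, \<dots>\<close> is represented by its coefficient function: the multiset \<open>m\<close> stands
  for the monomial \<open>\<Prod>i\<in>#m. x\<^sub>i\<close>.  Sums of series are the pointwise sums of
  \<^theory>\<open>HOL-Library.Function_Algebras\<close>.  The Schur function
  \<open>s\<^sub>\<lambda> = \<Sum>T\<in>SSYT \<lambda>. x^T\<close> has as coefficient at \<open>m\<close> the number of semistandard
  tableaux of shape \<open>\<lambda>\<close> with content \<open>m\<close>.\<close>

definition schur :: "nat list \<Rightarrow> nat multiset \<Rightarrow> int" where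
  "schur lam = (\<lambda>m. int (card {T \<in> SSYT lam. mset (concat T) = m}))"


section \<open>Major index and the polynomials \<open>f\<^sup>\<lambda>(q)\<close>\<close>

definition descents :: "tableau \<Rightarrow> nat set" where
  "descents T = {j. \<exists>r r'. r < r' \<and> r' < length T \<and> j \<in> set (T ! r) \<and> Suc j \<in> set (T ! r')}"

definition maj :: "tableau \<Rightarrow> nat" where
  "maj T = \<Sum>(descents T)"

definition fpoly :: "nat list \<Rightarrow> nat poly" where
  "fpoly lam = (\<Sum>T\<in>SYT lam. monom 1 (maj T))"


section \<open>The Robinson--Schensted correspondence\<close>

text \<open>Row insertion returns the new row together with the entry that was bumped out, if any.\<close>

fun row_insert :: "nat \<Rightarrow> nat list \<Rightarrow> nat list \<times> nat option" where
  "row_insert x [] = ([x], None)"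
| "row_insert x (y # ys) =
     (if x < y then (x # ys, Some y)
      else (case row_insert x ys of (ys', b) \<Rightarrow> (y # ys', b)))"

text \<open>Insertion into a tableau also returns the index of the row in which the new cell appears.\<close>

fun tab_insert :: "nat \<Rightarrow> tableau \<Rightarrow> tableau \<times> nat" where
  "tab_insert x [] = ([[x]], 0)"
| "tab_insert x (r # rs) =
     (case row_insert x r of
        (r', None) \<Rightarrow> (r' # rs, 0)
      | (r', Some y) \<Rightarrow> (case tab_insert y rs of (rs', i) \<Rightarrow> (r' # rs', Suc i)))"

definition add_cell :: "nat \<Rightarrow> nat \<Rightarrow> tableau \<Rightarrow> tableau" where
  "add_cell k i T = (if i < length T then T[i := T ! i @ [k]] else T @ [[k]])"

text \<open>The pair \<open>(P, Q)\<close> obtained from the word \<open>\<sigma>(1) \<sigma>(2) \<dots> \<sigma>(n)\<close>.\<close>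

primrec RS :: "nat \<Rightarrow> (nat \<Rightarrow> nat) \<Rightarrow> tableau \<times> tableau" where
  "RS 0 \<sigma> = ([], [])"
| "RS (Suc k) \<sigma> =
     (case RS k \<sigma> of (P, Q) \<Rightarrow>
        (case tab_insert (\<sigma> (Suc k)) P of (P', i) \<Rightarrow> (P', add_cell (Suc k) i Q)))"

definition sh :: "nat \<Rightarrow> (nat \<Rightarrow> nat) \<Rightarrow> nat list" where
  "sh n \<sigma> = shape (fst (RS n \<sigma>))"

lemma length_row_insert:
  "row_insert x r = (r', b) \<Longrightarrow> length r' = (if b = None then Suc (length r) else length r)"
  by (induction x r arbitrary: r' b rule: row_insert.induct) (auto split: if_splits prod.splits)

lemma shape_tab_insert:
  "tab_insert x P = (P', i) \<Longrightarrow> shape Q = shape P \<Longrightarrow> shape (add_cell k i Q) = shape P'"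
proof (induction x P arbitrary: P' i Q rule: tab_insert.induct)
  case (1 x)
  then show ?case by (auto simp: shape_def add_cell_def)
next
  case (2 x r rs)
  from "2.prems"(2) obtain q qs where Q: "Q = q # qs" "length q = length r" "shape qs = shape rs"
    by (auto simp: shape_def Cons_eq_map_conv map_eq_Cons_conv)
  obtain r' b where r': "row_insert x r = (r', b)" by fastforce
  show ?case
  proof (cases b)
    case None
    with 2 r' Q length_row_insert[OF r'] show ?thesis by (auto simp: shape_def add_cell_def)
  next
    case (Some y)
    obtain rs' j where rs': "tab_insert y rs = (rs', j)" by fastforce
    have "shape (add_cell k j qs) = shape rs'" using "2.IH"[OF r'[symmetric] Some rs' Q(3)] .
    with "2.prems" r' Q Some rs' length_row_insert[OF r'] show ?thesis
      by (auto simp: shape_def add_cell_def split: if_splits)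
  qed
qed

lemma sh_eq_shape_recording: "shape (snd (RS n \<sigma>)) = sh n \<sigma>"
  by (induction n) (auto simp: sh_def split: prod.splits intro: shape_tab_insert)


section \<open>Rotation of permutations\<close>

definition \<SS> :: "nat \<Rightarrow> (nat \<Rightarrow> nat) set" where
  "\<SS> n = {\<sigma>. \<sigma> permutes {1..n}}"

definition long_cycle :: "nat \<Rightarrow> nat \<Rightarrow> nat" where
  "long_cycle n = cycle_of_list [1..<Suc n]"

definition rot :: "nat \<Rightarrow> (nat \<Rightarrow> nat) \<Rightarrow> (nat \<Rightarrow> nat)" where
  "rot n \<sigma> = long_cycle n \<circ> \<sigma> \<circ> inv_into UNIV (long_cycle n)"


section \<open>Cyclic sieving\<close>

definition primitive_root_of_unity :: "nat \<Rightarrow> complex \<Rightarrow> bool" where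
  "primitive_root_of_unity n \<xi> \<longleftrightarrow> \<xi> ^ n = 1 \<and> (\<forall>k. 0 < k \<and> k < n \<longrightarrow> \<xi> ^ k \<noteq> 1)"

text \<open>An action of the cyclic group of order \<open>n\<close> on \<open>X\<close> with a chosen generator is the same as
  an element of the group of bijections of \<open>X\<close> whose \<open>n\<close>-th power is the identity.
  The elements of \<^term>\<open>BijGroup X\<close> are extensional functions, hence the restriction of \<open>\<rho>\<close>.
  The power \<open>\<rho>\<^sup>d\<close> is taken in this group, so that \<open>d\<close> ranges over all integers.\<close>

definition exhibits_cyclic_sieving ::
    "nat \<Rightarrow> 'a set \<Rightarrow> ('a \<Rightarrow> 'a) \<Rightarrow> nat poly \<Rightarrow> bool" where
  "exhibits_cyclic_sieving n X \<rho> f \<longleftrightarrow>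
     finite X \<and>
     restrict \<rho> X \<in> carrier (BijGroup X) \<and>
     restrict \<rho> X [^]\<^bsub>BijGroup X\<^esub> n = \<one>\<^bsub>BijGroup X\<^esub> \<and>
     (\<forall>\<xi>. primitive_root_of_unity n \<xi> \<longrightarrow>
        (\<forall>d::int. of_nat (card {x \<in> X. (restrict \<rho> X [^]\<^bsub>BijGroup X\<^esub> d) x = x})
                  = poly (map_poly of_nat f) (\<xi> powi d)))"

end

theory Submission
  imports Defs "HOL-Computational_Algebra.Primes"
begin

text \<open>Fix a partition \<open>\<lambda>\<close> of \<open>n\<close>, a primitive \<open>n\<close>-th root of unity \<open>\<xi>\<close>, and write \<open>d = gcd m n\<close> and
\<open>r = n / d\<close>, so that \<open>\<xi>\<^sup>m\<close> has order \<open>r\<close>.  The value \<open>f\<^sup>\<lambda>(\<xi>\<^sup>m)\<close> is, up to a sign, the number of standard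
\<open>r\<close>-ribbon tableaux of shape \<open>\<lambda>\<close>: the number of ways to reduce \<open>\<lambda>\<close> to the empty partition by
removing \<open>d\<close> rim hooks of length \<open>r\<close>.  On the abacus, where \<open>\<lambda>\<close> is a finite set of beads and
removing a rim hook lowers a bead by \<open>r\<close>, this number is \<open>paths r d {..<n} (beta n \<lambda>)\<close>
(\<open>phi_eq_paths\<close>, \<open>maj_squared_power\<close>).

Three facts then give the theorem.  First, lowering and raising beads satisfy the commutation
relation of a differential poset, whence \<open>\<Sum>\<lambda>. f\<^sup>\<lambda>(\<xi>\<^sup>m)\<^sup>2 = d! r\<^sup>d\<close> (\<open>sum_paths_squared\<close>).
This is also the order of the centralizer of the \<open>d\<close>-th power of the long cycle, that is, the number
of permutations fixed by the \<open>d\<close>-th power of the rotation (\<open>card_rot_fixed\<close>).  So the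
polynomials \<open>f\<^sup>\<lambda>(q)\<^sup>2\<close> taken together predict the right numbers of fixed points.

Secondly, each single \<open>\<lambda>\<close> predicts the fixed points of some action of the cyclic group.  The
numbers of orbits of the sizes \<open>k dvd n\<close> which such an action must have are determined by inversion
over divisors.  They are integers because \<open>d \<mapsto> f\<^sup>\<lambda>(\<xi>\<^sup>d)\<^sup>2\<close> is a rational-valued character
(\<open>orbit_count_Ints\<close>).  They are nonnegative because ribbon tableaux become much rarer when the
ribbons grow: replacing ribbons of length \<open>r\<close> by ribbons of length \<open>p r\<close> divides their number by at
least \<open>p - 1\<close> for a prime \<open>p \<ge> 3\<close>, and by at least \<open>3/2\<close> for \<open>p = 2\<close> and at least three long
ribbons, except if there is only one tableau (\<open>ribbon_ratio\<close>, \<open>domino_ratio\<close>, \<open>orbit_count_paths_nonneg\<close>).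

Thirdly, since the orbit numbers of all \<open>\<lambda>\<close> sum up to those of the rotation, the orbits of the
rotation can be distributed among the partitions accordingly (\<open>invariant_statistic_exists\<close>); the
partition that an orbit receives is the value of the statistic.

For the equidistribution the identity power is used: both fibres over \<open>\<lambda>\<close> have \<open>(f\<^sup>\<lambda>(1))\<^sup>2\<close>
elements.  For the Robinson--Schensted shape it suffices to know that insertion is injective, since
the resulting upper bounds have the sum \<open>n!\<close> (\<open>sh_count\<close>).\<close>

section \<open>Moving beads on an abacus\<close>

text \<open>A partition with at most \<open>l\<close> parts is encoded by the \<open>l\<close>-element set
\<open>B = {\<lambda>\<^sub>i + l - i | i = 1, \<dots>, l}\<close> of beads on the positions \<open>0, 1, 2, \<dots>\<close>; the empty partition is
\<open>{..<l}\<close>.  Its removable rim hooks of length \<open>r\<close> correspond to the positions in \<open>holes r B\<close>, and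
removing one of them gives \<open>lower r c B\<close>.\<close>

definition holes :: "nat \<Rightarrow> nat set \<Rightarrow> nat set" where
  "holes r B = {c. c \<notin> B \<and> c + r \<in> B}"

definition lower :: "nat \<Rightarrow> nat \<Rightarrow> nat set \<Rightarrow> nat set" where
  "lower r c B = insert c (B - {c + r})"

text \<open>In terms of partitions this is the number of standard \<open>r\<close>-ribbon tableaux with \<open>d\<close> ribbons on the
skew shape from \<open>A\<close> to \<open>B\<close>; for \<open>r = 1\<close> and \<open>A = {..<l}\<close> these are the standard Young tableaux.\<close>

primrec paths :: "nat \<Rightarrow> nat \<Rightarrow> nat set \<Rightarrow> nat set \<Rightarrow> nat" where
  "paths r 0 A B = (if B = A then 1 else 0)"
| "paths r (Suc d) A B = (\<Sum>c\<in>holes r B. paths r d A (lower r c B))"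

lemma finite_holes: "finite B \<Longrightarrow> finite (holes r B)"
proof -
  assume "finite B"
  then have "finite ((\<lambda>c. c + r) -` B)" by (intro finite_vimageI) (auto simp: inj_on_def)
  then show ?thesis by (rule finite_subset[rotated]) (auto simp: holes_def)
qed

lemma finite_lower: "finite B \<Longrightarrow> finite (lower r c B)"
  by (simp add: lower_def)

lemma inj_on_lower: "inj_on (\<lambda>c. lower r c B) (holes r B)"
  by (rule inj_onI) (auto simp: holes_def lower_def)

text \<open>A path is determined by its intermediate position and its two halves.  Equality would need all
intermediate positions in \<open>S\<close>; the inequality is the form in which the estimates below use it.\<close>

lemma paths_add_ge:
  assumes "finite B" "finite S"
  shows "(\<Sum>C\<in>S. paths r i A C * paths r j C B) \<le> paths r (i + j) A B"
  using assms(1)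
proof (induction j arbitrary: B)
  case 0
  then show ?case using assms(2) by (simp add: sum.delta if_distrib[of "\<lambda>x. _ * x"] cong: if_cong)
next
  case (Suc j)
  have "(\<Sum>C\<in>S. paths r i A C * paths r (Suc j) C B)
      = (\<Sum>c\<in>holes r B. \<Sum>C\<in>S. paths r i A C * paths r j C (lower r c B))"
    by (simp add: sum_distrib_left) (rule sum.swap)
  also have "\<dots> \<le> (\<Sum>c\<in>holes r B. paths r (i + j) A (lower r c B))"
    by (intro sum_mono Suc.IH finite_lower Suc.prems)
  finally show ?case by simp
qed

lemma paths_add_ge1:
  assumes "finite B"
  shows "paths r i A C * paths r j C B \<le> paths r (i + j) A B"
  using paths_add_ge[OF assms, of "{C}" r i A j] by simp

lemma paths_Suc_ge1:
  assumes "finite B" "c \<in> holes r B"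
  shows "paths r d A (lower r c B) \<le> paths r (Suc d) A B"
  using member_le_sum[OF assms(2), of "\<lambda>c. paths r d A (lower r c B)"] assms(1)
  by (simp add: finite_holes)

lemma paths_Suc_ge2:
  assumes "finite B" "c \<in> holes r B" "c' \<in> holes r B" "c \<noteq> c'"
  shows "paths r d A (lower r c B) + paths r d A (lower r c' B) \<le> paths r (Suc d) A B"
proof -
  have "(\<Sum>x\<in>{c,c'}. paths r d A (lower r x B)) \<le> (\<Sum>x\<in>holes r B. paths r d A (lower r x B))"
    by (rule sum_mono2) (use assms in \<open>auto simp: finite_holes\<close>)
  then show ?thesis using assms(4) by simp
qed

text \<open>A move by \<open>p * r\<close> splits into \<open>p\<close> moves by \<open>r\<close>, even if beads stand on the positions in between: then
the lower of two neighbouring beads moves first and the upper one takes its place.\<close>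

lemma ribbon_ge1:
  assumes "finite B" "c \<in> holes (p * r) B" "r > 0"
  shows "paths r p (lower (p * r) c B) B \<ge> 1"
  using assms(1,2)
proof (induction p arbitrary: c B)
  case 0
  then show ?case by (auto simp: holes_def)
next
  case (Suc p)
  show ?case
  proof (cases "p = 0")
    case True
    then show ?thesis using Suc.prems paths_Suc_ge1[of B c r 0 "lower r c B"] by simp
  next
    case p: False
    have ne: "c + r \<noteq> c + Suc p * r" using p assms(3) by simp
    show ?thesis
    proof (cases "c + r \<in> B")
      case True
      let ?D = "lower r c B"
      have cr: "c \<in> holes r B" using True Suc.prems by (auto simp: holes_def)
      have c2: "c + r \<in> holes (p * r) ?D"
        using Suc.prems True ne assms(3) by (auto simp: holes_def lower_def algebra_simps)
      have eq: "lower (p * r) (c + r) ?D = lower (Suc p * r) c B"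
        using Suc.prems True ne by (auto simp: lower_def holes_def algebra_simps)
      have "1 \<le> paths r p (lower (Suc p * r) c B) ?D"
        using Suc.IH[OF finite_lower[OF Suc.prems(1)] c2] by (simp only: eq)
      also have "\<dots> \<le> paths r (Suc p) (lower (Suc p * r) c B) B"
        by (rule paths_Suc_ge1[OF Suc.prems(1) cr])
      finally show ?thesis .
    next
      case False
      let ?D = "lower (p * r) (c + r) B"
      have c2: "c + r \<in> holes (p * r) B"
        using Suc.prems False by (auto simp: holes_def algebra_simps)
      have fD: "finite ?D" by (simp add: finite_lower Suc.prems)
      have cr: "c \<in> holes r ?D" using Suc.prems ne assms(3) by (auto simp: holes_def lower_def)
      have eq: "lower r c ?D = lower (Suc p * r) c B"
        using Suc.prems False ne by (auto simp: lower_def holes_def algebra_simps)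
      have "1 * 1 \<le> paths r 1 (lower (Suc p * r) c B) ?D * paths r p ?D B"
        using Suc.IH[OF Suc.prems(1) c2] paths_Suc_ge1[OF fD cr, of 0 "lower r c ?D"]
        by (intro mult_le_mono) (simp_all only: eq paths.simps One_nat_def, simp)
      also have "\<dots> \<le> paths r (1 + p) (lower (Suc p * r) c B) B"
        by (rule paths_add_ge1[OF Suc.prems(1)])
      finally show ?thesis by simp
    qed
  qed
qed

lemma ribbon_sum_le:
  assumes "finite B" "r > 0"
  shows "(\<Sum>c\<in>holes (p * r) B. paths r k A (lower (p * r) c B)) \<le> paths r (k + p) A B"
proof -
  let ?S = "(\<lambda>c. lower (p * r) c B) ` holes (p * r) B"
  have "(\<Sum>c\<in>holes (p * r) B. paths r k A (lower (p * r) c B)) = (\<Sum>C\<in>?S. paths r k A C)"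
    by (simp add: sum.reindex[OF inj_on_lower])
  also have "\<dots> \<le> (\<Sum>C\<in>?S. paths r k A C * paths r p C B)"
    by (rule sum_mono) (use ribbon_ge1[OF assms(1) _ assms(2)] in fastforce)
  also have "\<dots> \<le> paths r (k + p) A B"
    by (rule paths_add_ge[OF assms(1)]) (simp add: finite_holes assms(1))
  finally show ?thesis .
qed

text \<open>Splitting every long move into short ones is injective on paths, because the two positions before
and after a long move determine it.\<close>

lemma ribbon_paths_le:
  assumes "finite B" "r > 0"
  shows "paths (p * r) K A B \<le> paths r (p * K) A B"
  using assms(1)
proof (induction K arbitrary: B)
  case (Suc K)
  have "paths (p * r) (Suc K) A B \<le> (\<Sum>c\<in>holes (p * r) B. paths r (p * K) A (lower (p * r) c B))"
    by (simp, intro sum_mono Suc.IH finite_lower Suc.prems)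
  also have "\<dots> \<le> paths r (p * K + p) A B" by (rule ribbon_sum_le[OF Suc.prems assms(2)])
  finally show ?case by (simp add: add.commute)
qed simp

lemma lower_commute:
  assumes "c \<in> holes r B" "c' \<in> holes r B" "c \<noteq> c'"
  shows "c' \<in> holes r (lower r c B)" "lower r c' (lower r c B) = lower r c (lower r c' B)"
  using assms by (auto simp: holes_def lower_def)

lemma holes_lessThan [simp]: "holes r {..<l} = {}"
  by (auto simp: holes_def)

lemma paths_posE:
  assumes "paths r (Suc k) A B > 0"
  obtains c where "c \<in> holes r B" "paths r k A (lower r c B) > 0"
proof -
  have "\<exists>c\<in>holes r B. paths r k A (lower r c B) \<noteq> 0"
  proof (rule ccontr)
    assume "\<not> ?thesis"
    then have "paths r (Suc k) A B = 0" by (simp add: sum.neutral)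
    with assms show False by simp
  qed
  then show ?thesis using that by auto
qed

text \<open>If a position can be reduced to \<open>{..<l}\<close> at all, then every legal first move can be completed,
since moves at different holes commute: a form of the uniqueness of the \<open>r\<close>-core.\<close>

lemma paths_lower_pos:
  assumes "finite B" "paths r (Suc k) {..<l} B > 0" "c \<in> holes r B"
  shows "paths r k {..<l} (lower r c B) > 0"
  using assms
proof (induction k arbitrary: B c)
  case 0
  from paths_posE[OF 0(2)] obtain c' where "c' \<in> holes r B" "paths r 0 {..<l} (lower r c' B) > 0"
    by blast
  then have c': "c' \<in> holes r B" "lower r c' B = {..<l}" by (auto split: if_splits)
  have "c' = c"
  proof (rule ccontr)
    assume "c' \<noteq> c"
    from lower_commute(1)[OF c'(1) 0(3) this] show False using c'(2) by simp
  qed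
  then show ?case using c' by simp
next
  case (Suc k)
  from Suc.prems obtain c' where c': "c' \<in> holes r B" "paths r (Suc k) {..<l} (lower r c' B) > 0"
    by (blast elim: paths_posE)
  show ?case
  proof (cases "c' = c")
    case False
    have "0 < paths r k {..<l} (lower r c (lower r c' B))"
      by (rule Suc.IH[OF _ c'(2) lower_commute(1)[OF c'(1) Suc.prems(3) False]])
        (simp add: finite_lower Suc.prems)
    also have "\<dots> = paths r k {..<l} (lower r c' (lower r c B))"
      using lower_commute(2)[OF c'(1) Suc.prems(3) False] by simp
    also have "\<dots> \<le> paths r (Suc k) {..<l} (lower r c B)"
      using lower_commute(1)[OF Suc.prems(3) c'(1)] False Suc.prems(1)
      by (intro paths_Suc_ge1) (auto simp: finite_lower)
    finally show ?thesis .
  qed (use c' in simp)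
qed

text \<open>Conjugation of partitions: beads and gaps are exchanged and the abacus is read backwards.\<close>

definition dual :: "nat \<Rightarrow> nat set \<Rightarrow> nat set" where
  "dual l B = {b. b < 2 * l \<and> 2 * l - 1 - b \<notin> B}"

lemma dual_dual: "B \<subseteq> {..<2*l} \<Longrightarrow> dual l (dual l B) = B"
  by (auto simp: dual_def)

lemma dual_subset: "dual l B \<subseteq> {..<2*l}"
  by (auto simp: dual_def)

lemma dual_lessThan: "dual l {..<l} = {..<l}"
  by (auto simp: dual_def)

lemma lower_subset: "c \<in> holes r B \<Longrightarrow> B \<subseteq> {..<N} \<Longrightarrow> lower r c B \<subseteq> {..<N}"
  by (auto simp: holes_def lower_def)

lemma holes_dual:
  assumes "B \<subseteq> {..<2*l}" "c \<in> holes r B"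
  shows "2*l - 1 - (c + r) \<in> holes r (dual l B)"
    and "lower r (2*l - 1 - (c + r)) (dual l B) = dual l (lower r c B)"
proof -
  have lt: "c + r < 2*l" using assms by (auto simp: holes_def)
  have c: "c \<notin> B" "c + r \<in> B" using assms by (auto simp: holes_def)
  have e1: "2*l - 1 - (c + r) + r = 2*l - 1 - c" using lt by simp
  have e2: "2*l - 1 - (2*l - 1 - (c + r)) = c + r" "2*l - 1 - (2*l - 1 - c) = c" using lt by auto
  show "2*l - 1 - (c + r) \<in> holes r (dual l B)"
    unfolding holes_def dual_def mem_Collect_eq e1 e2 using lt c by auto
  show "lower r (2*l - 1 - (c + r)) (dual l B) = dual l (lower r c B)"
  proof (rule Set.set_eqI)
    fix b
    have "2*l - 1 - b = c + r \<longleftrightarrow> b = 2*l - 1 - (c + r)" if "b < 2*l" using lt that by auto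
    moreover have "2*l - 1 - b = c \<longleftrightarrow> b = 2*l - 1 - c" if "b < 2*l" using lt that by auto
    ultimately show "b \<in> lower r (2*l - 1 - (c + r)) (dual l B) \<longleftrightarrow> b \<in> dual l (lower r c B)"
      unfolding lower_def e1 dual_def using lt c by auto
  qed
qed

lemma paths_dual:
  assumes "B \<subseteq> {..<2*l}"
  shows "paths r d {..<l} (dual l B) = paths r d {..<l} B"
  using assms
proof (induction d arbitrary: B)
  case 0
  then show ?case using dual_dual[of B l] dual_lessThan[of l] by auto
next
  case (Suc d)
  have "(\<Sum>c\<in>holes r (dual l B). paths r d {..<l} (lower r c (dual l B)))
      = (\<Sum>c\<in>holes r B. paths r d {..<l} (lower r c B))"
  proof (rule sum.reindex_bij_witness[where i = "\<lambda>c. 2*l - 1 - (c + r)" and j = "\<lambda>c. 2*l - 1 - (c + r)"])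
    fix c assume "c \<in> holes r (dual l B)"
    then show "2*l - 1 - (c + r) \<in> holes r B" "2*l - 1 - (2*l - 1 - (c + r) + r) = c"
        "paths r d {..<l} (lower r (2*l - 1 - (c + r)) B) = paths r d {..<l} (lower r c (dual l B))"
      using holes_dual[OF dual_subset, of c r l B] dual_dual[OF Suc.prems]
        Suc.IH[OF lower_subset[OF _ dual_subset, of c r l B]]
      by (auto simp: holes_def dual_def intro!: Suc.IH)
  next
    fix c assume c: "c \<in> holes r B"
    then show "2*l - 1 - (c + r) \<in> holes r (dual l B)" by (rule holes_dual(1)[OF Suc.prems])
    show "2*l - 1 - (2*l - 1 - (c + r) + r) = c" using c Suc.prems by (auto simp: holes_def)
  qed
  then show ?case by simp
qed

section \<open>The sum of the squared path numbers\<close>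

text \<open>The bead sets of the partitions of \<open>s\<close> with at most \<open>l\<close> parts.\<close>

definition level :: "nat \<Rightarrow> nat \<Rightarrow> nat set set" where
  "level l s = {B. finite B \<and> card B = l \<and> \<Sum>B = \<Sum>{..<l} + s}"

lemma finite_level: "finite (level l s)"
proof (rule finite_subset)
  show "level l s \<subseteq> Pow {..\<Sum>{..<l} + s}"
  proof (intro subsetI PowI)
    fix B x assume "B \<in> level l s" "x \<in> B"
    then show "x \<in> {..\<Sum>{..<l} + s}"
      using member_le_sum[of x B "\<lambda>x. x"] by (simp add: level_def)
  qed
qed simp

abbreviation raise :: "nat \<Rightarrow> nat \<Rightarrow> nat set \<Rightarrow> nat set" where
  "raise r c B \<equiv> insert (c + r) (B - {c})"

lemma sum_move:
  fixes B :: "nat set"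
  assumes "finite B" "c \<notin> B" "c + r \<in> B"
  shows "\<Sum>(lower r c B) + r = \<Sum>B" "card (lower r c B) = card B"
proof -
  have "\<Sum>B = (c + r) + \<Sum>(B - {c + r})" using assms by (simp add: sum.remove)
  moreover have "\<Sum>(lower r c B) = c + \<Sum>(B - {c + r})" unfolding lower_def
    using assms by (subst sum.insert) auto
  ultimately show "\<Sum>(lower r c B) + r = \<Sum>B" by simp
  show "card (lower r c B) = card B"
    unfolding lower_def using assms card_Suc_Diff1[of B "c + r"] by (subst card_insert_disjoint) auto
qed

lemma lower_level:
  assumes "B \<in> level l (s + r)" "c \<in> holes r B"
  shows "lower r c B \<in> level l s"
  using assms sum_move[of B c r] by (auto simp: level_def holes_def finite_lower)

lemma raise_level:
  assumes "B \<in> level l s" "c \<in> B" "c + r \<notin> B" "r > 0"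
  shows "raise r c B \<in> level l (s + r)"
proof -
  have "lower r c (raise r c B) = B" using assms by (auto simp: lower_def)
  then show ?thesis using assms sum_move[of "raise r c B" c r] by (auto simp: level_def)
qed

text \<open>Pushing \<open>card A\<close> beads to the bottom can only decrease their sum; the largest element is at least
\<open>card A - 1\<close> and is removed in the induction.\<close>

lemma sum_lessThan_card_le:
  fixes A :: "nat set"
  assumes "finite A"
  shows "\<Sum>{..<card A} \<le> \<Sum>A"
  using assms
proof (induction "card A" arbitrary: A)
  case (Suc n)
  then have ne: "A \<noteq> {}" by auto
  have "n \<le> Max A"
  proof -
    have "A \<subseteq> {..Max A}" using Suc.prems by auto
    from card_mono[OF _ this] show ?thesis using Suc.hyps(2) by simp
  qed
  moreover have "\<Sum>A = Max A + \<Sum>(A - {Max A})"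
    using sum.remove[of A "Max A" "\<lambda>x. x"] Suc.prems ne by simp
  moreover have "\<Sum>{..<card (A - {Max A})} \<le> \<Sum>(A - {Max A})"
    using Suc.hyps(2) Suc.prems ne by (intro Suc.hyps(1)) auto
  moreover have "card (A - {Max A}) = n" using Suc.hyps(2) Suc.prems ne by simp
  ultimately show ?case using Suc.hyps(2)[symmetric] by (simp add: lessThan_Suc)
qed simp

text \<open>The partition has at most \<open>s \<le> l - r\<close> nonzero parts, so its last \<open>r\<close> beads have not moved.\<close>

lemma level_bottom:
  assumes "B \<in> level l s" "s + r \<le> l"
  shows "{..<r} \<subseteq> B"
proof
  fix m assume m: "m \<in> {..<r}"
  show "m \<in> B"
  proof (rule ccontr)
    assume "m \<notin> B"
    have B: "finite B" "card B = l" "\<Sum>B = \<Sum>{..<l} + s" using assms by (auto simp: level_def)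
    have "\<Sum>{..<Suc l} \<le> \<Sum>(insert m B)" using sum_lessThan_card_le[of "insert m B"] B \<open>m \<notin> B\<close> by simp
    then have "l \<le> m + s" using B \<open>m \<notin> B\<close> by (simp add: lessThan_Suc)
    then show False using m assms(2) by auto
  qed
qed

text \<open>On every one of the \<open>r\<close> residue classes, raisable beads and holes alternate as long as the lowest
position is occupied, starting and ending with a raisable bead.  So there is one more of the former.
The proof counts beads instead: \<open>B\<close> consists of its bottom part and of the beads that stand \<open>r\<close>
above some bead or hole.\<close>

lemma card_ups_holes:
  assumes "finite B" "{..<r} \<subseteq> B"
  shows "card {c\<in>B. c + r \<notin> B} = card (holes r B) + r"
proof -
  have 1: "card B = card {c\<in>B. c + r \<notin> B} + card {c\<in>B. c + r \<in> B}"
    using assms(1) by (subst card_Un_disjoint[symmetric]) (auto intro!: arg_cong[where f=card])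
  \<comment> \<open>The beads above the bottom row, each seen from the position \<open>r\<close> below it.\<close>
  have im: "B = {..<r} \<union> ((\<lambda>c. c + r) ` {c. c + r \<in> B})"
  proof (intro equalityI subsetI)
    fix b assume "b \<in> B"
    then show "b \<in> {..<r} \<union> ((\<lambda>c. c + r) ` {c. c + r \<in> B})"
      by (cases "b < r") (auto simp: image_iff intro!: exI[of _ "b - r"])
  qed (use assms in auto)
  have fin: "finite {c. c + r \<in> B}"
    using finite_vimageI[of B "\<lambda>c. c + r"] assms(1) by (simp add: vimage_def inj_on_def)
  have "card B = r + card {c. c + r \<in> B}"
    by (subst im, subst card_Un_disjoint) (auto simp: fin card_image inj_on_def)
  also have "card {c. c + r \<in> B} = card {c\<in>B. c + r \<in> B} + card (holes r B)"
    unfolding holes_def using fin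
    by (subst card_Un_disjoint[symmetric]) (auto intro!: arg_cong[where f=card])
  finally show ?thesis using 1 by simp
qed

text \<open>Raising at \<open>c\<close> and lowering at \<open>c' \<noteq> c\<close> commute, while the moves that undo each other are counted by
\<open>card_ups_holes\<close>: with the operators \<open>U\<close> (raise) and \<open>D\<close> (lower) this is \<open>D U - U D = r\<close>.  Iterating
gives \<open>D\<^bsup>d+1\<^esup> U = U D\<^bsup>d+1\<^esup> + r (d + 1) D\<^sup>d\<close>, and the first summand does not reach \<open>{..<l}\<close>, which is
not the result of raising a bead.  The bound on \<open>l\<close> keeps enough unmoved beads at the bottom.\<close>

lemma up_down:
  assumes "B \<in> level l (r * d)" "r * Suc d \<le> l" "r > 0"
  shows "(\<Sum>c | c \<in> B \<and> c + r \<notin> B. paths r (Suc d) {..<l} (raise r c B))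
       = r * Suc d * paths r d {..<l} B"
  using assms(1,2)
proof (induction d arbitrary: B)
  case 0
  have B: "finite B" "{..<r} \<subseteq> B" using 0 level_bottom[of B l 0 r] by (auto simp: level_def)
  show ?case
  proof (cases "B = {..<l}")
    case False
    have "paths r (Suc 0) {..<l} (raise r c B) = 0" if c: "c \<in> B" "c + r \<notin> B" for c
    proof (rule ccontr)
      assume "paths r (Suc 0) {..<l} (raise r c B) \<noteq> 0"
      moreover have "c \<in> holes r (raise r c B)" using c \<open>r > 0\<close> by (auto simp: holes_def)
      ultimately have "0 < paths r 0 {..<l} (lower r c (raise r c B))"
        by (intro paths_lower_pos) (use B in auto)
      moreover have "lower r c (raise r c B) = B" using c \<open>r > 0\<close> by (auto simp: lower_def)
      ultimately show False using False by simp
    qed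
    then show ?thesis using False by (simp del: paths.simps(2))
  next
    case True
    have "paths r (Suc 0) {..<l} (raise r c B) = 1" if c: "c \<in> B" "c + r \<notin> B" for c
    proof -
      have "holes r (raise r c B) = {c}" using c \<open>r > 0\<close> True by (auto simp: holes_def)
      moreover have "lower r c (raise r c B) = B" using c \<open>r > 0\<close> by (auto simp: lower_def)
      ultimately show ?thesis using True by simp
    qed
    then show ?thesis using card_ups_holes[OF B] True by (simp del: paths.simps(2))
  qed
next
  case (Suc d)
  let ?A = "{..<l}"
  let ?U = "\<lambda>B. {c. c \<in> B \<and> c + r \<notin> B}"
  have B: "finite B" using Suc.prems by (auto simp: level_def)
  have bot: "{..<r} \<subseteq> B"
    using level_bottom[OF Suc.prems(1), of r] Suc.prems(2) by (simp add: algebra_simps)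
  \<comment> \<open>Pairs of different moves, raising first in \<open>?S\<close> and lowering first in \<open>?T\<close>; the pairs with equal
    moves are split off below and return to \<open>B\<close>.\<close>
  let ?S = "SIGMA c : ?U B. holes r (raise r c B) - {c}"
  let ?T = "SIGMA c : holes r B. ?U (lower r c B) - {c}"
  have fin: "finite (?U B')" if "finite B'" for B' :: "nat set" using that by simp
  have "(\<Sum>c\<in>?U B. paths r (Suc (Suc d)) ?A (raise r c B))
     = (\<Sum>c\<in>?U B. paths r (Suc d) ?A B + (\<Sum>c'\<in>holes r (raise r c B) - {c}. paths r (Suc d) ?A (lower r c' (raise r c B))))"
  proof (rule sum.cong[OF refl])
    fix c assume c: "c \<in> ?U B"
    then have "c \<in> holes r (raise r c B)" "lower r c (raise r c B) = B"
      using \<open>r > 0\<close> by (auto simp: holes_def lower_def)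
    then show "paths r (Suc (Suc d)) ?A (raise r c B) = paths r (Suc d) ?A B
      + (\<Sum>c'\<in>holes r (raise r c B) - {c}. paths r (Suc d) ?A (lower r c' (raise r c B)))"
      using B by (subst paths.simps(2), subst sum.remove[of _ c]) (auto simp: finite_holes simp del: paths.simps(2))
  qed
  also have "\<dots> = (card (holes r B) + r) * paths r (Suc d) ?A B
      + (\<Sum>(c,c')\<in>?S. paths r (Suc d) ?A (lower r c' (raise r c B)))"
    using card_ups_holes[OF B bot] B
    by (subst sum.Sigma[symmetric]) (auto simp: sum.distrib finite_holes simp del: paths.simps(2))
  also have "(\<Sum>(c,c')\<in>?S. paths r (Suc d) ?A (lower r c' (raise r c B)))
      = (\<Sum>(c,c')\<in>?T. paths r (Suc d) ?A (raise r c' (lower r c B)))"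
  proof (rule sum.reindex_bij_witness[where i = "\<lambda>(a,b). (b,a)" and j = "\<lambda>(a,b). (b,a)"], goal_cases)
    case (2 x) then show ?case using \<open>r > 0\<close> by (auto simp: holes_def lower_def)
  next
    case (4 x) then show ?case using \<open>r > 0\<close> by (auto simp: holes_def lower_def)
  next
    case (5 x)
    then obtain a b where x: "x = (a, b)" "a \<in> ?U B" "b \<in> holes r (raise r a B)" "b \<noteq> a" by auto
    have "lower r b (raise r a B) = raise r a (lower r b B)"
      using x \<open>r > 0\<close> by (auto simp: holes_def lower_def)
    then show ?case using x by simp
  qed auto
  also have "(card (holes r B) + r) * paths r (Suc d) ?A B + (\<Sum>(c,c')\<in>?T. paths r (Suc d) ?A (raise r c' (lower r c B)))
     = r * paths r (Suc d) ?A B + (\<Sum>c\<in>holes r B. \<Sum>c'\<in>?U (lower r c B). paths r (Suc d) ?A (raise r c' (lower r c B)))"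
  proof -
    have "(\<Sum>c\<in>holes r B. \<Sum>c'\<in>?U (lower r c B). paths r (Suc d) ?A (raise r c' (lower r c B)))
      = (\<Sum>c\<in>holes r B. paths r (Suc d) ?A B + (\<Sum>c'\<in>?U (lower r c B) - {c}. paths r (Suc d) ?A (raise r c' (lower r c B))))"
    proof (rule sum.cong[OF refl])
      fix c assume c: "c \<in> holes r B"
      then have "c \<in> ?U (lower r c B)" "raise r c (lower r c B) = B"
        using \<open>r > 0\<close> by (auto simp: holes_def lower_def)
      then show "(\<Sum>c'\<in>?U (lower r c B). paths r (Suc d) ?A (raise r c' (lower r c B))) = paths r (Suc d) ?A B
        + (\<Sum>c'\<in>?U (lower r c B) - {c}. paths r (Suc d) ?A (raise r c' (lower r c B)))"
        using fin[OF finite_lower[OF B]] by (subst sum.remove[of _ c]) (auto simp del: paths.simps(2))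
    qed
    also have "\<dots> = card (holes r B) * paths r (Suc d) ?A B + (\<Sum>(c,c')\<in>?T. paths r (Suc d) ?A (raise r c' (lower r c B)))"
      using B by (subst sum.Sigma[symmetric]) (auto simp: sum.distrib finite_holes finite_lower simp del: paths.simps(2))
    finally show ?thesis by (simp add: algebra_simps del: paths.simps(2))
  qed
  also have "(\<Sum>c\<in>holes r B. \<Sum>c'\<in>?U (lower r c B). paths r (Suc d) ?A (raise r c' (lower r c B)))
     = (\<Sum>c\<in>holes r B. r * Suc d * paths r d ?A (lower r c B))"
  proof (rule sum.cong[OF refl])
    fix c assume c: "c \<in> holes r B"
    show "(\<Sum>c'\<in>?U (lower r c B). paths r (Suc d) ?A (raise r c' (lower r c B))) = r * Suc d * paths r d ?A (lower r c B)"
    proof (rule Suc.IH)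
      show "lower r c B \<in> level l (r * d)"
        using lower_level[of B l "r * d" r c] Suc.prems(1) c by (simp add: add.commute)
      show "r * Suc d \<le> l" using Suc.prems(2) by simp
    qed
  qed
  also have "\<dots> = r * Suc d * paths r (Suc d) ?A B" by (simp add: sum_distrib_left)
  finally show ?case by (simp add: algebra_simps del: paths.simps(2))
qed

text \<open>Stanley's argument for differential posets: one factor \<open>paths\<close> is unfolded into its last move,
the double sum is reordered by the smaller position, and \<open>up_down\<close> evaluates the inner sum.\<close>

theorem sum_paths_squared:
  assumes "r * d \<le> l" "r > 0"
  shows "(\<Sum>B\<in>level l (r * d). (paths r d {..<l} B)\<^sup>2) = fact d * r ^ d"
  using assms(1)
proof (induction d)
  case 0
  have "{..<l} \<in> level l 0" by (simp add: level_def)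
  then have "(\<Sum>B\<in>level l 0. (if B = {..<l} then 1 else 0 :: nat)) = 1" by (simp add: finite_level)
  then show ?case by (simp add: if_distrib[of "\<lambda>x. x\<^sup>2"] cong: if_cong)
next
  case (Suc d)
  let ?A = "{..<l}"
  let ?S = "SIGMA B : level l (r * Suc d). holes r B"
  let ?T = "SIGMA B : level l (r * d). {c. c \<in> B \<and> c + r \<notin> B}"
  have fl: "finite B" if "B \<in> level l s" for B s using that by (simp add: level_def)
  have lv: "lower r c B \<in> level l (r * d)" if "B \<in> level l (r * Suc d)" "c \<in> holes r B" for B c
    using lower_level[of B l "r * d" r c] that by (simp add: add.commute)
  have rv: "raise r c B \<in> level l (r * Suc d)" if "B \<in> level l (r * d)" "c \<in> B" "c + r \<notin> B" for B c
    using raise_level[of B l "r * d" c r] that assms(2) by (simp add: add.commute)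
  have "(\<Sum>B\<in>level l (r * Suc d). (paths r (Suc d) ?A B)\<^sup>2)
    = (\<Sum>B\<in>level l (r * Suc d). \<Sum>c\<in>holes r B. paths r (Suc d) ?A B * paths r d ?A (lower r c B))"
    by (simp add: power2_eq_square sum_distrib_left)
  also have "\<dots> = (\<Sum>(B,c)\<in>?S. paths r (Suc d) ?A B * paths r d ?A (lower r c B))"
    by (rule sum.Sigma) (auto simp: finite_level finite_holes fl)
  also have "\<dots> = (\<Sum>(B,c)\<in>?T. paths r (Suc d) ?A (raise r c B) * paths r d ?A B)"
  proof (rule sum.reindex_bij_witness[where i = "\<lambda>(B,c). (raise r c B, c)" and j = "\<lambda>(B,c). (lower r c B, c)"], goal_cases)
    case (1 x) then show ?case using assms(2) by (auto simp: holes_def lower_def)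
  next
    case (2 x) then show ?case using assms(2) lv by (auto simp: holes_def lower_def)
  next
    case (3 x) then show ?case using assms(2) by (auto simp: holes_def lower_def)
  next
    case (4 x) then show ?case using assms(2) rv by (auto simp: holes_def lower_def)
  next
    case (5 x)
    then obtain B c where x: "x = (B, c)" "c \<in> holes r B" by auto
    have "raise r c (lower r c B) = B" using x(2) assms(2) by (auto simp: holes_def lower_def)
    then show ?case using x by (simp del: paths.simps(2))
  qed
  also have "\<dots> = (\<Sum>B\<in>level l (r * d). \<Sum>c | c \<in> B \<and> c + r \<notin> B. paths r (Suc d) ?A (raise r c B) * paths r d ?A B)"
    by (rule sum.Sigma[symmetric]) (auto simp: finite_level dest: fl)
  also have "\<dots> = (\<Sum>B\<in>level l (r * d). r * Suc d * (paths r d ?A B)\<^sup>2)"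
  proof (rule sum.cong[OF refl])
    fix B assume B: "B \<in> level l (r * d)"
    have "(\<Sum>c | c \<in> B \<and> c + r \<notin> B. paths r (Suc d) ?A (raise r c B) * paths r d ?A B)
        = (\<Sum>c | c \<in> B \<and> c + r \<notin> B. paths r (Suc d) ?A (raise r c B)) * paths r d ?A B"
      by (simp only: sum_distrib_right)
    also have "\<dots> = r * Suc d * (paths r d ?A B)\<^sup>2"
      by (simp only: up_down[OF B Suc.prems assms(2)] power2_eq_square mult.assoc)
    finally show "(\<Sum>c | c \<in> B \<and> c + r \<notin> B. paths r (Suc d) ?A (raise r c B) * paths r d ?A B)
      = r * Suc d * (paths r d ?A B)\<^sup>2" .
  qed
  also have "\<dots> = r * Suc d * (fact d * r ^ d)"
    using Suc by (simp add: sum_distrib_left[symmetric])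
  finally show ?case by (simp add: algebra_simps)
qed

section \<open>Path numbers of positions with few displaced beads\<close>

text \<open>One bead raised from \<open>x\<close> by \<open>m\<close>: a hook shape, and a single row if \<open>x\<close> is the topmost bead of its
residue class and \<open>m\<close> is a multiple of the modulus considered.\<close>

definition row :: "nat \<Rightarrow> nat \<Rightarrow> nat \<Rightarrow> nat set" where
  "row l x m = insert (x + m) ({..<l} - {x})"

lemma finite_row [simp]: "finite (row l x m)"
  by (simp add: row_def)

lemma row_0: "x < l \<Longrightarrow> row l x 0 = {..<l}"
  by (auto simp: row_def)

lemma row_paths:
  assumes "x < l" "l \<le> x + r"
  shows "paths r N {..<l} (row l x (r * N)) = 1"
proof (induction N)
  case 0
  then show ?case using assms by (simp add: row_0)
next
  case (Suc N)
  have r: "r > 0" using assms by simp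
  have N: "N = 0 \<or> l \<le> x + r * N" using assms(2) by (cases N) auto
  have "holes r (row l x (r * Suc N)) = {x + r * N}"
    using assms r N by (auto simp: holes_def row_def)
  moreover have "lower r (x + r * N) (row l x (r * Suc N)) = row l x (r * N)"
    using assms r N by (auto simp: lower_def row_def)
  ultimately show ?case using Suc by simp
qed

lemma sum_le_two:
  fixes f :: "nat \<Rightarrow> nat"
  assumes "H \<subseteq> {a, b}" "a \<in> H \<Longrightarrow> f a \<le> m" "b \<in> H \<Longrightarrow> f b \<le> n"
  shows "sum f H \<le> m + n"
proof -
  have "H = {} \<or> H = {a} \<or> H = {b} \<or> (H = {a, b} \<and> a \<noteq> b)" using assms(1) by auto
  then show ?thesis using assms(2,3) by (auto intro: add_mono trans_le_add1 trans_le_add2)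
qed

text \<open>Once the bead at \<open>c + r\<close> has been lowered, only the other displaced bead can move, in one way.  So a path is
determined by the time of that single move.\<close>

lemma two_rows_paths_le:
  assumes "x < l" "l \<le> x + r" "c < l" "c \<noteq> x" "c + r \<notin> {..<l} - {x}" "c + r \<noteq> x + r * M"
  shows "paths r (Suc M) {..<l} (insert (c + r) (insert (x + r * M) ({..<l} - {x, c}))) \<le> Suc M"
  using assms(6)
proof (induction M)
  case 0
  have "insert (c + r) (insert (x + r * 0) ({..<l} - {x, c})) = row l c (r * 1)"
    using assms by (auto simp: row_def)
  then show ?case using row_paths[of c l r 1] assms 0 by simp
next
  case (Suc M)
  let ?B = "insert (c + r) (insert (x + r * Suc M) ({..<l} - {x, c}))"
  have r: "r > 0" using assms by simp
  have M: "M = 0 \<or> l \<le> x + r * M" using assms(2) by (cases M) auto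
  have H: "holes r ?B \<subseteq> {c, x + r * M}" using assms r M by (auto simp: holes_def)
  have "paths r (Suc (Suc M)) {..<l} ?B \<le> 1 + Suc M"
    unfolding paths.simps(2)[of r "Suc M"]
  proof (rule sum_le_two[OF H])
    have "lower r c ?B = row l x (r * Suc M)"
      using assms r M Suc.prems by (auto simp: lower_def row_def)
    then show "paths r (Suc M) {..<l} (lower r c ?B) \<le> 1" using row_paths[OF assms(1,2), of "Suc M"] by simp
    assume "x + r * M \<in> holes r ?B"
    then have ne: "c + r \<noteq> x + r * M" by (auto simp: holes_def)
    have "lower r (x + r * M) ?B = insert (c + r) (insert (x + r * M) ({..<l} - {x, c}))"
      using assms r M Suc.prems by (auto simp: lower_def)
    then show "paths r (Suc M) {..<l} (lower r (x + r * M) ?B) \<le> Suc M" using Suc.IH[OF ne] by simp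
  qed
  then show ?case by simp
qed

text \<open>The raised bead has jumped over \<open>i\<close> beads of its residue class.  The paths correspond to standard
tableaux of the hook with \<open>N\<close> cells in its row and \<open>i\<close> further cells in its column, of which there are
at least \<open>N + i - 1\<close> unless the hook is a row or a column.\<close>

lemma hook_paths:
  assumes "u + i * r < l" "l \<le> u + Suc i * r" "N \<ge> 1"
  shows "paths r (N + i) {..<l} (row l u ((i + N) * r)) \<ge> (if N \<ge> 2 \<and> i \<ge> 1 then N + i - 1 else 1)"
  using assms
proof (induction "N + i" arbitrary: N i u)
  case (Suc n)
  have r: "r > 0" using Suc.prems by (cases r) auto
  let ?B = "row l u ((i + N) * r)"
  have big: "u + i * r + N * r \<ge> l" using Suc.prems by (cases N) auto
  show ?case
  proof (cases "i = 0")
    case True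
    then show ?thesis using row_paths[of u l r N] Suc.prems by (simp add: mult.commute)
  next
    case i: False
    then obtain i' where i': "i = Suc i'" by (cases i) auto
    have ul: "u + r < l" using Suc.prems i' by simp
    have h1: "u \<in> holes r ?B" using r big ul Suc.prems i' by (auto simp: holes_def row_def)
    have l1: "lower r u ?B = row l (u + r) ((i' + N) * r)"
      using r big ul Suc.prems i' by (auto simp: lower_def row_def algebra_simps)
    have nn: "n = N + i'" using Suc(2) i' by simp
    have ge1: "paths r n {..<l} (lower r u ?B) \<ge> (if N \<ge> 2 \<and> i' \<ge> 1 then N + i' - 1 else 1)"
      unfolding l1 nn by (rule Suc.hyps(1)[of N i' "u + r"]) (use Suc.prems i' nn in \<open>auto simp: algebra_simps\<close>)
    show ?thesis
    proof (cases "N = 1")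
      case True
      then show ?thesis using ge1 paths_Suc_ge1[OF _ h1, of n "{..<l}"] Suc(2)[symmetric] by auto
    next
      case False
      then obtain N' where N': "N = Suc N'" "N' \<ge> 1" using Suc.prems by (cases N) auto
      have big': "u + i * r + N' * r \<ge> l" using Suc.prems N'(2) by (cases N') auto
      let ?h = "u + (i + N') * r"
      have h2: "?h \<in> holes r ?B" using r big' Suc.prems i' N' by (auto simp: holes_def row_def algebra_simps)
      have l2: "lower r ?h ?B = row l u ((i + N') * r)"
        using r big' Suc.prems i' N' by (auto simp: lower_def row_def algebra_simps)
      have nn2: "n = N' + i" using Suc(2) N' by simp
      have ge2: "paths r n {..<l} (lower r ?h ?B) \<ge> (if N' \<ge> 2 \<and> i \<ge> 1 then N' + i - 1 else 1)"
        unfolding l2 nn2 by (rule Suc.hyps(1)[of N' i u]) (use Suc.prems nn2 N' in auto)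
      have ne: "u \<noteq> ?h" using r i' by auto
      have "paths r n {..<l} (lower r u ?B) + paths r n {..<l} (lower r ?h ?B) \<le> paths r (Suc n) {..<l} ?B"
        by (rule paths_Suc_ge2[OF _ h1 h2 ne]) simp
      then have "paths r (Suc n) {..<l} ?B \<ge> N + i - 1"
        using ge1 ge2 i' N' by (cases "N' \<ge> 2"; cases "i' \<ge> 1") auto
      then show ?thesis using Suc(2)[symmetric] N' i' by simp
    qed
  qed
qed simp

lemma column_paths:
  assumes "u + i * r < l" "l \<le> u + Suc i * r"
  shows "paths r (Suc i) {..<l} (row l u (Suc i * r)) = 1"
  using assms
proof (induction i arbitrary: u)
  case 0
  then show ?case using row_paths[of u l r 1] by simp
next
  case (Suc i)
  have r: "r > 0" using Suc.prems by (cases r) auto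
  have ul: "u + r < l" using Suc.prems by simp
  let ?B = "row l u (Suc (Suc i) * r)"
  have "holes r ?B = {u}" using Suc.prems r ul by (auto simp: holes_def row_def)
  moreover have "lower r u ?B = row l (u + r) (Suc i * r)"
    using Suc.prems r ul by (auto simp: lower_def row_def)
  moreover have "paths r (Suc i) {..<l} (row l (u + r) (Suc i * r)) = 1"
    by (rule Suc.IH) (use Suc.prems in \<open>auto simp: algebra_simps\<close>)
  ultimately show ?case by simp
qed

text \<open>The first gap above \<open>c\<close> in its residue class, described by the bead directly below it.\<close>

lemma top_exists:
  fixes S :: "nat set"
  assumes "c \<in> S" "c + p * r \<notin> S"
  shows "\<exists>j<p. (\<forall>i\<le>j. c + i * r \<in> S) \<and> c + Suc j * r \<notin> S"
proof -
  let ?P = "\<lambda>j. c + j * r \<notin> S"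
  let ?m = "LEAST j. ?P j"
  have "?P ?m" "?m \<le> p" using assms(2) LeastI[of ?P p] Least_le[of ?P p] by auto
  moreover have "?m \<noteq> 0" using \<open>?P ?m\<close> assms(1) by (cases ?m) auto
  moreover have "c + i * r \<in> S" if "i < ?m" for i using not_less_Least[OF that] by simp
  ultimately show ?thesis by (intro exI[of _ "?m - 1"]) auto
qed

text \<open>Two independent beads give a recursion of Pascal type: the first move lowers either the bead that
has been raised from \<open>h\<close> or the bead on the class of \<open>x\<close>.\<close>

lemma grid_step:
  assumes "finite T" "h \<in> T" "h + r \<notin> T" "r > 0"
    and "x + r * N \<notin> T" "x + r * Suc N \<notin> T" "x + r * N \<noteq> h + r" "x + r * Suc N \<noteq> h + r"
  shows "paths r k A (insert (x + r * Suc N) T) + paths r k A (insert (x + r * N) (insert (h + r) (T - {h})))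
    \<le> paths r (Suc k) A (insert (x + r * Suc N) (insert (h + r) (T - {h})))"
proof -
  let ?B = "insert (x + r * Suc N) (insert (h + r) (T - {h}))"
  have e: "x + r * N + r = x + r * Suc N" by simp
  have "h \<in> holes r ?B" "x + r * N \<in> holes r ?B" "h \<noteq> x + r * N"
    unfolding holes_def mem_Collect_eq e using assms by auto
  moreover have "lower r h ?B = insert (x + r * Suc N) T"
    using assms by (auto simp: lower_def)
  moreover have "lower r (x + r * N) ?B = insert (x + r * N) (insert (h + r) (T - {h}))"
    unfolding lower_def e using assms by auto
  ultimately show ?thesis using paths_Suc_ge2[of ?B h r "x + r * N" k A] assms(1) by simp
qed

lemma grid_step1:
  assumes "finite T" "h \<in> T" "h + r \<notin> T" "r > 0" "y \<notin> T" "y \<noteq> h + r"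
  shows "paths r k A (insert y T) \<le> paths r (Suc k) A (insert y (insert (h + r) (T - {h})))"
proof -
  let ?B = "insert y (insert (h + r) (T - {h}))"
  have "h \<in> holes r ?B" using assms by (auto simp: holes_def)
  moreover have "lower r h ?B = insert y T" using assms by (auto simp: lower_def)
  ultimately show ?thesis using paths_Suc_ge1[of ?B h r k A] assms(1) by simp
qed

text \<open>One bead is raised \<open>N\<close> times, and one or two further moves are made elsewhere.  In the worst case each
further move has to wait for the corresponding move of the first bead; \<open>grid_step\<close> thus leads to the
numbers \<open>N\<close> and \<open>(N + 2) (N - 1) / 2\<close> of standard tableaux of the shapes \<open>(N, 1)\<close> and \<open>(N, 2)\<close>.\<close>

lemma grid_quadratic:
  fixes l r x :: nat
  defines "S \<equiv> {..<l} - {x}"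
  assumes x: "x < l" "l \<le> x + r"
    and h1: "h1 \<in> S" "h1 + r \<notin> S" and S1: "S1 = insert (h1 + r) (S - {h1})"
    and h2: "h2 \<in> S1" "h2 + r \<notin> S1" and S2: "S2 = insert (h2 + r) (S1 - {h2})"
  shows "N \<ge> 1 \<Longrightarrow> N \<le> paths r (N + 1) {..<l} (insert (x + r * N) S1)"
    and "N \<ge> 2 \<Longrightarrow> (N + 2) * (N - 1) \<le> 2 * paths r (N + 2) {..<l} (insert (x + r * N) S2)"
proof -
  have r: "r > 0" using x by simp
  have nS: "x + r * N \<notin> S" "x + r * N \<noteq> h1 + r" if N1: "N \<ge> 1" for N
  proof -
    obtain N' where N': "N = Suc N'" using N1 by (cases N) auto
    have "N' = 0 \<or> l \<le> x + r * N'" using x by (cases N') auto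
    then show "x + r * N \<noteq> h1 + r" using h1 N' by (auto simp: S_def)
    show "x + r * N \<notin> S" using x N' by (simp add: S_def)
  qed
  have nS1: "x + r * N \<notin> S1" if "N \<ge> 1" for N using nS[OF that] S1 by auto
  have nh2: "x + r * N \<noteq> h2 + r" if N: "N \<ge> 2" for N
  proof
    assume eq: "x + r * N = h2 + r"
    obtain N' where N': "N = Suc N'" "N' \<ge> 1" using N by (cases N) auto
    have "h2 = x + r * N'" using eq N' by simp
    then show False using nS1[OF N'(2)] h2 by simp
  qed
  have fin: "finite S" "finite S1" using S1 by (auto simp: S_def)
  have row: "paths r N {..<l} (insert (x + r * N) S) = 1" for N
    using row_paths[OF x, of N] by (simp add: row_def S_def)
  have a1: "N \<le> paths r (N + 1) {..<l} (insert (x + r * N) S1)" if "N \<ge> 1" for N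
    using that
  proof (induction N rule: nat_induct_at_least)
    case base
    then show ?case using grid_step1[OF fin(1) h1 r nS(1,2)[of 1], of 1 "{..<l}"] row[of 1] S1 by simp
  next
    case (Suc N)
    show ?case using grid_step[OF fin(1) h1 r nS(1)[of N] nS(1)[of "Suc N"] nS(2)[of N] nS(2)[of "Suc N"], of "Suc N" "{..<l}"]
      Suc row[of "Suc N"] S1 by simp
  qed
  then show "N \<ge> 1 \<Longrightarrow> N \<le> paths r (N + 1) {..<l} (insert (x + r * N) S1)" .
  show "(N + 2) * (N - 1) \<le> 2 * paths r (N + 2) {..<l} (insert (x + r * N) S2)" if "N \<ge> 2"
    using that
  proof (induction N rule: nat_induct_at_least)
    case base
    have "x + r * 2 \<notin> S1" using nS1[of 2] by simp
    then show ?case using grid_step1[OF fin(2) h2 r _ nh2[of 2], of 3 "{..<l}"] a1[of 2] S2 by (simp add: numeral_eq_Suc)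
  next
    case (Suc N)
    let ?a = "paths r (Suc N + 1) {..<l} (insert (x + r * Suc N) S1)"
    let ?b = "paths r (N + 2) {..<l} (insert (x + r * N) S2)"
    let ?c = "paths r (Suc N + 2) {..<l} (insert (x + r * Suc N) S2)"
    have abc: "?a + ?b \<le> ?c"
      using grid_step[OF fin(2) h2 r nS1[of N] nS1[of "Suc N"] nh2[of N] nh2[of "Suc N"], of "N + 2" "{..<l}"]
        Suc S2 by simp
    have "(Suc N + 2) * (Suc N - 1) \<le> 2 * Suc N + (N + 2) * (N - 1)"
      using Suc(1) by (cases N) (auto simp: algebra_simps)
    also have "\<dots> \<le> 2 * ?a + 2 * ?b" by (intro add_mono Suc.IH mult_le_mono2 a1) simp
    also have "\<dots> = 2 * (?a + ?b)" by simp
    also have "\<dots> \<le> 2 * ?c" by (intro mult_le_mono2 abc)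
    finally show ?case .
  qed
qed

text \<open>Against the linear upper bound \<open>two_rows_paths_le\<close> for long moves: as soon as the second bead is
displaced by at least two short moves, the number of paths is quadratic in \<open>N\<close>.  Two of the short
moves that make up the displacement from \<open>c\<close> are singled out so that \<open>grid_quadratic\<close> applies; the
others are only needed to exist, by \<open>ribbon_ge1\<close>.\<close>

lemma two_rows_paths_ge:
  fixes l r x :: nat
  assumes x: "x < l" "l \<le> x + r" and c: "c < l" "c \<noteq> x" "c + p * r \<notin> {..<l} - {x}"
    and ne: "c + p * r \<noteq> x + r * N" and N: "N \<ge> 2" and p: "p \<ge> 2"
  shows "(N + 2) * (N - 1) \<le> 2 * paths r (N + p) {..<l} (insert (c + p * r) (insert (x + r * N) ({..<l} - {x, c})))"
proof -
  define S where "S = {..<l} - {x}"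
  have r: "r > 0" using x by simp
  have cS: "c \<in> S" "c + p * r \<notin> S" using c by (auto simp: S_def)
  obtain j where j: "j < p" "\<forall>i\<le>j. c + i * r \<in> S" "c + Suc j * r \<notin> S"
    using top_exists[OF cS] by auto
  define B where "B = insert (c + p * r) (insert (x + r * N) ({..<l} - {x, c}))"
  have finB: "finite B" by (simp add: B_def)
  have Beq: "B = insert (c + p * r) (insert (x + r * N) (S - {c}))" by (auto simp: B_def S_def)
  \<comment> \<open>Seen from \<open>{..<l}\<close>, the first short move raises the topmost bead above \<open>c\<close> in an unbroken stack.\<close>
  define h1 where "h1 = c + j * r"
  define S1 where "S1 = insert (h1 + r) (S - {h1})"
  have h1: "h1 \<in> S" "h1 + r \<notin> S" using j by (auto simp: h1_def algebra_simps)
  have xN: "x + r * N \<noteq> h1 + r"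
  proof
    obtain N' where N': "N = Suc N'" "N' \<ge> 1" using N by (cases N) auto
    assume "x + r * N = h1 + r"
    then have "h1 = x + r * N'" using N' by simp
    moreover have "x + r * N' \<ge> l" using x N' by (cases N') auto
    ultimately show False using h1 by (auto simp: S_def)
  qed
  have xS: "x + r * N \<notin> S" using x N by (cases N) (auto simp: S_def)
  have main: "(N + 2) * (N - 1) \<le> 2 * paths r (N + p) {..<l} B"
    if h2: "h2 \<in> S1" "h2 + r \<notin> S1" and path: "paths r (p - 2) (insert (x + r * N) (insert (h2 + r) (S1 - {h2}))) B \<ge> 1" for h2
  proof -
    let ?D = "insert (x + r * N) (insert (h2 + r) (S1 - {h2}))"
    have "(N + 2) * (N - 1) \<le> 2 * paths r (N + 2) {..<l} ?D"
      using grid_quadratic(2)[OF x h1[unfolded S_def] S1_def[unfolded S_def] h2 refl N] .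
    also have "paths r (N + 2) {..<l} ?D \<le> paths r (N + 2) {..<l} ?D * paths r (p - 2) ?D B"
      using path by (cases "paths r (p - 2) ?D B") auto
    also have "\<dots> \<le> paths r ((N + 2) + (p - 2)) {..<l} B" by (rule paths_add_ge1[OF finB])
    also have "(N + 2) + (p - 2) = N + p" using p by simp
    finally show ?thesis by simp
  qed
  have "(N + 2) * (N - 1) \<le> 2 * paths r (N + p) {..<l} B"
  \<comment> \<open>If \<open>c\<close> itself is that bead, the second short move raises it again; otherwise it raises the
    bead just below \<open>h1\<close>.\<close>
  proof (cases "j = 0")
    case True
    then have h1c: "h1 = c" by (simp add: h1_def)
    show ?thesis
    proof (rule main)
      show "h1 + r \<in> S1" by (simp add: S1_def)
      show n2: "h1 + r + r \<notin> S1"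
      proof -
        have "c + r \<ge> l \<or> c + r = x" using h1 h1c by (auto simp: S_def)
        then have "c + r + r \<ge> l" using x by auto
        then show ?thesis using r h1c by (auto simp: S1_def S_def)
      qed
      let ?D = "insert (x + r * N) (insert (h1 + r + r) (S1 - {h1 + r}))"
      have D: "?D = insert (x + r * N) (insert (c + 2 * r) (S - {c}))"
        using h1 h1c by (auto simp: S1_def algebra_simps)
      show "1 \<le> paths r (p - 2) ?D B"
      proof (cases "p = 2")
        case True
        then have "?D = B" unfolding D Beq by auto
        then show ?thesis using True by simp
      next
        case False
        then have p3: "p \<ge> 3" using p by simp
        define k where "k = p - 2"
        have k: "p = 2 + k" "k \<ge> 1" using p3 by (auto simp: k_def)
        have pe: "c + p * r = c + 2 * r + k * r" using k by (simp add: algebra_simps)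
        have "x + r * N \<noteq> c + 2 * r"
        proof
          assume "x + r * N = c + 2 * r"
          then have "h1 + r + r = x + r * N" by (simp add: h1c)
          obtain N' where N': "N = 2 + N'" using N nat_le_iff_add by blast
          have "c = x + r * N'" using \<open>x + r * N = c + 2 * r\<close> N' by (simp add: algebra_simps)
          then show False using c x by (cases N') auto
        qed
        moreover have "c + 2 * r \<notin> S" using n2 h1c by (auto simp: S1_def mult_2 add.assoc)
        ultimately have hol: "c + 2 * r \<in> holes (k * r) B"
          using k ne r by (auto simp: holes_def Beq algebra_simps)
        have low: "lower (k * r) (c + 2 * r) B = ?D"
          unfolding D Beq lower_def pe using k ne[unfolded pe] cS[unfolded pe] r by auto
        show ?thesis using ribbon_ge1[OF finB hol r] low k by simp
      qed
    qed
  next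
    case False
    then obtain j' where j': "j = Suc j'" by (cases j) auto
    define h2 where "h2 = c + j' * r"
    have h2r: "h2 + r = h1" by (simp add: h2_def h1_def j')
    show ?thesis
    proof (rule main)
      show "h2 \<in> S1" using j j' r by (auto simp: S1_def h2_def h1_def)
      show "h2 + r \<notin> S1" unfolding h2r S1_def using r by simp
      let ?D = "insert (x + r * N) (insert (h2 + r) (S1 - {h2}))"
      have D: "?D = insert (x + r * N) (insert (h1 + r) (S - {h2}))"
        unfolding h2r S1_def using h1 r h2r by auto
      obtain k where k: "p = Suc j + k" using j(1) less_iff_Suc_add by auto
      have pe: "c + p * r = h1 + r + k * r" by (simp add: k h1_def algebra_simps)
      define E where "E = insert (x + r * N) (insert (c + p * r) (S - {h2}))"
      have finE: "finite E" by (simp add: E_def S_def)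
      have h2S: "h2 \<in> S" using j j' by (auto simp: h2_def)
      have e1: "1 \<le> paths r k ?D E"
      proof (cases "k = 0")
        case True
        then have "E = ?D" unfolding D E_def pe by simp
        then show ?thesis using True by simp
      next
        case False
        have "h1 + r \<in> holes (k * r) E" using False r h1 xN pe h2r
          by (auto simp: holes_def E_def)
        moreover have "lower (k * r) (h1 + r) E = ?D" unfolding D E_def lower_def pe
          using False r h1 cS ne pe by auto
        ultimately show ?thesis using ribbon_ge1[OF finE _ r, of "h1 + r" k] by simp
      qed
      have e2: "1 \<le> paths r j' E B"
      proof (cases "j' = 0")
        case True
        then have "E = B" unfolding E_def Beq h2_def by auto
        then show ?thesis using True by simp
      next
        case False
        have "c \<in> holes (j' * r) B" using False r p cS h2S xS c h1 by (auto simp: holes_def Beq h2_def)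
        moreover have "lower (j' * r) c B = E" unfolding E_def Beq lower_def
          using False r cS h2S xS c ne by (auto simp: h2_def)
        ultimately show ?thesis using ribbon_ge1[OF finB _ r, of c j'] by simp
      qed
      have "1 * 1 \<le> paths r k ?D E * paths r j' E B" using e1 e2 by (intro mult_le_mono)
      also have "\<dots> \<le> paths r (k + j') ?D B" by (rule paths_add_ge1[OF finB])
      finally show "1 \<le> paths r (p - 2) ?D B" using k j' by (simp add: add.commute)
    qed
  qed
  then show ?thesis by (simp add: B_def)
qed

section \<open>Comparing moves of length r with moves of length p r\<close>

lemma raise_lower: "c \<in> holes r B \<Longrightarrow> B = insert (c + r) (lower r c B - {c})"
  by (auto simp: holes_def lower_def)

lemma mem_lower: "c \<in> holes r B \<Longrightarrow> r > 0 \<Longrightarrow> c \<in> lower r c B \<and> c + r \<notin> lower r c B"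
  by (auto simp: holes_def lower_def)

lemma unique_path_hole:
  assumes "finite B" "paths r (Suc k) {..<l} B = 1" "c \<in> holes r B" "c' \<in> holes r B"
  shows "c = c'"
proof (rule ccontr)
  assume "c \<noteq> c'"
  from paths_Suc_ge2[OF assms(1,3,4) this, of k "{..<l}"]
    paths_lower_pos[OF assms(1) _ assms(3), of k l] paths_lower_pos[OF assms(1) _ assms(4), of k l] assms(2)
  show False by linarith
qed

text \<open>A shape with only one standard tableau is a row or a column, on a single residue class.  By induction:
removing the only removable ribbon leaves such a shape, which up to \<open>dual\<close> is a row, and adding a
ribbon without creating a second removable one either prolongs the row or turns a single cell into a
column of two cells.\<close>

lemma unique_path_cases:
  assumes "B \<subseteq> {..<2*l}" "paths r (Suc N) {..<l} B = 1" "r > 0"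
  shows "\<exists>x<l. l \<le> x + r \<and> (B = row l x (r * Suc N) \<or> dual l B = row l x (r * Suc N))"
  using assms(1,2)
proof (induction N arbitrary: B)
  case 0
  then obtain c where c: "c \<in> holes r B" "paths r 0 {..<l} (lower r c B) > 0"
    by (metis paths_posE zero_less_one)
  then have "lower r c B = {..<l}" by (auto split: if_splits)
  with raise_lower[OF c(1)] mem_lower[OF c(1) assms(3)] show ?case
    by (intro exI[of _ c]) (auto simp: row_def)
next
  case (Suc N)
  have fin: "finite B" using Suc.prems(1) by (rule finite_subset) simp
  let ?Q = "\<lambda>B. \<exists>x<l. l \<le> x + r \<and> (B = row l x (r * Suc (Suc N)) \<or> dual l B = row l x (r * Suc (Suc N)))"
  have step: "?Q B"
    if B: "B \<subseteq> {..<2*l}" "paths r (Suc (Suc N)) {..<l} B = 1" and c: "c \<in> holes r B"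
      and x: "x < l" "l \<le> x + r" and D: "lower r c B = row l x (r * Suc N)"
    for B c x
  proof -
    have finB: "finite B" using B(1) by (rule finite_subset) simp
    define y where "y = x + r * Suc N"
    have y: "l \<le> y" using x by (simp add: y_def)
    have cD: "c \<in> row l x (r * Suc N)" "c + r \<notin> row l x (r * Suc N)"
      using mem_lower[OF c assms(3)] D by auto
    have Beq: "B = insert (c + r) (row l x (r * Suc N) - {c})" using raise_lower[OF c] D by simp
    show ?thesis
    proof (cases "c = y")
      case True
      have "B = row l x (r * Suc (Suc N))"
        unfolding Beq True using x y by (auto simp: row_def y_def)
      then show ?thesis using x by blast
    next
      case False
      then have cl: "c < l" "c \<noteq> x" using cD(1) by (auto simp: row_def y_def)
      have "x + r * N \<in> B"
      proof (rule ccontr)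
        assume "x + r * N \<notin> B"
        moreover have "x + r * N + r \<in> B" using False cD unfolding Beq by (auto simp: row_def y_def)
        ultimately have "x + r * N \<in> holes r B" by (simp add: holes_def)
        from unique_path_hole[OF finB B(2) c this] have "c = x + r * N" .
        then show False using cl x by (cases N) auto
      qed
      then have "x + r * N = c + r"
        unfolding Beq using x assms(3) cl by (cases N) (auto simp: row_def)
      have N: "N = 0"
      proof (rule ccontr)
        assume "N \<noteq> 0"
        then obtain N' where N': "N = Suc N'" by (cases N) auto
        then have "c = x + r * N'" using \<open>x + r * N = c + r\<close> by simp
        then show False using cl x by (cases N') auto
      qed
      with \<open>x + r * N = c + r\<close> have xc: "x = c + r" by simp
      have B2: "B = insert (x + r) ({..<l} - {c})"
        unfolding Beq N using xc cl x by (auto simp: row_def)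
      define x' where "x' = 2 * l - 1 - (x + r)"
      have lt: "x + r < 2 * l" using x B(1) B2 by auto
      have x': "x' < l" "l \<le> x' + r" "x' + r * Suc (Suc N) = 2 * l - 1 - c"
        using lt x xc N by (auto simp: x'_def)
      have "dual l B = row l x' (r * Suc (Suc N))"
        unfolding row_def x'(3) unfolding B2 dual_def x'_def using lt x xc cl by auto
      then show ?thesis using x'(1,2) by blast
    qed
  qed
  from Suc.prems obtain c where c: "c \<in> holes r B" "paths r (Suc N) {..<l} (lower r c B) > 0"
    by (metis paths_posE zero_less_one)
  have one: "paths r (Suc N) {..<l} (lower r c B) = 1"
    using c(2) paths_Suc_ge1[OF fin c(1), of "Suc N" "{..<l}"] Suc.prems(2) by linarith
  have sub: "lower r c B \<subseteq> {..<2*l}" by (rule lower_subset[OF c(1) Suc.prems(1)])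
  from Suc.IH[OF sub one] obtain x where x: "x < l" "l \<le> x + r"
    "lower r c B = row l x (r * Suc N) \<or> dual l (lower r c B) = row l x (r * Suc N)" by blast
  from x(3) show ?case
  proof
    assume "lower r c B = row l x (r * Suc N)"
    from step[OF Suc.prems c(1) x(1,2) this] show ?case .
  next
    assume r: "dual l (lower r c B) = row l x (r * Suc N)"
    let ?c = "2*l - 1 - (c + r)"
    note hd = holes_dual[OF Suc.prems(1) c(1)]
    have "lower r ?c (dual l B) = row l x (r * Suc N)" using hd(2) r by simp
    moreover have "paths r (Suc (Suc N)) {..<l} (dual l B) = 1"
      using Suc.prems(2) paths_dual[OF Suc.prems(1)] by metis
    ultimately have "?Q (dual l B)" using step[OF dual_subset _ hd(1) x(1,2)] by blast
    then show ?case unfolding dual_dual[OF Suc.prems(1)] by blast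
  qed
qed

text \<open>In a row or a column the cells can be grouped into longer ribbons in exactly one way.\<close>

lemma unique_path_ribbons:
  assumes "B \<subseteq> {..<2*l}" "paths r (j * d) {..<l} B = 1" "r > 0" "j > 0"
  shows "paths (j * r) d {..<l} B = 1"
proof (cases "j * d")
  case 0
  then have "d = 0" using assms(4) by simp
  then show ?thesis using assms(2) by simp
next
  case (Suc N)
  have j: "j \<ge> 1" using Suc by (cases j) auto
  have fin: "finite B" using assms(1) by (rule finite_subset) simp
  obtain x where x: "x < l" "l \<le> x + r" "B = row l x (r * Suc N) \<or> dual l B = row l x (r * Suc N)"
    using unique_path_cases[OF assms(1) assms(2)[unfolded Suc] assms(3)] by blast
  have "r \<le> j * r" using j by simp
  then have xj: "l \<le> x + j * r" using x(2) by linarith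
  have e: "r * Suc N = j * r * d" unfolding Suc[symmetric] by (simp add: mult_ac)
  from x(3) show ?thesis
    using row_paths[OF x(1) xj, of d] paths_dual[OF assms(1), of "j * r" d] e by auto
qed

text \<open>If one ribbon of length \<open>p r\<close> can be removed so that a row remains, but the shape is not a row or
a column itself, then the shape has two displaced beads.  Long moves are then linear in number and
short moves are quadratic in number.\<close>

lemma straight_predecessor_bounds:
  assumes c: "c \<in> holes (p * r) B" "lower (p * r) c B = row l x (r * (p * K))"
    and x: "x < l" "l \<le> x + r" and K: "K \<ge> 1" and p: "p \<ge> 2"
    and F: "paths r (p * Suc K) {..<l} B \<noteq> 1"
  shows "paths (p * r) (Suc K) {..<l} B \<le> Suc K"
    and "(p * K + 2) * (p * K - 1) \<le> 2 * paths r (p * Suc K) {..<l} B"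
    and "c < l" "c \<noteq> x" "c + p * r \<notin> {..<l} - {x}" "c + p * r \<noteq> x + r * (p * K)"
      "B = insert (c + p * r) (insert (x + r * (p * K)) ({..<l} - {x, c}))"
proof -
  have r: "r > 0" using x by simp
  have pr: "p * r > 0" using r p by simp
  have cD: "c \<in> row l x (r * (p * K))" "c + p * r \<notin> row l x (r * (p * K))"
    using mem_lower[OF c(1) pr] c(2) by auto
  have Beq: "B = insert (c + p * r) (row l x (r * (p * K)) - {c})" using raise_lower[OF c(1)] c(2) by simp
  have pK: "p * K \<ge> 2" using p K mult_le_mono[of 2 p 1 K] by simp
  have y: "l \<le> x + r * (p * K)" using x pK by (cases "p * K") auto
  have "c \<noteq> x + r * (p * K)"
  proof
    assume eq: "c = x + r * (p * K)"
    have "B = row l x (r * (p * Suc K))"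
      unfolding Beq eq using x y pr by (auto simp: row_def algebra_simps)
    then show False using F row_paths[OF x] by simp
  qed
  then show cl: "c < l" "c \<noteq> x" using cD(1) by (auto simp: row_def)
  show b: "c + p * r \<notin> {..<l} - {x}" "c + p * r \<noteq> x + r * (p * K)" using cD(2) by (auto simp: row_def)
  show B: "B = insert (c + p * r) (insert (x + r * (p * K)) ({..<l} - {x, c}))"
    unfolding Beq using cl y by (auto simp: row_def)
  have "r \<le> p * r" using p by simp
  then have xp: "l \<le> x + p * r" using x(2) by linarith
  show "paths (p * r) (Suc K) {..<l} B \<le> Suc K"
    using two_rows_paths_le[OF x(1) xp cl b(1), of K] b(2) B by (simp add: mult_ac del: paths.simps(2))
  show "(p * K + 2) * (p * K - 1) \<le> 2 * paths r (p * Suc K) {..<l} B"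
    using two_rows_paths_ge[OF x cl b pK p] B by (simp add: add.commute)
qed

text \<open>By conjugation the remaining shape may also be a column.\<close>

lemma straight_predecessor_bounds':
  assumes B: "B \<subseteq> {..<2*l}" and c: "c \<in> holes (p * r) B"
    and one: "paths r (p * K) {..<l} (lower (p * r) c B) = 1" and K: "K \<ge> 1" and p: "p \<ge> 2" and r: "r > 0"
    and F: "paths r (p * Suc K) {..<l} B \<noteq> 1"
  shows "paths (p * r) (Suc K) {..<l} B \<le> Suc K"
    and "(p * K + 2) * (p * K - 1) \<le> 2 * paths r (p * Suc K) {..<l} B"
proof -
  obtain N where N: "p * K = Suc N" using p K by (cases "p * K") auto
  have sub: "lower (p * r) c B \<subseteq> {..<2*l}" by (rule lower_subset[OF c B])
  obtain x where x: "x < l" "l \<le> x + r"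
    "lower (p * r) c B = row l x (r * (p * K)) \<or> dual l (lower (p * r) c B) = row l x (r * (p * K))"
    using unique_path_cases[OF sub one[unfolded N] r] N by metis
  have "paths (p * r) (Suc K) {..<l} B \<le> Suc K \<and> (p * K + 2) * (p * K - 1) \<le> 2 * paths r (p * Suc K) {..<l} B"
    using x(3)
  proof
    assume D: "lower (p * r) c B = row l x (r * (p * K))"
    show ?thesis using straight_predecessor_bounds(1,2)[OF c D x(1,2) K p F] by blast
  next
    assume D: "dual l (lower (p * r) c B) = row l x (r * (p * K))"
    note hd = holes_dual[OF B c]
    have F': "paths r (p * Suc K) {..<l} (dual l B) \<noteq> 1" using F paths_dual[OF B] by metis
    show ?thesis
      using straight_predecessor_bounds(1,2)[OF hd(1) _ x(1,2) K p F'] hd(2) D paths_dual[OF B]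
      by (simp del: paths.simps(2))
  qed
  then show "paths (p * r) (Suc K) {..<l} B \<le> Suc K"
    "(p * K + 2) * (p * K - 1) \<le> 2 * paths r (p * Suc K) {..<l} B" by blast+
qed

text \<open>A single long ribbon consists of \<open>p\<close> short ones that form a hook.\<close>

lemma single_ribbon:
  assumes B: "B = row l c (p * r)" and c: "c < l" "l \<le> c + p * r"
    and F: "paths r p {..<l} B \<noteq> 1"
  shows "p - 1 \<le> paths r p {..<l} B"
proof -
  have "c \<in> {..<l}" "c + p * r \<notin> {..<l}" using c by auto
  from top_exists[OF this] obtain i where i: "i < p" "c + i * r < l" "l \<le> c + Suc i * r" by (auto simp: not_less)
  obtain N where N: "p = i + N" "N \<ge> 1" using i(1) less_imp_add_positive[of i p] by auto
  have i0: "i \<noteq> 0"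
  proof
    assume "i = 0"
    then have "paths r p {..<l} B = 1" using row_paths[of c l r p] i B N by (simp add: mult.commute)
    with F show False by simp
  qed
  have "N \<noteq> 1"
  proof
    assume "N = 1"
    then have "paths r p {..<l} B = 1" using column_paths[OF i(2,3)] B N by (simp del: paths.simps(2))
    with F show False by simp
  qed
  then show ?thesis using hook_paths[OF i(2,3) N(2)] i0 B N by (simp add: add.commute)
qed

text \<open>The inequality is inherited from all positions that are reached by one long move and that have more
than one path, since the short moves can be composed (\<open>ribbon_sum_le\<close>).  It fails exactly for positions
with one path, that is for rows and columns; positions with such a predecessor are therefore
estimated directly.\<close>

theorem ribbon_ratio:
  assumes "B \<subseteq> {..<2*l}" "paths r (p * K) {..<l} B \<ge> 2" "p \<ge> 3" "r > 0"
  shows "(p - 1) * paths (p * r) K {..<l} B \<le> paths r (p * K) {..<l} B"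
  using assms(1,2)
proof (induction K arbitrary: B)
  case 0
  then show ?case by (simp split: if_splits)
next
  case (Suc K)
  let ?A = "{..<l}"
  have fin: "finite B" using Suc.prems(1) by (rule finite_subset) simp
  have sub: "lower (p * r) c B \<subseteq> {..<2*l}" if "c \<in> holes (p * r) B" for c
    using lower_subset[OF that Suc.prems(1)] .
  show ?case
  proof (cases "\<exists>c\<in>holes (p * r) B. paths r (p * K) ?A (lower (p * r) c B) = 1")
    case True
    then obtain c where c: "c \<in> holes (p * r) B" "paths r (p * K) ?A (lower (p * r) c B) = 1" by blast
    show ?thesis
    proof (cases "K = 0")
      case True
      have low: "lower (p * r) c B = ?A" using c(2) True by (simp split: if_splits)
      have pr: "p * r > 0" using assms by simp
      have B: "B = row l c (p * r)" using raise_lower[OF c(1)] low by (simp add: row_def)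
      have cl: "c < l" "l \<le> c + p * r" using mem_lower[OF c(1) pr] low by auto
      have "paths (p * r) 1 ?A (row l c (p * r)) = 1"
        using row_paths[OF cl, of 1] by simp
      then show ?thesis
        using single_ribbon[OF B cl] Suc.prems(2) True B cl by (simp del: paths.simps(2))
    next
      case False
      then have K: "K \<ge> 1" by simp
      have b: "paths (p * r) (Suc K) ?A B \<le> Suc K"
        "(p * K + 2) * (p * K - 1) \<le> 2 * paths r (p * Suc K) ?A B"
        by (rule straight_predecessor_bounds'[OF Suc.prems(1) c K _ assms(4)]; use assms(3) Suc.prems(2) in simp)+
      \<comment> \<open>The linear bound for long moves against the quadratic one for short moves.\<close>
      have "2 * ((p - 1) * Suc K) \<le> (p * K + 2) * (p * K - 1)"
      proof -
        define N where "N = p * K"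
        have N: "N \<ge> p" using K by (simp add: N_def)
        obtain q where q: "p = Suc q" "q \<ge> 2" using assms(3) by (cases p) auto
        obtain M where M: "N = Suc M" "M \<ge> 2" "M \<ge> q" using N q by (cases N) auto
        have "(p - 1) * Suc K = N + p - K - 1"
          using q N by (simp add: N_def algebra_simps)
        also have "2 * (N + p - K - 1) \<le> 2 * N + 2 * p - 4" using K by auto
        also have "\<dots> \<le> (N + 2) * (N - 1)"
        proof -
          have "2 * q \<le> M * M" using mult_le_mono[OF M(2) M(3)] by simp
          then show ?thesis using q M(1) by (simp add: algebra_simps)
        qed
        finally show ?thesis by (simp add: N_def)
      qed
      then have "(p - 1) * Suc K \<le> paths r (p * Suc K) ?A B" using b(2) by linarith
      moreover have "(p - 1) * paths (p * r) (Suc K) ?A B \<le> (p - 1) * Suc K" using b(1) by (rule mult_le_mono2)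
      ultimately show ?thesis by linarith
    qed
  next
    case False
    have "(p - 1) * paths (p * r) (Suc K) ?A B
        = (\<Sum>c\<in>holes (p * r) B. (p - 1) * paths (p * r) K ?A (lower (p * r) c B))"
      by (simp add: sum_distrib_left)
    also have "\<dots> \<le> (\<Sum>c\<in>holes (p * r) B. paths r (p * K) ?A (lower (p * r) c B))"
    proof (rule sum_mono)
      fix c assume c: "c \<in> holes (p * r) B"
      have le: "paths (p * r) K ?A (lower (p * r) c B) \<le> paths r (p * K) ?A (lower (p * r) c B)"
        by (rule ribbon_paths_le) (simp_all add: finite_lower fin assms)
      show "(p - 1) * paths (p * r) K ?A (lower (p * r) c B) \<le> paths r (p * K) ?A (lower (p * r) c B)"
      proof (cases "paths r (p * K) ?A (lower (p * r) c B) \<ge> 2")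
        case True
        then show ?thesis by (rule Suc.IH[OF sub[OF c]])
      next
        case f: False
        then have "paths r (p * K) ?A (lower (p * r) c B) = 0" using False c by force
        then show ?thesis using le by simp
      qed
    qed
    also have "\<dots> \<le> paths r (p * K + p) ?A B" by (rule ribbon_sum_le[OF fin assms(4)])
    finally show ?thesis by (simp add: add.commute)
  qed
qed

section \<open>Comparing moves of length r with moves of length 2 r\<close>

declare paths.simps(2) [simp del]

text \<open>The \<open>2 \<times> 2\<close> square on the residue class of \<open>t\<close>.  It has as many domino tableaux as standard
tableaux, namely two, and is the one exception to the inequality for \<open>p = 2\<close> and two dominoes.\<close>

definition square :: "nat \<Rightarrow> nat \<Rightarrow> nat \<Rightarrow> nat set" where
  "square r l t = insert (t + r) (insert (t + 2 * r) ({..<l} - {t - r, t}))"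

text \<open>Two beads are displaced by two short moves each, and their moves hardly obstruct each other.  Of the
6 interleavings, \<open>grid_step\<close> guarantees 5.\<close>

lemma two_runners_paths_ge:
  assumes x: "x < l" "l \<le> x + r" and c: "c < l" "c \<noteq> x" "c + r \<noteq> x" "c + 2 * r \<noteq> x" "l \<le> c + 2 * r"
  shows "5 \<le> paths r 4 {..<l} (insert (c + 2 * r) (insert (x + 2 * r) ({..<l} - {x, c})))"
    (is "_ \<le> paths r 4 ?A ?C")
proof -
  define S where "S = {..<l} - {x}"
  have r: "r > 0" using x by simp
  have cS: "c \<in> S" "c + 2 * r \<notin> S" using c by (auto simp: S_def)
  obtain j where j: "j < 2" "\<forall>i\<le>j. c + i * r \<in> S" "c + Suc j * r \<notin> S"
    using top_exists[OF cS] by auto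
  define h1 where "h1 = c + j * r"
  \<comment> \<open>The bead displaced from \<open>c\<close> by \<open>2 * r\<close> is either moved twice, or takes the place of the bead
    above it, which is moved first.\<close>
  define h2 where "h2 = (if j = 0 then c + r else c)"
  define S1 where "S1 = insert (h1 + r) (S - {h1})"
  define S2 where "S2 = insert (h2 + r) (S1 - {h2})"
  have j01: "j = 0 \<or> j = 1" using j(1) by auto
  have h1: "h1 \<in> S" "h1 + r \<notin> S" using j by (auto simp: h1_def algebra_simps)
  have big: "l \<le> h1 + r" using h1 j01 c by (auto simp: S_def h1_def)
  have h2: "h2 \<in> S1" "h2 + r \<notin> S1"
    using j01 j h1 r cS big c by (auto simp: S1_def h2_def h1_def S_def algebra_simps)
  have C: "?C = insert (x + r * 2) S2"
    using j01
  proof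
    assume "j = 0"
    then show ?thesis using c h1 r by (auto simp: S2_def S1_def S_def h1_def h2_def)
  next
    assume "j = 1"
    then show ?thesis using c h1 r by (auto simp: S2_def S1_def S_def h1_def h2_def)
  qed
  have fin: "finite S" "finite S1" by (auto simp: S_def S1_def)
  have hx: "h1 \<noteq> x" "h2 \<noteq> x" "h1 < l" "x \<noteq> h1 + r" "x + r \<noteq> h2"
    using h1 big x j01 c cS by (auto simp: S_def h2_def h1_def split: if_splits)
  have row: "paths r N ?A (insert (x + r * N) S) = 1" for N
    using row_paths[OF x, of N] by (simp add: row_def S_def)
  have nx: "x \<notin> S" "x + r \<notin> S" "x + r * 2 \<notin> S" using x by (auto simp: S_def)
  have ne: "x + r * 2 \<noteq> h1 + r" "x + r * 2 \<noteq> h2 + r"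
    using hx x by auto
  have nS1: "x + r \<notin> S1" "x + r * 2 \<notin> S1" using nx ne hx by (auto simp: S1_def)
  have "insert x S1 = row l h1 (r * 1)" using hx h1 x by (auto simp: S1_def S_def row_def)
  then have "paths r 1 ?A (insert x S1) = 1" using row_paths[OF hx(3) big, of 1] by simp
  then have a11: "2 \<le> paths r 2 ?A (insert (x + r) S1)"
    using grid_step[OF fin(1) h1 r, of x 0 1 ?A] nx hx row[of 1] by (simp add: S1_def numeral_2_eq_2)
  have a21: "3 \<le> paths r 3 ?A (insert (x + r * 2) S1)"
    using grid_step[OF fin(1) h1 r, of x 1 2 ?A] nx ne hx row[of 2] a11
    by (simp add: S1_def numeral_2_eq_2 numeral_3_eq_3)
  have a12: "2 \<le> paths r 3 ?A (insert (x + r) S2)"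
    using grid_step1[OF fin(2) h2 r, of "x + r" 2 ?A] nS1 hx a11 by (simp add: S2_def numeral_3_eq_3)
  have "5 \<le> paths r 4 ?A (insert (x + r * 2) S2)"
    using grid_step[OF fin(2) h2 r, of x 1 3 ?A] nS1 ne hx a21 a12
    by (simp add: S2_def numeral_2_eq_2 numeral_3_eq_3 eval_nat_numeral)
  then show ?thesis by (simp only: C)
qed

text \<open>For shapes that arise from a row of two cells by adding a domino.  Apart from the square, the bead
\<open>c\<close> either moves independently of the bead at \<open>x\<close> or takes its place.\<close>

lemma two_dominoes_row:
  assumes C: "c \<in> holes (2 * r) C" "lower (2 * r) c C = row l x (r * 2)"
    and x: "x < l" "l \<le> x + r" and F: "paths r 4 {..<l} C \<noteq> 1"
  shows "paths (2 * r) 2 {..<l} C \<le> 2 \<and>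
    (3 * paths (2 * r) 2 {..<l} C \<le> 2 * paths r 4 {..<l} C \<or> (\<exists>t. t < l \<and> l \<le> t + r \<and> r \<le> t \<and> C = square r l t))"
proof -
  let ?A = "{..<l}"
  have r: "r > 0" using x by simp
  note b = straight_predecessor_bounds[of c 2 r C l x 1, simplified, OF C x F[unfolded numeral_eq_Suc, simplified]]
  have R2: "paths (2 * r) 2 ?A C \<le> 2" using b(1) by (simp add: numeral_2_eq_2)
  have cl: "c < l" "c \<noteq> x" and cb: "c + 2 * r \<notin> {..<l} - {x}" "c + 2 * r \<noteq> x + r * 2"
    and Ceq: "C = insert (c + 2 * r) (insert (x + r * 2) ({..<l} - {x, c}))"
    using b(3-7) by auto
  show ?thesis
  proof (cases "c + r = x")
    case True
    then have "C = square r l x" "r \<le> x" unfolding Ceq square_def by auto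
    then show ?thesis using R2 x by blast
  next
    case n1: False
    have "3 * paths (2 * r) 2 ?A C \<le> 2 * paths r 4 ?A C"
    proof (cases "c + 2 * r = x")
      case False
      then have "l \<le> c + 2 * r" using cb by auto
      then have "5 \<le> paths r 4 ?A C"
        using two_runners_paths_ge[OF x cl n1 False] unfolding Ceq by (simp add: mult.commute)
      then show ?thesis using R2 by linarith
    next
      case True
      have hol: "holes (2 * r) C \<subseteq> {c}"
        using True cl x r by (auto simp: holes_def Ceq)
      have "paths (2 * r) 2 ?A C = (\<Sum>c\<in>holes (2 * r) C. paths (2 * r) 1 ?A (lower (2 * r) c C))"
        by (simp add: numeral_2_eq_2 paths.simps(2)[of _ "Suc 0"])
      also have "\<dots> \<le> (\<Sum>c\<in>{c}. paths (2 * r) 1 ?A (lower (2 * r) c C))"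
        by (rule sum_mono2) (use hol in auto)
      also have "\<dots> = 1" using row_paths[of x l "2 * r" 1] x C(2) by (simp add: mult.commute)
      finally have R1: "paths (2 * r) 2 ?A C \<le> 1" .
      define S where "S = {..<l} - {x}"
      define S1 where "S1 = insert x (insert (c + 2 * r) (S - {c + r}))"
      have h1: "c + r \<in> S" "c + r + r \<notin> S" using True x r by (auto simp: S_def)
      have S1eq: "S1 = insert (c + r + r) (S - {c + r})" using True by (auto simp: S1_def S_def algebra_simps)
      have h2: "c \<in> S1" "c + r \<notin> S1" using cl True r by (auto simp: S1_def S_def)
      have C2: "C = insert (x + r * 2) (insert (c + r) (S1 - {c}))"
        unfolding Ceq S1eq using True x r cl by (auto simp: S_def)
      have a21: "2 \<le> paths r 3 ?A (insert (x + r * 2) S1)" and a11: "1 \<le> paths r 2 ?A (insert (x + r) S1)"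
        using grid_quadratic(1)[OF x h1[unfolded S_def] S1eq[unfolded S_def] h2 refl, of 2]
          grid_quadratic(1)[OF x h1[unfolded S_def] S1eq[unfolded S_def] h2 refl, of 1]
        by (simp_all add: eval_nat_numeral)
      have fin: "finite S1" by (simp add: S1_def S_def)
      have n: "x + r \<notin> S1" "x + r * 2 \<notin> S1" "x + r \<noteq> c + r" "x + r * 2 \<noteq> c + r"
        using x True r by (auto simp: S1_def S_def)
      have "1 \<le> paths r 3 ?A (insert (x + r) (insert (c + r) (S1 - {c})))"
        using grid_step1[OF fin h2 r n(1) n(3), of 2 ?A] a11 by (simp add: eval_nat_numeral)
      then have "3 \<le> paths r 4 ?A C"
        using grid_step[OF fin h2 r, of x 1 3 ?A] n a21 unfolding C2 by (simp add: eval_nat_numeral)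
      then show ?thesis using R1 by linarith
    qed
    then show ?thesis using R2 by blast
  qed
qed

text \<open>The square is its own conjugate.\<close>

lemma dual_square:
  assumes "t < l" "l \<le> t + r" "r \<le> t" "square r l t \<subseteq> {..<2*l}"
  obtains t' where "t' < l" "l \<le> t' + r" "r \<le> t'" "dual l (square r l t) = square r l t'"
    "t' + r = 2 * l - 1 - t" "t' + 2 * r = 2 * l - 1 - (t - r)"
proof -
  have r: "r > 0" using assms by simp
  have lt: "t + 2 * r < 2 * l" using assms(4) by (auto simp: square_def)
  define t' where "t' = 2 * l - 1 - (t + r)"
  have e: "t' + r = 2 * l - 1 - t" "t' + 2 * r = 2 * l - 1 - (t - r)" "t' - r = 2 * l - 1 - (t + 2 * r)"
    using lt assms by (auto simp: t'_def)
  have "dual l (square r l t) = square r l t'"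
    unfolding square_def e unfolding dual_def t'_def using lt assms r by auto
  then show ?thesis using that[of t'] e lt assms by (auto simp: t'_def)
qed

text \<open>Removing a domino leaves a domino, which is a row or a column of two cells; conjugation reduces the
second case to the first.\<close>

lemma two_dominoes:
  assumes "C \<subseteq> {..<2*l}" "paths (2 * r) 2 {..<l} C > 0" "paths r 4 {..<l} C \<noteq> 1" "r > 0"
  shows "paths (2 * r) 2 {..<l} C \<le> 2 \<and>
    (3 * paths (2 * r) 2 {..<l} C \<le> 2 * paths r 4 {..<l} C \<or> (\<exists>t. t < l \<and> l \<le> t + r \<and> r \<le> t \<and> C = square r l t))"
proof -
  let ?A = "{..<l}"
  from assms(2) have "0 < paths (2 * r) (Suc 1) ?A C" by (simp add: numeral_2_eq_2)
  then obtain c where c: "c \<in> holes (2 * r) C" "paths (2 * r) (Suc 0) ?A (lower (2 * r) c C) > 0"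
    by (auto elim: paths_posE)
  let ?D = "lower (2 * r) c C"
  from c(2) obtain c0 where c0: "c0 \<in> holes (2 * r) ?D" "lower (2 * r) c0 ?D = ?A"
    by (metis paths_posE paths.simps(1) less_irrefl)
  have D: "?D = row l c0 (2 * r)" using raise_lower[OF c0(1)] c0(2) by (simp add: row_def)
  have c0l: "c0 < l" "l \<le> c0 + 2 * r" using mem_lower[OF c0(1)] c0(2) assms(4) by auto
  have one: "paths r (Suc 1) ?A ?D = 1"
  proof (cases "l \<le> c0 + r")
    case True
    then show ?thesis using row_paths[OF c0l(1) True, of 2] D by (simp add: numeral_2_eq_2 mult.commute)
  next
    case False
    then show ?thesis using column_paths[of c0 1 r l] c0l D by (simp add: numeral_2_eq_2)
  qed
  have sub: "?D \<subseteq> {..<2*l}" by (rule lower_subset[OF c(1) assms(1)])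
  obtain x where x: "x < l" "l \<le> x + r" "?D = row l x (r * 2) \<or> dual l ?D = row l x (r * 2)"
    using unique_path_cases[OF sub one assms(4)] by (metis Suc_1)
  from x(3) show ?thesis
  proof
    assume "?D = row l x (r * 2)"
    from two_dominoes_row[OF c(1) this x(1,2) assms(3)] show ?thesis .
  next
    assume D: "dual l ?D = row l x (r * 2)"
    note hd = holes_dual[OF assms(1) c(1)]
    have F: "paths r 4 ?A (dual l C) \<noteq> 1" using assms(3) paths_dual[OF assms(1)] by metis
    have "\<exists>t. t < l \<and> l \<le> t + r \<and> r \<le> t \<and> C = square r l t"
      if t: "t < l" "l \<le> t + r" "r \<le> t" "dual l C = square r l t" for t
    proof -
      have "square r l t \<subseteq> {..<2*l}" using t(4) dual_subset by metis
      from dual_square[OF t(1-3) this] obtain t' where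
        "t' < l" "l \<le> t' + r" "r \<le> t'" "dual l (square r l t) = square r l t'" by metis
      moreover have "dual l (dual l C) = C" by (rule dual_dual[OF assms(1)])
      ultimately show ?thesis using t(4) by metis
    qed
    then show ?thesis
      using two_dominoes_row[OF hd(1) hd(2)[unfolded D] x(1,2) F] paths_dual[OF assms(1)] by metis
  qed
qed

lemma sum_ge_two:
  fixes f :: "nat \<Rightarrow> nat"
  assumes "finite H" "a \<in> H" "b \<in> H" "a \<noteq> b"
  shows "f a + f b \<le> sum f H"
  using sum_mono2[of H "{a, b}" f] assms by simp

lemma sum_ge_three:
  fixes f :: "nat \<Rightarrow> nat"
  assumes "finite H" "a \<in> H" "b \<in> H" "c \<in> H" "a \<noteq> b" "a \<noteq> c" "b \<noteq> c"
  shows "f a + f b + f c \<le> sum f H"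
  using sum_mono2[of H "{a, b, c}" f] assms by simp

text \<open>Shapes which become the square after removing a domino need a separate count, since the square gives
no gain.  The last hypothesis says that the added domino does not fill one of the two gaps of the
square; in the remaining cases the conjugate shape has this property.\<close>

lemma three_dominoes_square:
  assumes B: "B \<subseteq> {..<2*l}" and c: "c \<in> holes (2 * r) B" "lower (2 * r) c B = square r l t"
    and t: "t < l" "l \<le> t + r" "r \<le> t"
    and pos: "paths (2 * r) 2 {..<l} (square r l t) > 0"
    and ns: "\<And>c'. c' \<in> holes (2 * r) B \<Longrightarrow> paths r 4 {..<l} (lower (2 * r) c' B) \<noteq> 1"
    and cc: "c + 2 * r \<noteq> t" "c + 2 * r \<noteq> t - r"
  shows "3 * paths (2 * r) 3 {..<l} B \<le> 2 * paths r 6 {..<l} B"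
proof -
  let ?A = "{..<l}"
  let ?R = "\<lambda>c. paths (2 * r) 2 ?A (lower (2 * r) c B)"
  let ?F = "\<lambda>c. paths r 4 ?A (lower (2 * r) c B)"
  have r: "r > 0" using t by simp
  have fin: "finite B" using B by (rule finite_subset) simp
  note finH = finite_holes[OF fin, of "2 * r"]
  have Rsum: "paths (2 * r) 3 ?A B = (\<Sum>c\<in>holes (2 * r) B. ?R c)"
    by (simp add: numeral_3_eq_3 numeral_2_eq_2 paths.simps(2)[of _ "Suc (Suc 0)"])
  have Fsum: "(\<Sum>c\<in>holes (2 * r) B. ?F c) \<le> paths r 6 ?A B"
    using ribbon_sum_le[OF fin r, where p = 2 and k = 4 and A = ?A] by simp
  have RF: "?R c \<le> ?F c" for c
    using ribbon_paths_le[OF finite_lower[OF fin] r, of 2 2 ?A "2 * r" c] by simp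
  have subl: "lower (2 * r) c' B \<subseteq> {..<2*l}" if "c' \<in> holes (2 * r) B" for c'
    by (rule lower_subset[OF that B])
  have R2: "?R c' \<le> 2" if c': "c' \<in> holes (2 * r) B" for c'
    using two_dominoes[OF subl[OF c'] _ ns[OF c'] r] by (cases "?R c' = 0") auto
  have pos3: "0 < paths (2 * r) (Suc 2) ?A B"
    using paths_Suc_ge1[OF fin c(1), of 2 ?A] pos c(2) by simp
  have F2: "?F c' \<ge> 2" if c': "c' \<in> holes (2 * r) B" for c'
    using paths_lower_pos[OF fin pos3 c'] RF[of c'] ns[OF c'] by linarith
  have cD: "c \<in> square r l t" "c + 2 * r \<notin> square r l t"
    using mem_lower[OF c(1)] c(2) r by auto
  have Beq: "B = insert (c + 2 * r) (square r l t - {c})" using raise_lower[OF c(1)] c(2) by simp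
  have tr: "t - r + r = t" "t - r + 2 * r = t + r" "t - r + 4 * r = t + 3 * r" using t(3) by auto
  consider "c = t + 2 * r" | "c = t + r" | "c < l" "c \<noteq> t - r" "c \<noteq> t"
    using cD(1) t by (auto simp: square_def)
  then show ?thesis
  proof cases
    case 1
    have h: "t - r \<in> holes (2 * r) B"
      unfolding holes_def mem_Collect_eq tr using t r cc by (auto simp: Beq square_def 1)
    have "lower (2 * r) (t - r) B = row l t (r * 4)"
      unfolding lower_def tr using t r cc by (auto simp: Beq square_def 1 row_def)
    then have "?F (t - r) = 1" using row_paths[OF t(1,2), of 4] by simp
    then show ?thesis using ns[OF h] by simp
  next
    case 2
    have B2: "B = insert (t + 3 * r) (insert (t + 2 * r) ({..<l} - {t - r, t}))"
      unfolding Beq 2 square_def using t r by auto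
    have h: "t \<in> holes (2 * r) B" using t r by (auto simp: holes_def B2)
    have low: "lower (2 * r) t B = row l (t - r) (4 * r)"
      using t r by (auto simp: lower_def B2 row_def)
    have H: "holes (2 * r) B \<subseteq> {t, t + r}" using t r by (auto simp: holes_def B2)
    have "?R t = 1" using low row_paths[of "t - r" l "2 * r" 2] t by simp
    moreover have "?R (t + r) \<le> 2" if "t + r \<in> holes (2 * r) B" using R2[OF that] .
    ultimately have "paths (2 * r) 3 ?A B \<le> 1 + 2" unfolding Rsum by (intro sum_le_two[OF H]) auto
    moreover have "?F t \<ge> 3" using low hook_paths[of "t - r" 1 r l 3] t tr by simp
    moreover have "?F t + ?F c \<le> (\<Sum>c\<in>holes (2 * r) B. ?F c)"
      by (rule sum_ge_two[OF finH h c(1)]) (use 2 r in simp)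
    ultimately show ?thesis using Fsum F2[OF c(1)] by linarith
  next
    case 3
    have big: "l \<le> c + 2 * r" "c + 2 * r \<noteq> t + r" "c + 2 * r \<noteq> t + 2 * r" "c + r \<noteq> t"
      using cD(2) cc 3 t by (auto simp: square_def)
    have h1: "t - r \<in> holes (2 * r) B"
      unfolding holes_def mem_Collect_eq tr using t r cc 3 by (auto simp: Beq square_def)
    have h2: "t \<in> holes (2 * r) B"
      using t r cc 3 by (auto simp: Beq square_def holes_def)
    have H: "holes (2 * r) B \<subseteq> {c, t - r, t}"
      using t r cc 3 big by (auto simp: Beq square_def holes_def)
    have "paths (2 * r) 3 ?A B \<le> (\<Sum>c'\<in>holes (2 * r) B. 2)" unfolding Rsum by (rule sum_mono) (rule R2)
    also have "\<dots> \<le> 6" using card_mono[OF _ H] card_insert_le_m1[of 3 "{t - r, t}" c]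
      by (simp add: card_insert_if split: if_splits)
    finally have R: "paths (2 * r) 3 ?A B \<le> 6" .
    have "lower (2 * r) (t - r) B = insert (c + 2 * r) (insert (t + 2 * r) ({..<l} - {t, c}))"
      unfolding lower_def tr Beq square_def using t r cc 3 big by auto
    then have "?F (t - r) \<ge> 5"
      using two_runners_paths_ge[OF t(1,2), of c] 3 big cc by simp
    moreover have "?F c + ?F (t - r) + ?F t \<le> (\<Sum>c\<in>holes (2 * r) B. ?F c)"
      by (rule sum_ge_three[OF finH c(1) h1 h2]) (use 3 t r in auto)
    ultimately have "paths r 6 ?A B \<ge> 9" using Fsum F2[OF c(1)] F2[OF h2] by linarith
    then show ?thesis using R by linarith
  qed
qed

text \<open>The summation over the removed domino works unless a predecessor is a row, a column or a square.\<close>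

lemma three_dominoes:
  assumes B: "B \<subseteq> {..<2*l}" and F: "paths r 6 {..<l} B \<noteq> 1" and r: "r > 0"
  shows "3 * paths (2 * r) 3 {..<l} B \<le> 2 * paths r 6 {..<l} B"
proof -
  let ?A = "{..<l}"
  have fin: "finite B" using B by (rule finite_subset) simp
  have subl: "lower (2 * r) c' B \<subseteq> {..<2*l}" if "c' \<in> holes (2 * r) B" for c'
    by (rule lower_subset[OF that B])
  have RF: "paths (2 * r) 2 ?A (lower (2 * r) c B) \<le> paths r 4 ?A (lower (2 * r) c B)" for c
    using ribbon_paths_le[OF finite_lower[OF fin] r, of 2 2 ?A "2 * r" c] by simp
  show ?thesis
  proof (cases "\<exists>c\<in>holes (2 * r) B. paths r 4 ?A (lower (2 * r) c B) = 1")
    case True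
    then obtain c where c: "c \<in> holes (2 * r) B" "paths r (2 * 2) ?A (lower (2 * r) c B) = 1" by auto
    have F': "paths r (2 * Suc 2) ?A B \<noteq> 1" using F by simp
    from straight_predecessor_bounds'[OF B c _ _ r F'] show ?thesis by (simp add: eval_nat_numeral)
  next
    case ns: False
    show ?thesis
    proof (cases "\<exists>c\<in>holes (2 * r) B. \<exists>t. t < l \<and> l \<le> t + r \<and> r \<le> t \<and>
        lower (2 * r) c B = square r l t \<and> paths (2 * r) 2 ?A (lower (2 * r) c B) > 0")
      case True
      then obtain c t where c: "c \<in> holes (2 * r) B" "lower (2 * r) c B = square r l t"
        and t: "t < l" "l \<le> t + r" "r \<le> t" and pos: "paths (2 * r) 2 ?A (square r l t) > 0" by metis
      show ?thesis
      proof (cases "c + 2 * r \<noteq> t \<and> c + 2 * r \<noteq> t - r")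
        case True
        then show ?thesis using three_dominoes_square[OF B c t pos] ns by blast
      next
        case False
        have sq: "square r l t \<subseteq> {..<2*l}" using subl[OF c(1)] c(2) by simp
        obtain t' where t': "t' < l" "l \<le> t' + r" "r \<le> t'" "dual l (square r l t) = square r l t'"
          "t' + r = 2 * l - 1 - t" "t' + 2 * r = 2 * l - 1 - (t - r)" using dual_square[OF t sq] by metis
        note hd = holes_dual[OF B c(1)]
        let ?c = "2 * l - 1 - (c + 2 * r)"
        have lc: "lower (2 * r) ?c (dual l B) = square r l t'" using hd(2) c(2) t'(4) by simp
        have pos': "paths (2 * r) 2 ?A (square r l t') > 0" using pos paths_dual[OF sq, of "2 * r" 2] t'(4) by simp
        have ns': "paths r 4 ?A (lower (2 * r) c' (dual l B)) \<noteq> 1" if c': "c' \<in> holes (2 * r) (dual l B)" for c'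
        proof
          assume one: "paths r 4 ?A (lower (2 * r) c' (dual l B)) = 1"
          note h2 = holes_dual[OF dual_subset c', unfolded dual_dual[OF B]]
          have "paths r 4 ?A (lower (2 * r) (2 * l - 1 - (c' + 2 * r)) B) = 1"
            unfolding h2(2) using paths_dual[OF lower_subset[OF c' dual_subset]] one by metis
          with h2(1) ns show False by blast
        qed
        have "?c = t' + r \<or> ?c = t' + 2 * r" using False t' by auto
        then have cc: "?c + 2 * r \<noteq> t'" "?c + 2 * r \<noteq> t' - r" using r by auto
        show ?thesis
          using three_dominoes_square[OF dual_subset hd(1) lc t'(1-3) pos' ns' cc] paths_dual[OF B] by metis
      qed
    next
      case nsq: False
      have "3 * paths (2 * r) 3 ?A B = (\<Sum>c\<in>holes (2 * r) B. 3 * paths (2 * r) 2 ?A (lower (2 * r) c B))"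
        by (simp add: numeral_3_eq_3 numeral_2_eq_2 paths.simps(2)[of _ "Suc (Suc 0)"] sum_distrib_left)
      also have "\<dots> \<le> (\<Sum>c\<in>holes (2 * r) B. 2 * paths r 4 ?A (lower (2 * r) c B))"
      proof (rule sum_mono)
        fix c assume c: "c \<in> holes (2 * r) B"
        show "3 * paths (2 * r) 2 ?A (lower (2 * r) c B) \<le> 2 * paths r 4 ?A (lower (2 * r) c B)"
        proof (cases "paths (2 * r) 2 ?A (lower (2 * r) c B) = 0")
          case False
          then show ?thesis using two_dominoes[OF subl[OF c] _ _ r] ns nsq c by force
        qed simp
      qed
      also have "\<dots> = 2 * (\<Sum>c\<in>holes (2 * r) B. paths r 4 ?A (lower (2 * r) c B))"
        by (simp add: sum_distrib_left)
      also have "\<dots> \<le> 2 * paths r (4 + 2) ?A B" by (intro mult_le_mono2 ribbon_sum_le fin r)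
      finally show ?thesis by simp
    qed
  qed
qed

text \<open>The factor \<open>3/2\<close> is not available for two dominoes, because of the square; it starts at three
dominoes, and from there on the argument is that of \<open>ribbon_ratio\<close>.\<close>

theorem domino_ratio:
  assumes "B \<subseteq> {..<2*l}" "paths r (2 * K) {..<l} B \<ge> 2" "K \<ge> 3" "r > 0"
  shows "3 * paths (2 * r) K {..<l} B \<le> 2 * paths r (2 * K) {..<l} B"
  using assms(3,1,2)
proof (induction K arbitrary: B rule: nat_induct_at_least)
  case base
  then show ?case using three_dominoes[OF base(1) _ assms(4)] by simp
next
  case (Suc K)
  let ?A = "{..<l}"
  have fin: "finite B" using Suc.prems(1) by (rule finite_subset) simp
  show ?case
  proof (cases "\<exists>c\<in>holes (2 * r) B. paths r (2 * K) ?A (lower (2 * r) c B) = 1")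
    case True
    then obtain c where c: "c \<in> holes (2 * r) B" "paths r (2 * K) ?A (lower (2 * r) c B) = 1" by blast
    have b: "paths (2 * r) (Suc K) ?A B \<le> Suc K" "(2 * K + 2) * (2 * K - 1) \<le> 2 * paths r (2 * Suc K) ?A B"
      by (rule straight_predecessor_bounds'[OF Suc.prems(1) c _ _ assms(4)]; use Suc in simp)+
    have "3 * Suc K \<le> (2 * K + 2) * 3" by simp
    also have "\<dots> \<le> (2 * K + 2) * (2 * K - 1)" using Suc(1) by (intro mult_le_mono2) simp
    also have "\<dots> \<le> 2 * paths r (2 * Suc K) ?A B" by (rule b(2))
    finally have "3 * Suc K \<le> 2 * paths r (2 * Suc K) ?A B" .
    moreover have "3 * paths (2 * r) (Suc K) ?A B \<le> 3 * Suc K" using b(1) by (rule mult_le_mono2)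
    ultimately show ?thesis by (rule order_trans[rotated])
  next
    case False
    have "3 * paths (2 * r) (Suc K) ?A B = (\<Sum>c\<in>holes (2 * r) B. 3 * paths (2 * r) K ?A (lower (2 * r) c B))"
      by (simp add: sum_distrib_left paths.simps(2))
    also have "\<dots> \<le> (\<Sum>c\<in>holes (2 * r) B. 2 * paths r (2 * K) ?A (lower (2 * r) c B))"
    proof (rule sum_mono)
      fix c assume c: "c \<in> holes (2 * r) B"
      have le: "paths (2 * r) K ?A (lower (2 * r) c B) \<le> paths r (2 * K) ?A (lower (2 * r) c B)"
        by (rule ribbon_paths_le) (simp_all add: finite_lower fin assms)
      show "3 * paths (2 * r) K ?A (lower (2 * r) c B) \<le> 2 * paths r (2 * K) ?A (lower (2 * r) c B)"
      proof (cases "paths r (2 * K) ?A (lower (2 * r) c B) \<ge> 2")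
        case True
        then show ?thesis by (rule Suc.IH[OF lower_subset[OF c Suc.prems(1)]])
      next
        case f: False
        then have "paths r (2 * K) ?A (lower (2 * r) c B) = 0" using False c by force
        then show ?thesis using le by simp
      qed
    qed
    also have "\<dots> = 2 * (\<Sum>c\<in>holes (2 * r) B. paths r (2 * K) ?A (lower (2 * r) c B))"
      by (simp add: sum_distrib_left)
    also have "\<dots> \<le> 2 * paths r (2 * K + 2) ?A B" by (intro mult_le_mono2 ribbon_sum_le fin assms)
    finally show ?thesis by simp
  qed
qed

section \<open>The major index as an alternating recursion\<close>

lemma finite_submultisets: "finite {u. u \<subseteq># (v :: 'a multiset)}"
proof (induction v)
  case (add x v)
  have "{u. u \<subseteq># add_mset x v} \<subseteq> {u. u \<subseteq># v} \<union> add_mset x ` {u. u \<subseteq># v}"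
  proof
    fix u assume u: "u \<in> {u. u \<subseteq># add_mset x v}"
    show "u \<in> {u. u \<subseteq># v} \<union> add_mset x ` {u. u \<subseteq># v}"
    proof (cases "x \<in># u")
      case True
      then obtain u' where "u = add_mset x u'" by (metis multi_member_split)
      then show ?thesis using u by auto
    next
      case False
      have "u \<subseteq># v" unfolding subseteq_mset_def
      proof
        fix a
        have "count u a \<le> count (add_mset x v) a" using u by (simp add: subseteq_mset_def)
        then show "count u a \<le> count v a" using False by (cases "a = x") (auto simp: not_in_iff)
      qed
      then show ?thesis by simp
    qed
  qed
  then show ?case using add by (meson finite_UnI finite_imageI finite_subset)
qed simp

text \<open>With \<open>(q)\<^sub>m = (1 - q) \<dots> (1 - q\<^sup>m)\<close> this is \<open>q\<^bsup>n-k\<^esup> (q)\<^bsub>n-1\<^esub> / (q)\<^bsub>n-k\<^esub>\<close>, written as a polynomial so that it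
makes sense at roots of unity.\<close>

definition qcoeff :: "complex \<Rightarrow> nat \<Rightarrow> nat \<Rightarrow> complex" where
  "qcoeff q n k = (if k \<le> n then q ^ (n - k) * (\<Prod>j\<in>{n-k<..<n}. 1 - q ^ j) else 0)"

definition index_pairs :: "nat \<Rightarrow> (nat \<times> nat) set" where
  "index_pairs l = {(i, j). i < j \<and> j < l}"

lemma finite_index_pairs: "finite (index_pairs l)"
  by (rule finite_subset[of _ "{..<l} \<times> {..<l}"]) (auto simp: index_pairs_def)

text \<open>From here on a vector of \<open>l\<close> nonnegative integers is a multiset \<open>v\<close> with elements in \<open>{..<l}\<close>, whose \<open>i\<close>-th
coordinate is \<open>count v i\<close>.  Subtraction of vectors is then total, and sums over smaller vectors are
sums over submultisets.

For \<open>s = sgn_cmp\<close> the product is the sign of the permutation that sorts the coordinates of \<open>v\<close>, and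
zero if two of them agree.\<close>

definition alt :: "nat \<Rightarrow> (nat \<Rightarrow> nat \<Rightarrow> complex) \<Rightarrow> nat multiset \<Rightarrow> complex" where
  "alt l s v = (\<Prod>(i,j)\<in>index_pairs l. s (count v i) (count v j))"

definition swap :: "nat \<Rightarrow> nat multiset \<Rightarrow> nat multiset" where
  "swap i v = image_mset (transpose i (Suc i)) v"

lemma count_swap: "count (swap i v) a = count v (transpose i (Suc i) a)"
proof -
  have "(\<lambda>x. transpose i (Suc i) x) -` {a} \<inter> set_mset v = {transpose i (Suc i) a} \<inter> set_mset v"
    by (auto simp: transpose_eq_iff)
  then show ?thesis
    by (cases "transpose i (Suc i) a \<in># v") (simp_all add: swap_def count_image_mset not_in_iff)
qed

lemma count_swap_simps [simp]:
  "count (swap i v) i = count v (Suc i)" "count (swap i v) (Suc i) = count v i"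
  "a \<noteq> i \<Longrightarrow> a \<noteq> Suc i \<Longrightarrow> count (swap i v) a = count v a"
  by (simp_all add: count_swap transpose_def)

lemma swap_swap [simp]: "swap i (swap i v) = v"
  by (rule multiset_eqI) (simp add: count_swap)

lemma size_swap [simp]: "size (swap i v) = size v"
  by (simp add: swap_def)

lemma swap_diff: "swap i (v - u) = swap i v - swap i u"
  by (rule multiset_eqI) (simp add: count_swap)

lemma swap_subset: "swap i u \<subseteq># swap i v \<longleftrightarrow> u \<subseteq># v"
  unfolding subseteq_mset_def count_swap by (metis transpose_involutory)

lemma swap_empty [simp]: "swap i u = {#} \<longleftrightarrow> u = {#}"
  by (simp add: swap_def)

text \<open>An adjacent transposition permutes the index pairs other than \<open>(i, i + 1)\<close> among themselves.\<close>

lemma alt_swap: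
  assumes "Suc i < l" "\<And>a b. s a b = - s b a"
  shows "alt l s (swap i v) = - alt l s v"
proof -
  let ?t = "transpose i (Suc i)"
  let ?P = "index_pairs l - {(i, Suc i)}"
  have mem: "(i, Suc i) \<in> index_pairs l" using assms by (simp add: index_pairs_def)
  have split: "alt l s w = s (count w i) (count w (Suc i)) * (\<Prod>(a,b)\<in>?P. s (count w a) (count w b))" for w
    unfolding alt_def by (subst prod.remove[OF finite_index_pairs mem]) simp
  have lt: "?t a < ?t b" if "a < b" "(a, b) \<noteq> (i, Suc i)" for a b
    using that by (auto simp: transpose_def)
  have tl: "?t b < l" if "b < l" for b using that assms(1) by (auto simp: transpose_def)
  have ne: "(?t a, ?t b) \<noteq> (i, Suc i)" if "a < b" for a b using that by (auto simp: transpose_def split: if_splits)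
  have "(\<Prod>(a,b)\<in>?P. s (count (swap i v) a) (count (swap i v) b)) = (\<Prod>(a,b)\<in>?P. s (count v a) (count v b))"
  proof (rule prod.reindex_bij_witness[where i = "\<lambda>(a,b). (?t a, ?t b)" and j = "\<lambda>(a,b). (?t a, ?t b)"], goal_cases)
    case (2 x)
    obtain a b where x: "x = (a, b)" by (cases x)
    then have "a < b" "b < l" "(a, b) \<noteq> (i, Suc i)" using 2 by (auto simp: index_pairs_def)
    from lt[OF this(1,3)] tl[OF this(2)] ne[OF this(1)] show ?case
      unfolding x by (simp add: index_pairs_def)
  next
    case (4 x)
    obtain a b where x: "x = (a, b)" by (cases x)
    then have "a < b" "b < l" "(a, b) \<noteq> (i, Suc i)" using 4 by (auto simp: index_pairs_def)
    from lt[OF this(1,3)] tl[OF this(2)] ne[OF this(1)] show ?case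
      unfolding x by (simp add: index_pairs_def)
  next
    case (5 x)
    then show ?case by (cases x) (simp only: count_swap split_conv)
  qed auto
  then show ?thesis unfolding split[of "swap i v"] split[of v]
    using assms(2)[of "count v (Suc i)" "count v i"] by simp
qed

definition sgn_cmp :: "nat \<Rightarrow> nat \<Rightarrow> complex" where
  "sgn_cmp a b = (if b < a then 1 else if a = b then 0 else -1)"

text \<open>For \<open>v = \<lambda> + (l - 1, \<dots>, 1, 0)\<close> and \<open>\<lambda>\<close> of size \<open>n\<close> this computes \<open>(q)\<^sub>n s\<^sub>\<lambda>(1, q, q\<^sup>2, \<dots>)\<close>, extended to
all vectors by antisymmetry as in the Jacobi--Trudi formula.  Splitting off the variable \<open>1\<close> gives
\<open>(1 - q\<^sup>n) s\<^sub>\<lambda>(1, q, \<dots>) = \<Sum>u. q\<^bsup>n-|u|\<^esup> s\<^bsub>\<lambda>-u\<^esub>(1, q, \<dots>)\<close> over nonzero horizontal strips \<open>u\<close>, which is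
the recursion.  Summing over all nonzero \<open>u\<close> instead of strips makes no difference (\<open>pieri\<close>) but keeps
the antisymmetry visible.\<close>

function phi :: "complex \<Rightarrow> nat \<Rightarrow> nat multiset \<Rightarrow> complex" where
  "phi q l v = (if size v \<le> \<Sum>{..<l} then alt l sgn_cmp v
     else \<Sum>u\<in>{u. u \<subseteq># v \<and> u \<noteq> {#}}. qcoeff q (size v - \<Sum>{..<l}) (size u) * phi q l (v - u))"
  by pat_completeness auto
termination
proof (relation "measure (\<lambda>(q, l, v). size v)")
  fix q l v u assume "u \<in> {u. u \<subseteq># (v :: nat multiset) \<and> u \<noteq> {#}}"
  then show "((q, l, v - u), (q, l, v)) \<in> measure (\<lambda>(q::complex, l::nat, v). size v)"
    using size_mset_mono[of u v] by (auto simp: size_Diff_submset nonempty_has_size)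
qed simp

declare phi.simps [simp del]

lemma phi_swap:
  assumes "Suc i < l"
  shows "phi q l (swap i v) = - phi q l v"
proof (induction "size v" arbitrary: v rule: less_induct)
  case less
  show ?case
  proof (cases "size v \<le> \<Sum>{..<l}")
    case True
    then show ?thesis by (simp add: phi.simps alt_swap[OF assms] sgn_cmp_def)
  next
    case False
    let ?n = "size v - \<Sum>{..<l}"
    have "phi q l (swap i v) = (\<Sum>u\<in>{u. u \<subseteq># swap i v \<and> u \<noteq> {#}}. qcoeff q ?n (size u) * phi q l (swap i v - u))"
      using False by (subst phi.simps) simp
    also have "\<dots> = (\<Sum>u\<in>{u. u \<subseteq># v \<and> u \<noteq> {#}}. qcoeff q ?n (size u) * - phi q l (v - u))"
    proof (rule sum.reindex_bij_witness[where i = "swap i" and j = "swap i"], goal_cases)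
      case (2 u) then show ?case using swap_subset[of i "swap i u" v] by simp
    next
      case (4 u) then show ?case using swap_subset by simp
    next
      case (5 u)
      then have u: "swap i u \<subseteq># v" "u \<noteq> {#}" using swap_subset[of i "swap i u" v] by auto
      then have "size (v - swap i u) < size v" using size_mset_mono[OF u(1)] by (simp add: size_Diff_submset nonempty_has_size)
      from less[OF this] have "phi q l (swap i v - u) = - phi q l (v - swap i u)" by (simp add: swap_diff)
      then show ?case by simp
    qed auto
    also have "\<dots> = - phi q l v" using False by (subst phi.simps[of q l v]) (simp add: sum_negf)
    finally show ?thesis .
  qed
qed

definition strict_dec :: "nat \<Rightarrow> nat multiset \<Rightarrow> bool" where
  "strict_dec l v \<longleftrightarrow> (\<forall>i. Suc i < l \<longrightarrow> count v (Suc i) < count v i)"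

lemma strict_dec_less:
  assumes "strict_dec l v" "i < j" "j < l"
  shows "count v j < count v i"
  using assms(2,3)
proof (induction j)
  case (Suc j)
  have "count v (Suc j) < count v j" using assms(1) Suc.prems by (simp add: strict_dec_def)
  moreover have "count v j \<le> count v i" using Suc by (cases "i = j") (auto simp: less_imp_le)
  ultimately show ?case by simp
qed simp

lemma strict_dec_inj: "strict_dec l v \<Longrightarrow> inj_on (count v) {..<l}"
  by (rule linorder_inj_onI') (auto dest: strict_dec_less)

text \<open>Nonzero vectors whose subtraction from \<open>v\<close> removes a horizontal strip from the partition: the
remaining parts interlace with the old ones.\<close>

definition hstrips :: "nat \<Rightarrow> nat multiset \<Rightarrow> nat multiset set" where
  "hstrips l v = {u. u \<subseteq># v \<and> u \<noteq> {#} \<and> (\<forall>i. Suc i < l \<longrightarrow> count v (Suc i) < count (v - u) i)}"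

text \<open>Sign-reversing involution: if \<open>v - u\<close> violates the interlacing condition, then swapping the
coordinates \<open>i\<close> and \<open>i + 1\<close> of \<open>v - u\<close> at the first violation \<open>i\<close> gives another violating
vector, with the same first violation and the opposite sign.\<close>

lemma pieri:
  fixes g :: "nat multiset \<Rightarrow> complex"
  assumes g: "\<And>i v. Suc i < l \<Longrightarrow> g (swap i v) = - g v" and v: "strict_dec l v"
  shows "(\<Sum>u\<in>{u. u \<subseteq># v \<and> u \<noteq> {#}}. c (size u) * g (v - u)) = (\<Sum>u\<in>hstrips l v. c (size u) * g (v - u))"
proof -
  let ?U = "{u. u \<subseteq># v \<and> u \<noteq> {#}}"
  let ?b = "\<lambda>u i. Suc i < l \<and> count (v - u) i \<le> count v (Suc i)"
  let ?f = "\<lambda>u. c (size u) * g (v - u)"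
  \<comment> \<open>The subtractions that do not leave interlacing parts; \<open>m\<close> is their first violation.\<close>
  define Bad where "Bad = {u \<in> ?U. \<exists>i. ?b u i}"
  define m where "m u = (LEAST i. ?b u i)" for u
  define partner where "partner u = v - swap (m u) (v - u)" for u
  have key: "partner u \<in> Bad" "m (partner u) = m u" "v - partner u = swap (m u) (v - u)" "?f (partner u) = - ?f u" "partner (partner u) = u"
    if u: "u \<in> Bad" for u
  proof -
    from u have u1: "u \<subseteq># v" "u \<noteq> {#}" and ex: "\<exists>i. ?b u i" by (auto simp: Bad_def)
    let ?i = "m u"
    have i: "Suc ?i < l" "count (v - u) ?i \<le> count v (Suc ?i)"
      using LeastI_ex[OF ex] by (auto simp: m_def)
    have vi: "count v (Suc ?i) < count v ?i" using v i by (simp add: strict_dec_def)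
    let ?w = "swap ?i (v - u)"
    have wv: "?w \<subseteq># v"
      unfolding subseteq_mset_def
    proof
      fix a show "count ?w a \<le> count v a"
        using i vi by (cases "a = ?i"; cases "a = Suc ?i") auto
    qed
    show eq: "v - partner u = ?w"
    proof (rule multiset_eqI)
      fix x show "count (v - partner u) x = count ?w x"
        using mset_subset_eq_count[OF wv, of x] unfolding partner_def count_diff by linarith
    qed
    have b: "?b (partner u) ?i" using i eq by simp
    have "partner u \<noteq> {#}"
    proof
      assume "partner u = {#}"
      then have "count v ?i = count ?w ?i" using eq by simp
      then have "count v ?i \<le> count v (Suc ?i)" by simp
      with vi show False by simp
    qed
    then show "partner u \<in> Bad" using b by (auto simp: Bad_def partner_def)
    have nb: "\<not> ?b u k" if "k < ?i" for k using not_less_Least[of k "?b u"] that by (simp add: m_def)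
    show m: "m (partner u) = ?i" unfolding m_def[of "partner u"]
    proof (rule Least_equality)
      show "?b (partner u) ?i" by (rule b)
      fix k assume k: "?b (partner u) k"
      show "?i \<le> k"
      proof (rule ccontr)
        assume "\<not> ?i \<le> k"
        then have "k < ?i" by simp
        then have "count (v - partner u) k = count (v - u) k" unfolding eq by simp
        then show False using nb[OF \<open>k < ?i\<close>] k by auto
      qed
    qed
    have "size (partner u) = size u"
      using size_mset_mono[OF u1(1)] size_mset_mono[OF wv] wv u1(1)
      by (simp add: partner_def size_Diff_submset)
    then show "?f (partner u) = - ?f u" unfolding eq using g[OF i(1)] by simp
    show "partner (partner u) = u" unfolding partner_def[of "partner u"] m eq using u1(1)
      by (simp add: subset_mset.diff_diff_right multiset_eq_iff subseteq_mset_def)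
  qed
  have "sum ?f Bad = (\<Sum>u\<in>Bad. - ?f u)"
    by (rule sum.reindex_bij_witness[where i = partner and j = partner]) (use key in auto)
  then have "sum ?f Bad = 0" by (simp add: sum_negf)
  moreover have "?U = Bad \<union> hstrips l v" "Bad \<inter> hstrips l v = {}"
    by (auto simp: Bad_def hstrips_def not_less)
  moreover have "finite ?U" by (rule finite_subset[OF _ finite_submultisets[of v]]) auto
  ultimately show ?thesis by (metis (no_types, lifting) add_0 finite_Un sum.union_disjoint)
qed

text \<open>The vector \<open>(l - 1, \<dots>, 1, 0)\<close>; adding it turns weakly decreasing into strictly decreasing.\<close>

definition delta :: "nat \<Rightarrow> nat multiset" where
  "delta l = (\<Sum>i<l. replicate_mset (l - 1 - i) i)"

lemma count_delta: "count (delta l) i = (if i < l then l - 1 - i else 0)"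
  unfolding delta_def by (simp add: count_sum sum.delta' if_distrib cong: if_cong)

definition state :: "nat \<Rightarrow> nat list \<Rightarrow> nat multiset" where
  "state l w = delta l + mset w"

text \<open>Words are read from right to left: the last letter is the row of the entry 1 of a tableau, and the
first letter is the row of its largest entry.  Removing the largest entry is then the tail of the
list, and the condition says that every suffix has the content of a partition.\<close>

fun lattice_word :: "nat \<Rightarrow> nat list \<Rightarrow> bool" where
  "lattice_word l [] = True"
| "lattice_word l (j # w) = (j < l \<and> lattice_word l w \<and> strict_dec l (state l (j # w)))"

text \<open>The major index of the corresponding tableau: \<open>length (i # w)\<close> is the entry in row \<open>i\<close>, and it is a
descent if the next entry is in a lower row \<open>j\<close>.\<close>

fun wmaj :: "nat list \<Rightarrow> nat" where
  "wmaj (j # i # w) = wmaj (i # w) + (if i < j then Suc (length w) else 0)"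
| "wmaj _ = 0"

definition words :: "nat \<Rightarrow> nat multiset \<Rightarrow> nat list set" where
  "words l v = {w. lattice_word l w \<and> state l w = v}"

lemma strict_dec_delta: "strict_dec l (delta l)"
  by (auto simp: strict_dec_def count_delta)

lemma lattice_word_strict_dec: "lattice_word l w \<Longrightarrow> strict_dec l (state l w)"
  by (cases w) (auto simp: state_def strict_dec_delta)

lemma lattice_word_set: "lattice_word l w \<Longrightarrow> set w \<subseteq> {..<l}"
  by (induction w) auto

lemma size_supp:
  fixes v :: "nat multiset"
  assumes "set_mset v \<subseteq> {..<l}"
  shows "size v = (\<Sum>i<l. count v i)"
  unfolding size_multiset_overloaded_eq
  by (rule sum.mono_neutral_left) (use assms in \<open>auto simp: not_in_iff\<close>)

lemma set_delta: "set_mset (delta l) \<subseteq> {..<l}"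
  by (auto simp: count_delta simp flip: count_greater_zero_iff split: if_splits)

lemma size_delta: "size (delta l) = \<Sum>{..<l}"
proof -
  have "size (delta l) = (\<Sum>i<l. l - 1 - i)"
    using size_supp[OF set_delta] by (simp add: count_delta)
  also have "\<dots> = \<Sum>{..<l}" using sum.nat_diff_reindex[of "\<lambda>x. x" l] by simp
  finally show ?thesis .
qed

lemma size_state: "size (state l w) = \<Sum>{..<l} + length w"
  by (simp add: state_def size_delta)

lemma finite_words: "finite (words l v)"
proof (rule finite_subset)
  show "words l v \<subseteq> {w. set w \<subseteq> {..<l} \<and> length w = size v - \<Sum>{..<l}}"
    using lattice_word_set by (auto simp: words_def size_state)
qed (simp add: finite_lists_length_eq)

text \<open>The entries of a horizontal strip can be added in one order without descents, namely from the lowest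
row to the highest.  The lattice condition for the intermediate words reduces to the interlacing
condition for the whole strip.\<close>

lemma lattice_word_append:
  assumes "sorted s" "set s \<subseteq> {..<l}"
  shows "lattice_word l (s @ w) \<longleftrightarrow> lattice_word l w \<and>
    (\<forall>i. Suc i < l \<longrightarrow> count (state l w + mset s) (Suc i) < count (state l w) i)"
  using assms
proof (induction s)
  case Nil
  then show ?case using lattice_word_strict_dec[of l w] by (auto simp: strict_dec_def)
next
  case (Cons j s)
  then have IH: "lattice_word l (s @ w) \<longleftrightarrow> lattice_word l w \<and>
    (\<forall>i. Suc i < l \<longrightarrow> count (state l w + mset s) (Suc i) < count (state l w) i)" by simp
  have st: "state l (s @ w) = state l w + mset s" by (simp add: state_def)
  show ?case
  proof
    assume L: "lattice_word l ((j # s) @ w)"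
    have "count (state l w + mset (j # s)) (Suc i) < count (state l w) i" if i: "Suc i < l" for i
    proof (cases "j = Suc i")
      case True
      then have "i \<notin> set s" using Cons.prems by auto
      then have c0: "count (mset s) i = 0" by (simp add: not_in_iff[symmetric])
      have "count (state l (j # s @ w)) (Suc i) < count (state l (j # s @ w)) i"
        using L i by (simp add: strict_dec_def)
      then show ?thesis using True by (simp add: state_def c0)
    next
      case False
      then show ?thesis using L IH i by auto
    qed
    then show "lattice_word l w \<and> (\<forall>i. Suc i < l \<longrightarrow> count (state l w + mset (j # s)) (Suc i) < count (state l w) i)"
      using L IH by auto
  next
    assume R: "lattice_word l w \<and> (\<forall>i. Suc i < l \<longrightarrow> count (state l w + mset (j # s)) (Suc i) < count (state l w) i)"
    have "lattice_word l (s @ w)" unfolding IH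
    proof (intro conjI allI impI)
      fix i assume "Suc i < l"
      then have "count (state l w + mset (j # s)) (Suc i) < count (state l w) i" using R by blast
      then show "count (state l w + mset s) (Suc i) < count (state l w) i" by (simp split: if_splits)
    qed (use R in simp)
    moreover have "strict_dec l (state l (j # s @ w))"
      unfolding strict_dec_def
    proof (intro allI impI)
      fix i assume "Suc i < l"
      then have "count (state l w + mset (j # s)) (Suc i) < count (state l w) i" using R by blast
      then show "count (state l (j # s @ w)) (Suc i) < count (state l (j # s @ w)) i"
        by (simp add: state_def split: if_splits)
    qed
    ultimately show "lattice_word l ((j # s) @ w)" using Cons.prems by simp
  qed
qed

text \<open>The largest entries of a tableau that do not contain a descent form a run, and every initial segment
of the run is a horizontal strip.  Summing over the possible lengths \<open>j\<close> of the strip telescopes: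
if the run goes on at \<open>k\<close>, then \<open>(1 - q\<^bsup>n-k\<^esup>) + q\<^bsup>n-k\<^esup> = 1\<close>; if it stops there, then \<open>n - k\<close> is a
descent and contributes the factor \<open>q\<^bsup>n-k\<^esup>\<close> alone.\<close>

lemma run_telescope:
  fixes q :: complex and w :: "nat list"
  defines "n \<equiv> length w"
  assumes "1 \<le> k" "k \<le> n" "sorted (take k w)"
  shows "(\<Sum>j\<in>{j\<in>{k..n}. sorted (take j w)}. qcoeff q n j * q ^ wmaj (drop j w))
    = (\<Prod>j\<in>{n-k<..<n}. 1 - q ^ j) * q ^ wmaj (drop (k - 1) w)"
  using assms(3,2,4)
proof (induction k rule: inc_induct)
  case base
  have "{j \<in> {n..n}. sorted (take j w)} = {n}" using base by auto
  moreover have "wmaj (drop (n - 1) w) = 0"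
  proof -
    have "length (drop (n - 1) w) = 1" using base by (simp add: n_def)
    then obtain a where "drop (n - 1) w = [a]" by (metis length_0_conv length_Suc_conv One_nat_def)
    then show ?thesis by simp
  qed
  ultimately show ?case by (simp add: qcoeff_def n_def)
next
  case (step k)
  let ?P = "\<lambda>k. \<Prod>j\<in>{n-k<..<n}. 1 - q ^ j"
  have kn: "k < n" using step by simp
  have d2: "drop k w = w ! k # drop (Suc k) w" using kn by (simp add: n_def Cons_nth_drop_Suc)
  have d1: "drop (k - 1) w = w ! (k - 1) # w ! k # drop (Suc k) w"
  proof -
    have "drop (k - 1) w = w ! (k - 1) # drop (Suc (k - 1)) w"
      using kn by (intro Cons_nth_drop_Suc[symmetric]) (simp add: n_def)
    then show ?thesis using step(4) d2 by simp
  qed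
  have ln: "Suc (length (drop (Suc k) w)) = n - k" using kn by (simp add: n_def)
  have sk: "sorted (take (Suc k) w) \<longleftrightarrow> w ! (k - 1) \<le> w ! k"
  proof -
    have "sorted (take (Suc k) w) \<longleftrightarrow> (\<forall>i<k. w ! i \<le> w ! Suc i)"
      using kn by (auto simp: sorted_iff_nth_Suc n_def)
    also have "\<dots> \<longleftrightarrow> (\<forall>i<k-1. w ! i \<le> w ! Suc i) \<and> w ! (k - 1) \<le> w ! k"
    proof -
      have "{i. i < k} = insert (k - 1) {i. i < k - 1}" using step(4) by auto
      then have "(\<forall>i. i \<in> {i. i < k} \<longrightarrow> w ! i \<le> w ! Suc i) \<longleftrightarrow>
         (\<forall>i. i \<in> insert (k - 1) {i. i < k - 1} \<longrightarrow> w ! i \<le> w ! Suc i)" by simp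
      then show ?thesis using step(4) by auto
    qed
    finally have eq: "sorted (take (Suc k) w) \<longleftrightarrow> (\<forall>i<k-1. w ! i \<le> w ! Suc i) \<and> w ! (k - 1) \<le> w ! k" .
    have "w ! i \<le> w ! Suc i" if "i < k - 1" for i
    proof -
      have "Suc i < k" using that by linarith
      then show ?thesis using sorted_nth_mono[OF step(5), of i "Suc i"] kn by (simp add: n_def)
    qed
    then show ?thesis using eq by blast
  qed
  have q1: "qcoeff q n k = q ^ (n - k) * ?P k" using kn by (simp add: qcoeff_def)
  show ?case
  proof (cases "sorted (take (Suc k) w)")
    case True
    have "{n - Suc k<..<n} = insert (n - k) {n - k<..<n}" using kn step(4) by auto
    then have P: "?P (Suc k) = (1 - q ^ (n - k)) * ?P k" by simp
    have "{j\<in>{k..n}. sorted (take j w)} = insert k {j\<in>{Suc k..n}. sorted (take j w)}"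
      using step(5) kn by auto
    then have "(\<Sum>j\<in>{j\<in>{k..n}. sorted (take j w)}. qcoeff q n j * q ^ wmaj (drop j w))
      = qcoeff q n k * q ^ wmaj (drop k w) + ?P (Suc k) * q ^ wmaj (drop k w)"
      using step.IH[OF _ True] by simp
    moreover have "wmaj (drop (k - 1) w) = wmaj (drop k w)"
      unfolding d1 d2 using True sk by simp
    ultimately show ?thesis by (simp add: q1 P algebra_simps)
  next
    case False
    have nos: "\<not> sorted (take j w)" if "j \<in> {Suc k..n}" for j
    proof
      assume s: "sorted (take j w)"
      have "take (Suc k) (take j w) = take (Suc k) w" using that by (simp add: min_def)
      then show False using sorted_wrt_take[OF s, of "Suc k"] False by simp
    qed
    have "{j\<in>{k..n}. sorted (take j w)} = {k}"
    proof (intro equalityI subsetI)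
      fix j assume j: "j \<in> {j\<in>{k..n}. sorted (take j w)}"
      then have "\<not> j \<in> {Suc k..n}" using nos by blast
      then show "j \<in> {k}" using j by auto
    qed (use step(5) kn in auto)
    moreover have "wmaj (drop (k - 1) w) = wmaj (drop k w) + (n - k)"
      unfolding d1 d2 using False sk ln by simp
    ultimately show ?thesis by (simp add: q1 power_add algebra_simps)
  qed
qed

text \<open>Decomposing a word into a sorted prefix and the rest, weighted by \<open>run_telescope\<close>, which says that
the weights of all decompositions of one word sum up to its own weight.\<close>

lemma words_maj_recursion:
  assumes v: "strict_dec l v" "set_mset v \<subseteq> {..<l}" "size v = \<Sum>{..<l} + n" "n \<ge> 1"
  shows "(\<Sum>w\<in>words l v. q ^ wmaj w)
    = (\<Sum>u\<in>hstrips l v. qcoeff q n (size u) * (\<Sum>w\<in>words l (v - u). q ^ wmaj w))"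
proof -
  let ?K = "\<lambda>w. {k\<in>{1..n}. sorted (take k w)}"
  have len: "length w = n" if "w \<in> words l v" for w
    using that size_state[of l w] v(3) by (auto simp: words_def)
  have "(\<Sum>w\<in>words l v. q ^ wmaj w) = (\<Sum>w\<in>words l v. \<Sum>k\<in>?K w. qcoeff q n k * q ^ wmaj (drop k w))"
  proof (rule sum.cong[OF refl])
    fix w assume w: "w \<in> words l v"
    have s1: "sorted (take 1 w)" by (cases w) auto
    have e: "{n - Suc 0<..<n} = {}" by auto
    show "q ^ wmaj w = (\<Sum>k\<in>?K w. qcoeff q n k * q ^ wmaj (drop k w))"
      using run_telescope[of 1 w q] s1 len[OF w] v(4) e by simp
  qed
  also have "\<dots> = (\<Sum>(w,k)\<in>Sigma (words l v) ?K. qcoeff q n k * q ^ wmaj (drop k w))"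
    by (rule sum.Sigma) (auto simp: finite_words)
  also have "\<dots> = (\<Sum>(u,w)\<in>Sigma (hstrips l v) (\<lambda>u. words l (v - u)). qcoeff q n (size u) * q ^ wmaj w)"
  proof (rule sum.reindex_bij_witness[where i = "\<lambda>(u,w). (sorted_list_of_multiset u @ w, size u)"
        and j = "\<lambda>(w,k). (mset (take k w), drop k w)"], goal_cases)
    case (1 x)
    then obtain w k where x: "x = (w, k)" "w \<in> words l v" "k \<le> n" "sorted (take k w)" by auto
    have "sorted_list_of_multiset (mset (take k w)) = take k w" using x(4)
      by (simp add: sorted_sort_id)
    then show ?case using x len[OF x(2)] by simp
  next
    case (2 x)
    then obtain w k where x: "x = (w, k)" "w \<in> words l v" "k \<le> n" "1 \<le> k" "sorted (take k w)" by auto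
    have w: "lattice_word l (take k w @ drop k w)" "state l w = v" using x by (auto simp: words_def)
    have "set (take k w) \<subseteq> {..<l}" using lattice_word_set[OF w(1)] by (auto dest: in_set_takeD)
    note L = w(1)[unfolded lattice_word_append[OF x(5) this]]
    have vs: "state l (drop k w) + mset (take k w) = v"
      unfolding w(2)[symmetric] state_def
      by (metis append_take_drop_id mset_append union_assoc union_commute)
    then have vd: "v - mset (take k w) = state l (drop k w)" by (metis add_diff_cancel_right')
    have "mset (take k w) \<subseteq># v" using vs by (metis mset_subset_eq_add_right)
    moreover have "mset (take k w) \<noteq> {#}" using x len[OF x(2)] by auto
    ultimately show ?case using x L vd vs by (auto simp: hstrips_def words_def)
  next
    case (3 x)
    have "length (sorted_list_of_multiset u) = size u" for u :: "nat multiset"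
      by (metis size_mset mset_sorted_list_of_multiset)
    then show ?case by (cases x) simp
  next
    case (4 x)
    then obtain u w where x: "x = (u, w)" "u \<in> hstrips l v" "w \<in> words l (v - u)" by auto
    have u: "u \<subseteq># v" "u \<noteq> {#}" using x by (auto simp: hstrips_def)
    have su: "set (sorted_list_of_multiset u) \<subseteq> {..<l}"
      using set_mset_mono[OF u(1)] v(2) by simp
    have st: "state l w = v - u" "lattice_word l w" using x by (auto simp: words_def)
    have vs: "state l w + u = v" using st u by simp
    have "lattice_word l (sorted_list_of_multiset u @ w)"
      unfolding lattice_word_append[OF sorted_sorted_list_of_multiset su] mset_sorted_list_of_multiset vs
      unfolding st(1) using x(2) st(2) by (auto simp only: hstrips_def mem_Collect_eq)
    moreover have "state l (sorted_list_of_multiset u @ w) = v"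
      using vs by (simp add: state_def add_ac)
    moreover have "size u \<le> n"
      using vs v(3) size_state[of l w] size_union[of "state l w" u] by simp
    moreover have "size u \<ge> 1" using u(2) by (simp add: Suc_le_eq nonempty_has_size)
    moreover have "take (size u) (sorted_list_of_multiset u @ w) = sorted_list_of_multiset u"
      by (simp flip: size_mset)
    ultimately show ?case using x(1) by (auto simp: words_def)
  next
    case (5 x)
    then obtain w k where x: "x = (w, k)" "w \<in> words l v" "k \<le> n" by auto
    then show ?case using len[OF x(2)] by simp
  qed
  also have "\<dots> = (\<Sum>u\<in>hstrips l v. \<Sum>w\<in>words l (v - u). qcoeff q n (size u) * q ^ wmaj w)"
    by (rule sum.Sigma[symmetric])
       (auto simp: finite_words hstrips_def intro: finite_subset[OF _ finite_submultisets[of v]])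
  finally show ?thesis by (simp add: sum_distrib_left)
qed

lemma strict_dec_ge:
  assumes "strict_dec l v" "i < l"
  shows "l - 1 - i \<le> count v i"
  using assms(2)
proof (induction "l - 1 - i" arbitrary: i)
  case (Suc k)
  have "k = l - 1 - Suc i" "Suc i < l" using Suc(2) by arith+
  then have "k \<le> count v (Suc i)" using Suc(1)[of "Suc i"] by simp
  moreover have "count v (Suc i) < count v i" using assms(1) Suc(2) by (auto simp: strict_dec_def)
  ultimately show ?case using Suc(2) by simp
qed simp

lemma strict_dec_delta_subset:
  assumes "strict_dec l v"
  shows "delta l \<subseteq># v"
  unfolding subseteq_mset_def using strict_dec_ge[OF assms] by (simp add: count_delta)

text \<open>Both sides satisfy the same recursion, by \<open>words_maj_recursion\<close> and \<open>pieri\<close>.\<close>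

theorem words_maj_eq_phi:
  assumes "strict_dec l v" "set_mset v \<subseteq> {..<l}"
  shows "(\<Sum>w\<in>words l v. q ^ wmaj w) = phi q l v"
  using assms
proof (induction "size v" arbitrary: v rule: less_induct)
  case less
  have sub: "delta l \<subseteq># v" by (rule strict_dec_delta_subset[OF less(2)])
  show ?case
  proof (cases "size v \<le> \<Sum>{..<l}")
    case True
    have v: "v = delta l"
    proof (rule ccontr)
      assume "v \<noteq> delta l"
      then have "delta l \<subset># v" using sub by (metis subset_mset.le_neq_trans)
      then have "size (delta l) < size v" by (rule mset_subset_size)
      then show False using True by (simp add: size_delta)
    qed
    have "words l v = {[]}" by (auto simp: words_def v state_def)
    moreover have "alt l sgn_cmp v = 1" unfolding alt_def v
      by (rule prod.neutral) (auto simp: index_pairs_def sgn_cmp_def count_delta)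
    ultimately show ?thesis using True by (simp add: phi.simps)
  next
    case False
    define n where "n = size v - \<Sum>{..<l}"
    have n: "size v = \<Sum>{..<l} + n" "n \<ge> 1" using False by (auto simp: n_def)
    have "(\<Sum>w\<in>words l v. q ^ wmaj w)
      = (\<Sum>u\<in>hstrips l v. qcoeff q n (size u) * (\<Sum>w\<in>words l (v - u). q ^ wmaj w))"
      by (rule words_maj_recursion[OF less(2,3) n])
    also have "\<dots> = (\<Sum>u\<in>hstrips l v. qcoeff q n (size u) * phi q l (v - u))"
    proof (rule sum.cong[OF refl])
      fix u assume u: "u \<in> hstrips l v"
      then have "u \<subseteq># v" "u \<noteq> {#}" by (auto simp: hstrips_def)
      then have "size (v - u) < size v"
        using size_mset_mono[of u v] by (simp add: size_Diff_submset nonempty_has_size)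
      moreover have "strict_dec l (v - u)" using u by (fastforce simp: hstrips_def strict_dec_def)
      moreover have "set_mset (v - u) \<subseteq> {..<l}" using less(3) by (meson in_diffD subset_eq)
      ultimately show "qcoeff q n (size u) * (\<Sum>w\<in>words l (v - u). q ^ wmaj w) = qcoeff q n (size u) * phi q l (v - u)"
        using less(1) by simp
    qed
    also have "\<dots> = (\<Sum>u\<in>{u. u \<subseteq># v \<and> u \<noteq> {#}}. qcoeff q n (size u) * phi q l (v - u))"
      by (rule pieri[symmetric, OF phi_swap less(2)])
    also have "\<dots> = phi q l v" using False by (subst phi.simps[of q l v]) (simp add: n_def)
    finally show ?thesis .
  qed
qed

section \<open>The recursion at a root of unity\<close>

text \<open>A submultiset is a free choice of its coordinates, so the sum factorizes.\<close>

lemma sum_submultisets_prod: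
  fixes h :: "nat \<Rightarrow> complex" and u :: "nat multiset"
  assumes "set_mset u \<subseteq> {..<l}"
  shows "(\<Sum>w\<in>{w. w \<subseteq># u}. \<Prod>i<l. h (count w i)) = (\<Prod>i<l. \<Sum>b\<le>count u i. h b)"
proof -
  have "(\<Prod>i<l. \<Sum>b\<le>count u i. h b) = (\<Sum>f\<in>PiE {..<l} (\<lambda>i. {..count u i}). \<Prod>i<l. h (f i))"
    by (rule prod_sum_PiE) auto
  also have "\<dots> = (\<Sum>w\<in>{w. w \<subseteq># u}. \<Prod>i<l. h (count w i))"
  proof (rule sum.reindex_bij_witness[where i = "\<lambda>w. restrict (count w) {..<l}"
        and j = "\<lambda>f. \<Sum>i<l. replicate_mset (f i) i"], goal_cases)
    case (1 f)
    have c: "count (\<Sum>i<l. replicate_mset (f i) i) a = (if a < l then f a else 0)" for a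
      by (simp add: count_sum sum.delta' if_distrib cong: if_cong)
    show ?case
      unfolding c using 1 by (auto simp: fun_eq_iff PiE_def extensional_def restrict_def)
  next
    case (2 f)
    have c: "count (\<Sum>i<l. replicate_mset (f i) i) a = (if a < l then f a else 0)" for a
      by (simp add: count_sum sum.delta' if_distrib cong: if_cong)
    show ?case using 2 by (auto simp: subseteq_mset_def c PiE_def Pi_def)
  next
    case (3 w)
    then have w: "w \<subseteq># u" by simp
    have "count w a = 0" if "\<not> a < l" for a
      using set_mset_mono[OF w] assms that by (auto simp: not_in_iff[symmetric])
    then show ?case
      by (intro multiset_eqI) (simp add: count_sum sum.delta' if_distrib cong: if_cong)
  next
    case (4 w)
    then show ?case by (auto simp: subseteq_mset_def)
  next
    case (5 f)
    have c: "count (\<Sum>i<l. replicate_mset (f i) i) a = (if a < l then f a else 0)" for a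
      by (simp add: count_sum sum.delta' if_distrib cong: if_cong)
    show ?case by (simp add: c)
  qed
  finally show ?thesis by simp
qed

definition qfac :: "complex \<Rightarrow> nat \<Rightarrow> complex" where
  "qfac q m = (\<Prod>j\<in>{1..m}. 1 - q ^ j)"

lemma qfac_Suc: "qfac q (Suc m) = qfac q m * (1 - q ^ Suc m)"
  by (simp add: qfac_def)

lemma qfac_0 [simp]: "qfac q 0 = 1"
  by (simp add: qfac_def)

lemma qcoeff_qfac:
  assumes "1 \<le> k" "k \<le> m"
  shows "qcoeff q m k * qfac q (m - k) = q ^ (m - k) * qfac q (m - 1)"
proof -
  have "{1..m - 1} = {1..m - k} \<union> {m-k<..<m}" using assms by auto
  then have "qfac q (m - 1) = qfac q (m - k) * (\<Prod>j\<in>{m-k<..<m}. 1 - q ^ j)"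
    unfolding qfac_def by (simp only:) (rule prod.union_disjoint, auto)
  then show ?thesis using assms by (simp add: qcoeff_def)
qed

definition qfacs :: "complex \<Rightarrow> nat \<Rightarrow> nat multiset \<Rightarrow> complex" where
  "qfacs q l u = (\<Prod>i<l. qfac q (count u i))"

context
  fixes q :: complex and r :: nat
  assumes r: "r > 0" and qr: "q ^ r = 1" and prim: "\<And>j. 0 < j \<Longrightarrow> j < r \<Longrightarrow> q ^ j \<noteq> 1"
begin

lemma q_power_mult: "q ^ (r * d + j) = q ^ j"
  by (simp add: power_add power_mult qr)

text \<open>The factors of \<open>qcoeff\<close> depend on the exponents modulo \<open>r\<close> only; if the range of the product passes
a multiple of \<open>r\<close> the coefficient vanishes.\<close>

lemma qcoeff_periodic:
  assumes "1 \<le> k" "1 \<le> s"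
  shows "qcoeff q (r * d + s) k = qcoeff q s k"
proof (cases "k \<le> s")
  case True
  have e: "r * d + s - k = r * d + (s - k)" using True by simp
  have p: "(\<Prod>j\<in>{r * d + (s - k)<..<r * d + s}. 1 - q ^ j) = (\<Prod>j\<in>{s-k<..<s}. 1 - q ^ j)"
  proof (rule prod.reindex_bij_witness[where i = "\<lambda>j. r * d + j" and j = "\<lambda>j. j - r * d"], goal_cases)
    case (5 j)
    then show ?case using q_power_mult[of d "j - r * d"] by auto
  qed auto
  have "k \<le> r * d + s" using True by simp
  then show ?thesis unfolding qcoeff_def e q_power_mult p using True by simp
next
  case False
  show ?thesis
  proof (cases "k \<le> r * d + s")
    case True
    have "q ^ (r * d) = 1" using q_power_mult[of d 0] by simp
    then have "(\<Prod>j\<in>{r * d + s - k<..<r * d + s}. 1 - q ^ j) = 0"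
      using True False assms by (intro prod_zero bexI[of _ "r * d"]) auto
    then show ?thesis using False by (simp add: qcoeff_def)
  qed (use False in \<open>simp add: qcoeff_def\<close>)
qed

lemma qfac_nonzero: "m < r \<Longrightarrow> qfac q m \<noteq> 0"
  unfolding qfac_def using prim by (auto simp: prod_zero_iff)

text \<open>This telescopes, by \<open>(1 - q\<^sup>a) / (q)\<^sub>a = 1 / (q)\<^bsub>a-1\<^esub>\<close>.\<close>

lemma sum_q_over_qfac: "a < r \<Longrightarrow> (\<Sum>b\<le>a. q ^ b / qfac q b) = 1 / qfac q a"
proof (induction a)
  case (Suc a)
  then have nz: "qfac q a \<noteq> 0" "qfac q (Suc a) \<noteq> 0" using qfac_nonzero by auto
  then have nz2: "1 - q ^ Suc a \<noteq> 0" by (simp add: qfac_Suc)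
  have "(\<Sum>b\<le>Suc a. q ^ b / qfac q b) = 1 / qfac q a + q ^ Suc a / qfac q (Suc a)" using Suc by simp
  also have "1 / qfac q a = (1 - q ^ Suc a) / qfac q (Suc a)" using nz nz2 unfolding qfac_Suc by (simp del: power_Suc)
  finally show ?case by (simp add: add_divide_distrib[symmetric] del: power_Suc)
qed simp

lemma qfacs_sum:
  assumes "set_mset u \<subseteq> {..<l}" "\<And>i. count u i < r"
  shows "(\<Sum>w\<in>{w. w \<subseteq># u}. q ^ size w / qfacs q l w) = 1 / qfacs q l u"
proof -
  have "(\<Sum>w\<in>{w. w \<subseteq># u}. q ^ size w / qfacs q l w) = (\<Sum>w\<in>{w. w \<subseteq># u}. \<Prod>i<l. q ^ count w i / qfac q (count w i))"
  proof (rule sum.cong[OF refl])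
    fix w assume "w \<in> {w. w \<subseteq># u}"
    then have "set_mset w \<subseteq> {..<l}" using assms(1) set_mset_mono by fastforce
    then show "q ^ size w / qfacs q l w = (\<Prod>i<l. q ^ count w i / qfac q (count w i))"
      by (simp add: size_supp qfacs_def prod_dividef power_sum)
  qed
  also have "\<dots> = (\<Prod>i<l. \<Sum>b\<le>count u i. q ^ b / qfac q b)"
    by (rule sum_submultisets_prod[OF assms(1)])
  also have "\<dots> = 1 / qfacs q l u"
    by (simp add: sum_q_over_qfac assms(2) qfacs_def prod_dividef)
  finally show ?thesis .
qed

definition qmult :: "nat \<Rightarrow> nat multiset \<Rightarrow> complex" where
  "qmult l u = qfac q (size u) / qfacs q l u"

text \<open>The recursion of \<open>phi\<close> without the alternating factor.  Up to size \<open>r - 1\<close> it reproduces the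
\<open>q\<close>-multinomial coefficients.  At size \<open>r\<close> all \<open>q\<close>-multinomial coefficients
except the trivial ones vanish, since \<open>(q)\<^sub>r = 0\<close>; this is where a general horizontal strip becomes a
multiple of a unit vector.\<close>

lemma qmult_recursion:
  assumes u: "set_mset u \<subseteq> {..<l}" "1 \<le> size u" "size u \<le> r"
  shows "(\<Sum>w\<in>{w. w \<subseteq># u \<and> w \<noteq> {#}}. qcoeff q (size u) (size w) * qmult l (u - w))
    = (if size u < r then qmult l u else if \<exists>i<l. u = replicate_mset r i then 1 else 0)"
proof -
  let ?m = "size u"
  let ?W = "{w. w \<subseteq># u}"
  have fin: "finite ?W" by (rule finite_submultisets)
  have "(\<Sum>w\<in>{w. w \<subseteq># u \<and> w \<noteq> {#}}. qcoeff q ?m (size w) * qmult l (u - w))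
    = (\<Sum>w\<in>?W - {u}. qcoeff q ?m (size u - size w) * qmult l w)"
  proof (rule sum.reindex_bij_witness[where i = "\<lambda>w. u - w" and j = "\<lambda>w. u - w"], goal_cases)
    case (1 w) then show ?case by (auto simp: subset_mset.diff_diff_right multiset_eq_iff subseteq_mset_def)
  next
    case (2 w)
    then have w: "w \<subseteq># u" "w \<noteq> {#}" by auto
    have "u - w \<noteq> u"
    proof
      assume "u - w = u"
      then have "size (u - w) = size u" by simp
      then show False using w size_mset_mono[OF w(1)] by (simp add: size_Diff_submset nonempty_has_size)
    qed
    then show ?case using w by auto
  next
    case (3 w) then show ?case by (auto simp: multiset_eq_iff subseteq_mset_def)
  next
    case (4 w)
    then have w: "w \<subseteq># u" "w \<noteq> u" by auto
    have "u - w \<noteq> {#}" using w by (metis Diff_eq_empty_iff_mset subset_mset.antisym)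
    then show ?case using w by auto
  next
    case (5 w)
    then show ?case using size_mset_mono[of w u] by (auto simp: size_Diff_submset)
  qed
  also have "\<dots> = (\<Sum>w\<in>?W - {u}. qfac q (?m - 1) * (q ^ size w / qfacs q l w))"
  proof (rule sum.cong[OF refl])
    fix w assume w: "w \<in> ?W - {u}"
    then have "w \<subset># u" using subset_mset.le_neq_trans[of w u] by simp
    then have lt: "size w < ?m" by (rule mset_subset_size)
    have "qcoeff q ?m (?m - size w) * qfac q (size w) = q ^ size w * qfac q (?m - 1)"
      using qcoeff_qfac[of "?m - size w" ?m q] lt by simp
    then show "qcoeff q ?m (size u - size w) * qmult l w = qfac q (?m - 1) * (q ^ size w / qfacs q l w)"
      unfolding qmult_def by (simp add: mult.commute)
  qed
  also have "\<dots> = qfac q (?m - 1) * (\<Sum>w\<in>?W - {u}. q ^ size w / qfacs q l w)"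
    by (simp add: sum_distrib_left)
  finally have main: "(\<Sum>w\<in>{w. w \<subseteq># u \<and> w \<noteq> {#}}. qcoeff q ?m (size w) * qmult l (u - w))
    = qfac q (?m - 1) * (\<Sum>w\<in>?W - {u}. q ^ size w / qfacs q l w)" .
  show ?thesis
  proof (cases "\<forall>i. count u i < r")
    case True
    have "(\<Sum>w\<in>?W. q ^ size w / qfacs q l w) = q ^ ?m / qfacs q l u + (\<Sum>w\<in>?W - {u}. q ^ size w / qfacs q l w)"
      by (rule sum.remove) (auto simp: fin)
    then have "(\<Sum>w\<in>?W - {u}. q ^ size w / qfacs q l w) = (1 - q ^ ?m) / qfacs q l u"
      using qfacs_sum[OF u(1)] True by (simp add: diff_divide_distrib)
    moreover have "qfac q (?m - 1) * (1 - q ^ ?m) = qfac q ?m"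
      using qfac_Suc[of q "?m - 1"] u(2) by simp
    moreover have "\<not> (\<exists>i<l. u = replicate_mset r i)" using True by (metis count_replicate_mset less_irrefl)
    moreover have "qfac q ?m = 0" if "\<not> ?m < r"
    proof -
      have "?m = r" using that u(3) by simp
      then show ?thesis unfolding qfac_def using qr r by (intro prod_zero bexI[of _ r]) auto
    qed
    ultimately show ?thesis unfolding main unfolding qmult_def by auto
  next
    case False
    then obtain i where i: "count u i \<ge> r" by (meson not_less)
    have iu: "i \<in># u" using i r by (metis count_greater_zero_iff less_le_trans)
    have sub: "replicate_mset r i \<subseteq># u" using i by (simp add: count_le_replicate_mset_subset_eq)
    have ueq: "u = replicate_mset r i"
    proof (rule ccontr)
      assume "u \<noteq> replicate_mset r i"
      then have "replicate_mset r i \<subset># u" using sub by (metis subset_mset.le_neq_trans)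
      from mset_subset_size[OF this] show False using u(3) by simp
    qed
    have il: "i < l" using iu u(1) by auto
    have W: "?W - {u} = (\<lambda>b. replicate_mset b i) ` {..<r}"
    proof (intro equalityI subsetI)
      fix w assume w: "w \<in> ?W - {u}"
      have "w = replicate_mset (count w i) i"
      proof (rule multiset_eqI)
        fix x
        have "count w x \<le> count u x" using w by (simp add: subseteq_mset_def)
        then show "count w x = count (replicate_mset (count w i) i) x"
          by (cases "x = i") (simp_all add: ueq)
      qed
      moreover have "count w i \<le> r" using w ueq by (auto simp: subseteq_mset_def dest: spec[of _ i])
      moreover have "count w i \<noteq> r" using w ueq calculation(1) by auto
      ultimately show "w \<in> (\<lambda>b. replicate_mset b i) ` {..<r}" by (intro image_eqI) auto
    next
      fix w assume "w \<in> (\<lambda>b. replicate_mset b i) ` {..<r}"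
      then show "w \<in> ?W - {u}" using ueq by (auto simp: subseteq_mset_def replicate_mset_eq_iff)
    qed
    have "(\<Sum>w\<in>?W - {u}. q ^ size w / qfacs q l w) = (\<Sum>b<r. q ^ b / qfac q b)"
      unfolding W
    proof (subst sum.reindex, goal_cases)
      case 1 then show ?case by (auto simp: inj_on_def replicate_mset_eq_iff)
    next
      case 2
      have "qfacs q l (replicate_mset b i) = qfac q b" for b
        unfolding qfacs_def using il by (subst prod.remove[of _ i]) (auto intro!: prod.neutral)
      then show ?case by simp
    qed
    also have "{..<r} = {..r - 1}" using r by auto
    also have "(\<Sum>b\<le>r - 1. q ^ b / qfac q b) = 1 / qfac q (r - 1)"
      by (rule sum_q_over_qfac) (use r in simp)
    finally show ?thesis unfolding main using ueq il qfac_nonzero[of "r - 1"] r by auto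
  qed
qed

text \<open>One step of the recursion for \<open>phi\<close>, with the periodicity of \<open>qcoeff\<close>, composed with the
induction hypothesis for smaller remainders \<open>s'\<close>, and reordered by the total vector subtracted.\<close>

lemma phi_convolution:
  assumes "set_mset v \<subseteq> {..<l}" "size v = \<Sum>{..<l} + r * d + s" "1 \<le> s" "s \<le> r"
    and IH: "\<And>w s'. set_mset w \<subseteq> {..<l} \<Longrightarrow> size w = \<Sum>{..<l} + r * d + s' \<Longrightarrow> s' < s \<Longrightarrow>
       phi q l w = (\<Sum>u\<in>{u. u \<subseteq># w \<and> size u = s'}. qmult l u * phi q l (w - u))"
  shows "phi q l v = (\<Sum>u\<in>{u. u \<subseteq># v \<and> size u = s}.
      (\<Sum>w\<in>{w. w \<subseteq># u \<and> w \<noteq> {#}}. qcoeff q s (size w) * qmult l (u - w)) * phi q l (v - u))"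
proof -
  have n: "size v - \<Sum>{..<l} = r * d + s" "\<not> size v \<le> \<Sum>{..<l}" using assms by auto
  let ?U = "{u. u \<subseteq># v \<and> u \<noteq> {#}}"
  let ?U' = "{u. u \<subseteq># v \<and> u \<noteq> {#} \<and> size u \<le> s}"
  have fin: "finite {u. u \<subseteq># x \<and> P u}" for x P
    by (rule finite_subset[OF _ finite_submultisets[of x]]) auto
  have "phi q l v = (\<Sum>u\<in>?U. qcoeff q s (size u) * phi q l (v - u))"
  proof -
    have "phi q l v = (\<Sum>u\<in>?U. qcoeff q (r * d + s) (size u) * phi q l (v - u))"
      using n by (subst phi.simps) simp
    also have "\<dots> = (\<Sum>u\<in>?U. qcoeff q s (size u) * phi q l (v - u))"
    proof (rule sum.cong[OF refl])
      fix u assume "u \<in> ?U"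
      then have "1 \<le> size u" by (auto simp: Suc_le_eq nonempty_has_size)
      from qcoeff_periodic[OF this assms(3), of d]
      show "qcoeff q (r * d + s) (size u) * phi q l (v - u) = qcoeff q s (size u) * phi q l (v - u)" by simp
    qed
    finally show ?thesis .
  qed
  also have "\<dots> = (\<Sum>u\<in>?U'. qcoeff q s (size u) * phi q l (v - u))"
    by (rule sum.mono_neutral_right) (auto simp: fin qcoeff_def)
  also have "\<dots> = (\<Sum>u\<in>?U'. \<Sum>u'\<in>{u'. u' \<subseteq># v - u \<and> size u' = s - size u}. qcoeff q s (size u) * (qmult l u' * phi q l (v - u - u')))"
  proof (rule sum.cong[OF refl])
    fix u assume u: "u \<in> ?U'"
    have "set_mset (v - u) \<subseteq> {..<l}" using assms(1) by (meson in_diffD subset_eq)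
    moreover have "size (v - u) = \<Sum>{..<l} + r * d + (s - size u)"
      using u assms(2) size_mset_mono[of u v] by (simp add: size_Diff_submset)
    moreover have "s - size u < s" using u assms(3) by (simp add: nonempty_has_size)
    ultimately show "qcoeff q s (size u) * phi q l (v - u) =
      (\<Sum>u'\<in>{u'. u' \<subseteq># v - u \<and> size u' = s - size u}. qcoeff q s (size u) * (qmult l u' * phi q l (v - u - u')))"
      using IH[of "v - u" "s - size u"] by (simp add: sum_distrib_left)
  qed
  also have "\<dots> = (\<Sum>(u,u')\<in>Sigma ?U' (\<lambda>u. {u'. u' \<subseteq># v - u \<and> size u' = s - size u}).
      qcoeff q s (size u) * (qmult l u' * phi q l (v - u - u')))"
    by (rule sum.Sigma) (auto simp: fin)
  also have "\<dots> = (\<Sum>(u,w)\<in>Sigma {u. u \<subseteq># v \<and> size u = s} (\<lambda>u. {w. w \<subseteq># u \<and> w \<noteq> {#}}).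
      qcoeff q s (size w) * qmult l (u - w) * phi q l (v - u))"
  proof (rule sum.reindex_bij_witness[where i = "\<lambda>(u,w). (w, u - w)" and j = "\<lambda>(w,u'). (w + u', w)"], goal_cases)
    case (1 x) then show ?case by auto
  next
    case (2 x)
    then obtain w u' where x: "x = (w, u')" "w \<subseteq># v" "w \<noteq> {#}" "size w \<le> s" "u' \<subseteq># v - w" "size u' = s - size w" by auto
    have "w + u' \<subseteq># v" using x by (metis subset_mset.le_diff_conv2 union_commute)
    then show ?case using x by auto
  next
    case (3 x) then show ?case by auto
  next
    case (4 x)
    then obtain u w where x: "x = (u, w)" "u \<subseteq># v" "size u = s" "w \<subseteq># u" "w \<noteq> {#}" by auto
    have "w \<subseteq># v" using x(2,4) unfolding subseteq_mset_def by (meson order_trans)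
    moreover have "u - w \<subseteq># v - w" using x(2) by (simp add: subseteq_mset_def diff_le_mono)
    ultimately show ?case using x size_mset_mono[OF x(4)] by (simp add: size_Diff_submset)
  next
    case (5 x) then show ?case by (auto simp: mult_ac)
  qed
  also have "\<dots> = (\<Sum>u\<in>{u. u \<subseteq># v \<and> size u = s}. \<Sum>w\<in>{w. w \<subseteq># u \<and> w \<noteq> {#}}.
      qcoeff q s (size w) * qmult l (u - w) * phi q l (v - u))"
    by (rule sum.Sigma[symmetric]) (auto simp: fin)
  finally show ?thesis by (simp add: sum_distrib_right)
qed

text \<open>Within a block of \<open>r\<close> consecutive sizes the recursion does not see the size at the bottom of the
block, and its iteration produces \<open>q\<close>-multinomial coefficients.\<close>

lemma phi_below:
  assumes "set_mset v \<subseteq> {..<l}" "size v = \<Sum>{..<l} + r * d + s" "s < r"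
  shows "phi q l v = (\<Sum>u\<in>{u. u \<subseteq># v \<and> size u = s}. qmult l u * phi q l (v - u))"
  using assms
proof (induction s arbitrary: v rule: less_induct)
  case (less s)
  show ?case
  proof (cases "s = 0")
    case True
    have "{u. u \<subseteq># v \<and> size u = s} = {{#}}" using True by auto
    then show ?thesis by (simp add: qmult_def qfacs_def)
  next
    case False
    have "phi q l v = (\<Sum>u\<in>{u. u \<subseteq># v \<and> size u = s}.
      (\<Sum>w\<in>{w. w \<subseteq># u \<and> w \<noteq> {#}}. qcoeff q s (size w) * qmult l (u - w)) * phi q l (v - u))"
      by (rule phi_convolution[OF less.prems(1,2)]) (use False less in auto)
    also have "\<dots> = (\<Sum>u\<in>{u. u \<subseteq># v \<and> size u = s}. qmult l u * phi q l (v - u))"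
    proof (rule sum.cong[OF refl])
      fix u assume u: "u \<in> {u. u \<subseteq># v \<and> size u = s}"
      then have "set_mset u \<subseteq> {..<l}" using less.prems(1) set_mset_mono by fastforce
      then show "(\<Sum>w\<in>{w. w \<subseteq># u \<and> w \<noteq> {#}}. qcoeff q s (size w) * qmult l (u - w)) * phi q l (v - u)
        = qmult l u * phi q l (v - u)"
        using qmult_recursion[of u l] u False less.prems(3) by auto
    qed
    finally show ?thesis .
  qed
qed

text \<open>At a root of unity of order \<open>r\<close> a whole block of \<open>r\<close> steps collapses to the subtraction of \<open>r\<close> from one
coordinate: multiplication by a power sum, the Murnaghan--Nakayama rule before signs are sorted out.\<close>

theorem phi_power_sum:
  assumes "set_mset v \<subseteq> {..<l}" "size v = \<Sum>{..<l} + r * Suc d"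
  shows "phi q l v = (\<Sum>i\<in>{i. i < l \<and> r \<le> count v i}. phi q l (v - replicate_mset r i))"
proof -
  have fin: "finite {u. u \<subseteq># x \<and> P u}" for x :: "nat multiset" and P
    by (rule finite_subset[OF _ finite_submultisets[of x]]) auto
  let ?V = "(\<lambda>i. replicate_mset r i) ` {i. i < l \<and> r \<le> count v i}"
  have "phi q l v = (\<Sum>u\<in>{u. u \<subseteq># v \<and> size u = r}.
      (\<Sum>w\<in>{w. w \<subseteq># u \<and> w \<noteq> {#}}. qcoeff q r (size w) * qmult l (u - w)) * phi q l (v - u))"
    by (rule phi_convolution[OF assms(1), of d]) (use assms r phi_below in auto)
  also have "\<dots> = (\<Sum>u\<in>{u. u \<subseteq># v \<and> size u = r}. (if \<exists>i<l. u = replicate_mset r i then 1 else 0) * phi q l (v - u))"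
  proof (rule sum.cong[OF refl])
    fix u assume u: "u \<in> {u. u \<subseteq># v \<and> size u = r}"
    then have "set_mset u \<subseteq> {..<l}" using assms(1) set_mset_mono by fastforce
    then show "(\<Sum>w\<in>{w. w \<subseteq># u \<and> w \<noteq> {#}}. qcoeff q r (size w) * qmult l (u - w)) * phi q l (v - u)
      = (if \<exists>i<l. u = replicate_mset r i then 1 else 0) * phi q l (v - u)"
      using qmult_recursion[of u l] u r by auto
  qed
  also have "\<dots> = (\<Sum>u\<in>?V. phi q l (v - u))"
    by (rule sum.mono_neutral_cong_right) (auto simp: fin count_le_replicate_mset_subset_eq)
  also have "\<dots> = (\<Sum>i\<in>{i. i < l \<and> r \<le> count v i}. phi q l (v - replicate_mset r i))"
    by (subst sum.reindex) (use r in \<open>auto simp: inj_on_def replicate_mset_eq_iff\<close>)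
  finally show ?thesis .
qed

end

section \<open>The common sign of all ribbon removals\<close>

text \<open>Antisymmetry; the two equal coordinates are brought next to each other by adjacent swaps.\<close>

lemma phi_zero:
  assumes "i < j" "j < l" "count v i = count v j"
  shows "phi q l v = 0"
  using assms
proof (induction "j - i" arbitrary: j v)
  case (Suc k)
  show ?case
  proof (cases "j = Suc i")
    case True
    have "swap i v = v" by (rule multiset_eqI) (use Suc.prems True in \<open>auto simp: count_swap transpose_def\<close>)
    then show ?thesis using phi_swap[of i l q v] True Suc.prems by simp
  next
    case False
    then obtain j' where j: "j = Suc j'" "i < j'" using Suc.prems by (cases j) auto
    have "phi q l (swap j' v) = 0"
      by (rule Suc.hyps(1)[of j']) (use Suc.hyps(2) Suc.prems j in auto)
    then show ?thesis using phi_swap[of j' l q v] Suc.prems j by simp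
  qed
qed simp

text \<open>Beads are compared by their residue class modulo \<open>r\<close> first, and by their position second.\<close>

definition residue_cmp :: "nat \<Rightarrow> nat \<Rightarrow> nat \<Rightarrow> complex" where
  "residue_cmp r a b = (if a mod r = b mod r then sgn_cmp a b else sgn_cmp (a mod r) (b mod r))"

text \<open>Lowering a bead by \<open>r\<close> onto a free position keeps its residue class and does not pass another bead
of that class.  Thus in the order by \<open>residue_cmp\<close> the arrangement of the beads never changes, and every
removal of a ribbon has the sign \<open>+1\<close>.\<close>

lemma residue_cmp_shift:
  assumes "r \<le> a" "b \<noteq> a" "b \<noteq> a - r"
  shows "residue_cmp r (a - r) b = residue_cmp r a b"
proof -
  have m: "(a - r) mod r = a mod r" using assms(1) using le_mod_geq[of r a] by simp
  show ?thesis
  proof (cases "a mod r = b mod r")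
    case False
    then show ?thesis by (simp add: residue_cmp_def m)
  next
    case True
    have "b < a - r" if "b < a"
    proof -
      have "r dvd a - b" using True that by (metis mod_eq_dvd_iff_nat less_imp_le)
      then have "r \<le> a - b" using that by (auto dest: dvd_imp_le)
      then show ?thesis using assms that by auto
    qed
    then have "sgn_cmp (a - r) b = sgn_cmp a b" using assms by (auto simp: sgn_cmp_def)
    then show ?thesis using True by (simp add: residue_cmp_def m)
  qed
qed

lemma residue_cmp_antisym: "residue_cmp r a b = - residue_cmp r b a"
  by (simp add: residue_cmp_def sgn_cmp_def)

lemma residue_cmp_shift':
  assumes "r \<le> a" "b \<noteq> a" "b \<noteq> a - r"
  shows "residue_cmp r b (a - r) = residue_cmp r b a"
  using residue_cmp_shift[OF assms] residue_cmp_antisym by metis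

lemma alt_noninj:
  assumes "\<And>a. s a a = 0" "\<not> inj_on (count v) {..<l}"
  shows "alt l s v = 0"
proof -
  obtain i j where ij: "i < l" "j < l" "i \<noteq> j" "count v i = count v j" using assms(2) by (auto simp: inj_on_def)
  have "\<exists>i j. i < j \<and> j < l \<and> count v i = count v j"
  proof (cases "i < j")
    case True then show ?thesis using ij by blast
  next
    case False then show ?thesis using ij by (metis linorder_neqE_nat)
  qed
  then obtain i j where "i < j" "j < l" "count v i = count v j" by blast
  then show ?thesis unfolding alt_def
    by (intro prod_zero[OF finite_index_pairs] bexI[of _ "(i, j)"]) (auto simp: assms(1) index_pairs_def)
qed

lemma phi_noninj: "\<not> inj_on (count v) {..<l} \<Longrightarrow> phi q l v = 0"
proof -
  assume "\<not> inj_on (count v) {..<l}"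
  then obtain i j where ij: "i < l" "j < l" "i \<noteq> j" "count v i = count v j" by (auto simp: inj_on_def)
  show ?thesis
  proof (cases "i < j")
    case True then show ?thesis using ij phi_zero by blast
  next
    case False then show ?thesis using ij phi_zero[of j i l v q] by simp
  qed
qed

text \<open>For a symmetric factor the product does not depend on the arrangement.\<close>

lemma alt_symmetric:
  assumes "inj_on (count v) {..<l}" "count v ` {..<l} = {..<l}" and sym: "\<And>a b. t a b = t b a"
  shows "alt l t v = (\<Prod>(a,b)\<in>index_pairs l. t a b)"
proof -
  let ?f = "count v"
  define g where "g = inv_into {..<l} ?f"
  have bij: "bij_betw ?f {..<l} {..<l}" using assms by (simp add: bij_betw_def)
  have fl: "?f i < l" if "i < l" for i using bij that by (auto simp: bij_betw_def)
  have gl: "g i < l" if "i < l" for i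
    using bij_betw_inv_into[OF bij] that by (auto simp: bij_betw_def g_def)
  have gf: "g (?f i) = i" if "i < l" for i
    using bij_betw_inv_into_left[OF bij] that by (simp add: g_def)
  have fg: "?f (g i) = i" if "i < l" for i
    using bij_betw_inv_into_right[OF bij] that by (simp add: g_def)
  let ?o = "\<lambda>h (a, b). if h a < (h b :: nat) then (h a, h b) else (h b, h a)"
  show ?thesis unfolding alt_def
  proof (rule prod.reindex_bij_witness[where i = "?o g" and j = "?o ?f"], goal_cases)
    case (1 x)
    then obtain a b where x: "x = (a, b)" "a < b" "b < l" by (auto simp: index_pairs_def)
    then show ?case using gf[of a] gf[of b] by auto
  next
    case (2 x)
    then obtain a b where x: "x = (a, b)" "a < b" "b < l" by (auto simp: index_pairs_def)
    then have "?f a \<noteq> ?f b" using gf[of a] gf[of b] by auto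
    then show ?case using x fl[of a] fl[of b] by (auto simp: index_pairs_def)
  next
    case (3 x)
    then obtain a b where x: "x = (a, b)" "a < b" "b < l" by (auto simp: index_pairs_def)
    then show ?case using fg[of a] fg[of b] by auto
  next
    case (4 x)
    then obtain a b where x: "x = (a, b)" "a < b" "b < l" by (auto simp: index_pairs_def)
    then have "g a \<noteq> g b" using fg[of a] fg[of b] by auto
    then show ?case using x gl[of a] gl[of b] by (auto simp: index_pairs_def)
  next
    case (5 x)
    then obtain a b where x: "x = (a, b)" by (cases x)
    show ?case unfolding x using sym by auto
  qed
qed

text \<open>The only \<open>l\<close> distinct positions with the minimal sum are \<open>0, \<dots>, l - 1\<close>.\<close>

lemma inj_sum_image:
  fixes f :: "nat \<Rightarrow> nat"
  assumes "inj_on f {..<l}" "(\<Sum>i<l. f i) = \<Sum>{..<l}"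
  shows "f ` {..<l} = {..<l}"
proof -
  let ?B = "f ` {..<l}"
  have B: "?B \<in> level l 0"
    using assms by (simp add: level_def card_image sum.reindex)
  have "{..<l} \<subseteq> ?B" using level_bottom[OF B, of l] by simp
  moreover have "card ?B = l" using assms(1) by (simp add: card_image)
  ultimately show ?thesis by (metis card_lessThan card_subset_eq finite_imageI finite_lessThan)
qed

text \<open>The sign by which the two orders of the beads differ in the position \<open>{..<l}\<close>.\<close>

definition sign_const :: "nat \<Rightarrow> nat \<Rightarrow> complex" where
  "sign_const r l = (\<Prod>(a,b)\<in>index_pairs l. sgn_cmp a b * residue_cmp r a b)"

lemma residue_cmp_sq: "a \<noteq> b \<Longrightarrow> residue_cmp r a b * residue_cmp r a b = 1"
  by (auto simp: residue_cmp_def sgn_cmp_def)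

lemma alt_residue_sq:
  assumes "inj_on (count v) {..<l}"
  shows "alt l (residue_cmp r) v * alt l (residue_cmp r) v = 1"
  unfolding alt_def prod.distrib[symmetric]
proof (rule prod.neutral, clarify)
  fix a b assume "(a, b) \<in> index_pairs l"
  then have "a \<in> {..<l}" "b \<in> {..<l}" "a \<noteq> b" by (auto simp: index_pairs_def)
  then have "count v a \<noteq> count v b" using assms by (auto dest: inj_onD)
  then show "residue_cmp r (count v a) (count v b) * residue_cmp r (count v a) (count v b) = 1"
    by (rule residue_cmp_sq)
qed

lemma sign_const_sq: "sign_const r l * sign_const r l = 1"
  unfolding sign_const_def prod.distrib[symmetric]
proof (rule prod.neutral, clarify)
  fix a b assume "(a, b) \<in> index_pairs l"
  then have "residue_cmp r a b * residue_cmp r a b = 1" "sgn_cmp a b * sgn_cmp a b = 1"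
    by (auto simp: index_pairs_def residue_cmp_sq) (auto simp: sgn_cmp_def)
  then show "sgn_cmp a b * residue_cmp r a b * (sgn_cmp a b * residue_cmp r a b) = 1"
    by (simp add: mult_ac)
qed

text \<open>The sign of the arrangement with respect to \<open>residue_cmp\<close> is unchanged by removing ribbons, so all
terms of \<open>phi_power_sum\<close> come with the same sign and their number is counted by \<open>paths\<close>.  Terms in which
a bead would be moved onto another one vanish.\<close>

theorem phi_eq_paths:
  fixes q :: complex
  assumes r: "r > 0" and qr: "q ^ r = 1" and prim: "\<And>j. 0 < j \<Longrightarrow> j < r \<Longrightarrow> q ^ j \<noteq> 1"
    and v: "set_mset v \<subseteq> {..<l}" "size v = \<Sum>{..<l} + r * d"
  shows "phi q l v = sign_const r l * alt l (residue_cmp r) v * of_nat (paths r d {..<l} (count v ` {..<l}))"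
  using v
proof (induction d arbitrary: v)
  case 0
  show ?case
  proof (cases "inj_on (count v) {..<l}")
    case False
    have "alt l (residue_cmp r) v = 0"
      by (rule alt_noninj[OF _ False]) (simp add: residue_cmp_def sgn_cmp_def)
    then show ?thesis using phi_noninj[OF False] by simp
  next
    case True
    have im: "count v ` {..<l} = {..<l}"
      using inj_sum_image[OF True] size_supp[OF 0(1)] 0(2) by simp
    let ?t = "\<lambda>a b. sgn_cmp a b * residue_cmp r a b"
    have "?t a b = ?t b a" for a b by (auto simp: residue_cmp_def sgn_cmp_def)
    then have "alt l ?t v = sign_const r l"
      unfolding sign_const_def by (rule alt_symmetric[OF True im])
    moreover have "alt l ?t v = alt l sgn_cmp v * alt l (residue_cmp r) v"
      unfolding alt_def prod.distrib[symmetric] by (simp add: case_prod_unfold)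
    ultimately have "alt l sgn_cmp v * (alt l (residue_cmp r) v * alt l (residue_cmp r) v)
      = sign_const r l * alt l (residue_cmp r) v" by (simp add: mult_ac)
    then have "alt l sgn_cmp v = sign_const r l * alt l (residue_cmp r) v"
      using alt_residue_sq[OF True] by simp
    then show ?thesis using 0 im by (simp add: phi.simps)
  qed
next
  case (Suc d)
  show ?case
  proof (cases "inj_on (count v) {..<l}")
    case False
    have "alt l (residue_cmp r) v = 0"
      by (rule alt_noninj[OF _ False]) (simp add: residue_cmp_def sgn_cmp_def)
    then show ?thesis using phi_noninj[OF False] by simp
  next
    case True
    let ?B = "count v ` {..<l}"
    let ?I = "{i. i < l \<and> r \<le> count v i}"
    let ?J = "{i. i < l \<and> r \<le> count v i \<and> count v i - r \<notin> ?B}"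
    let ?v = "\<lambda>i. v - replicate_mset r i"
    let ?K = "sign_const r l * alt l (residue_cmp r) v"
    have cnt: "count (?v i) j = (if j = i then count v i - r else count v j)" for i j by simp
    have "phi q l v = (\<Sum>i\<in>?I. phi q l (?v i))"
      by (rule phi_power_sum[OF r qr prim Suc.prems])
    also have "\<dots> = (\<Sum>i\<in>?J. phi q l (?v i))"
    proof (rule sum.mono_neutral_right)
      show "\<forall>i\<in>?I - ?J. phi q l (?v i) = 0"
      proof
        fix i assume "i \<in> ?I - ?J"
        then obtain j where j: "i < l" "r \<le> count v i" "j < l" "count v i - r = count v j" by auto
        have "j \<noteq> i" using j r by auto
        have "\<not> inj_on (count (?v i)) {..<l}"
        proof
          assume I: "inj_on (count (?v i)) {..<l}"
          have "count (?v i) i = count (?v i) j" unfolding cnt using j \<open>j \<noteq> i\<close> by simp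
          from inj_onD[OF I this] show False using j \<open>j \<noteq> i\<close> by simp
        qed
        then show "phi q l (?v i) = 0" by (rule phi_noninj)
      qed
    qed auto
    also have "\<dots> = (\<Sum>i\<in>?J. ?K * of_nat (paths r d {..<l} (lower r (count v i - r) ?B)))"
    proof (rule sum.cong[OF refl])
      fix i assume i: "i \<in> ?J"
      have "set_mset (?v i) \<subseteq> {..<l}" using Suc.prems(1) by (meson in_diffD subset_eq)
      moreover have "size (?v i) = \<Sum>{..<l} + r * d"
        using i Suc.prems(2) by (simp add: size_Diff_submset count_le_replicate_mset_subset_eq[symmetric])
      ultimately have "phi q l (?v i) = sign_const r l * alt l (residue_cmp r) (?v i) *
          of_nat (paths r d {..<l} (count (?v i) ` {..<l}))" by (rule Suc.IH)
      \<comment> \<open>The arrangement by residues is not changed by the move.\<close>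
      also have "alt l (residue_cmp r) (?v i) = alt l (residue_cmp r) v"
        unfolding alt_def
      proof (rule prod.cong[OF refl], clarify)
        fix a b assume ab: "(a, b) \<in> index_pairs l"
        then have ab: "a < b" "a < l" "b < l" by (auto simp: index_pairs_def)
        have ne: "count v j \<noteq> count v i" "count v j \<noteq> count v i - r" if "j < l" "j \<noteq> i" for j
        proof -
          show "count v j \<noteq> count v i" using True i that by (auto dest: inj_onD)
          have "count v j \<in> ?B" using that by simp
          then show "count v j \<noteq> count v i - r" using i by auto
        qed
        show "residue_cmp r (count (?v i) a) (count (?v i) b) = residue_cmp r (count v a) (count v b)"
          unfolding cnt using ab i ne[of a] ne[of b] residue_cmp_shift[of r "count v i" "count v b"]
            residue_cmp_shift'[of r "count v i" "count v a"] by auto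
      qed
      also have "count (?v i) ` {..<l} = lower r (count v i - r) ?B"
      proof -
        have "count (?v i) ` {..<l} = insert (count v i - r) (count v ` ({..<l} - {i}))"
          unfolding cnt using i by auto
        also have "count v ` ({..<l} - {i}) = ?B - {count v i}"
          using True i by (auto simp: inj_on_def)
        finally show ?thesis using i by (simp add: lower_def)
      qed
      finally show "phi q l (?v i) = ?K * of_nat (paths r d {..<l} (lower r (count v i - r) ?B))" .
    qed
    also have "\<dots> = (\<Sum>c\<in>holes r ?B. ?K * of_nat (paths r d {..<l} (lower r c ?B)))"
    proof (rule sum.reindex_bij_betw[where h = "\<lambda>i. count v i - r" and g = "\<lambda>c. ?K * of_nat (paths r d {..<l} (lower r c ?B))"])
      show "bij_betw (\<lambda>i. count v i - r) ?J (holes r ?B)"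
        unfolding bij_betw_def
      proof
        show "inj_on (\<lambda>i. count v i - r) ?J"
          using True by (auto simp: inj_on_def eq_diff_iff)
        show "(\<lambda>i. count v i - r) ` ?J = holes r ?B"
        proof (intro equalityI subsetI)
          fix c assume c: "c \<in> holes r ?B"
          then obtain i where i: "i < l" "c + r = count v i" "c \<notin> ?B" by (auto simp: holes_def)
          then have "i \<in> ?J" "c = count v i - r" by (auto simp: add_diff_eq simp flip: i(2))
          then show "c \<in> (\<lambda>i. count v i - r) ` ?J" by blast
        qed (auto simp: holes_def)
      qed
    qed
    also have "\<dots> = ?K * of_nat (paths r (Suc d) {..<l} ?B)"
      by (simp add: sum_distrib_left paths.simps(2))
    finally show ?thesis .
  qed
qed

text \<open>Squaring removes both signs.\<close>

corollary phi_squared: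
  fixes q :: complex
  assumes "r > 0" "q ^ r = 1" "\<And>j. 0 < j \<Longrightarrow> j < r \<Longrightarrow> q ^ j \<noteq> 1"
    and "set_mset v \<subseteq> {..<l}" "size v = \<Sum>{..<l} + r * d" "strict_dec l v"
  shows "(phi q l v)\<^sup>2 = of_nat ((paths r d {..<l} (count v ` {..<l}))\<^sup>2)"
proof -
  have inj: "inj_on (count v) {..<l}" by (rule strict_dec_inj[OF assms(6)])
  have eq: "phi q l v = sign_const r l * alt l (residue_cmp r) v * of_nat (paths r d {..<l} (count v ` {..<l}))"
    by (rule phi_eq_paths[OF assms(1-5)])
  show ?thesis
    unfolding eq power2_eq_square
    using sign_const_sq[of r l] alt_residue_sq[OF inj, of r]
    by (simp add: mult_ac)
qed

section \<open>Standard tableaux as lattice words\<close>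

lemma lattice_word_iff:
  "lattice_word l w \<longleftrightarrow> set w \<subseteq> {..<l} \<and> (\<forall>k. strict_dec l (state l (drop k w)))"
proof (induction w)
  case Nil
  then show ?case by (simp add: state_def strict_dec_delta)
next
  case (Cons j w)
  have "(\<forall>k. strict_dec l (state l (drop k (j # w)))) \<longleftrightarrow>
      strict_dec l (state l (j # w)) \<and> (\<forall>k. strict_dec l (state l (drop k w)))"
    by (metis drop0 drop_Suc_Cons nat.exhaust)
  then show ?case using Cons by auto
qed

text \<open>The letter that belongs to the entry \<open>m\<close>, as words are read from right to left.\<close>

definition letter :: "nat list \<Rightarrow> nat \<Rightarrow> nat" where
  "letter w m = w ! (length w - m)"

lemma letter_Cons: "1 \<le> m \<Longrightarrow> m \<le> length u \<Longrightarrow> letter (j # u) m = letter u m"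
  by (simp add: letter_def nth_Cons split: nat.split) (metis Suc_diff_le diff_Suc_1 nat.inject)

lemma letter_Cons_last: "letter (j # u) (Suc (length u)) = j"
  by (simp add: letter_def)

lemma wmaj_eq: "wmaj w = \<Sum>{m. 1 \<le> m \<and> m < length w \<and> letter w m < letter w (Suc m)}"
proof (induction w rule: wmaj.induct)
  case (1 j i w)
  let ?D = "\<lambda>w. {m. 1 \<le> m \<and> m < length w \<and> letter w m < letter w (Suc m)}"
  let ?u = "i # w"
  have "?D (j # ?u) = ?D ?u \<union> (if i < j then {length ?u} else {})"
  proof (rule Set.set_eqI)
    fix m
    show "m \<in> ?D (j # ?u) \<longleftrightarrow> m \<in> ?D ?u \<union> (if i < j then {length ?u} else {})"
    proof (cases "m < length ?u")
      case True
      then show ?thesis using letter_Cons[of m ?u j] letter_Cons[of "Suc m" ?u j] by auto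
    next
      case False
      then show ?thesis
        using letter_Cons_last[of j ?u] letter_Cons[of "length ?u" ?u j] letter_Cons_last[of i w]
        by (auto simp: less_Suc_eq)
    qed
  qed
  moreover have "finite (?D ?u)" by (rule finite_subset[of _ "{..<length ?u}"]) auto
  ultimately have "\<Sum>(?D (j # ?u)) = \<Sum>(?D ?u) + (if i < j then length ?u else 0)"
    by (simp add: sum.union_disjoint)
  then show ?case using 1 by simp
qed auto

lemma map_letter:
  assumes "N \<le> length w"
  shows "map (letter w) [1..<Suc N] = rev (drop (length w - N) w)"
proof (rule nth_equalityI)
  fix i assume "i < length (map (letter w) [1..<Suc N])"
  then show "map (letter w) [1..<Suc N] ! i = rev (drop (length w - N) w) ! i"
    using assms by (simp add: rev_nth letter_def del: upt_Suc)
qed (use assms in simp)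

definition row_entries :: "nat list \<Rightarrow> nat \<Rightarrow> nat list" where
  "row_entries w i = filter (\<lambda>m. letter w m = i) [1..<Suc (length w)]"

text \<open>The entry \<open>m\<close> is placed in row \<open>letter w m\<close> (Yamanouchi word to tableau).\<close>

definition tab :: "nat list \<Rightarrow> nat list \<Rightarrow> tableau" where
  "tab lam w = map (row_entries w) [0..<length lam]"

text \<open>The entries up to \<open>N\<close> in a row are counted by the suffix of length \<open>N\<close>, which relates the lattice
condition to the shapes of the subtableaux.\<close>

lemma length_filter_row_entries:
  assumes "N \<le> length w"
  shows "length (filter (\<lambda>x. x \<le> N) (row_entries w i)) = count (mset (drop (length w - N) w)) i"
proof -
  have "filter (\<lambda>x. x \<le> N) [1..<Suc (length w)] = [1..<Suc N]"
  proof -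
    have "[1..<Suc (length w)] = [1..<Suc N] @ [Suc N..<Suc (length w)]"
      using assms by (metis le_add1 le_add_diff_inverse plus_1_eq_Suc upt_add_eq_append Suc_le_mono le_Suc_eq add_Suc)
    moreover have "filter (\<lambda>x. x \<le> N) [1..<Suc N] = [1..<Suc N]" by (rule filter_True) auto
    moreover have "filter (\<lambda>x. x \<le> N) [Suc N..<Suc (length w)] = []" by (rule filter_False) auto
    ultimately show ?thesis by (simp del: upt_Suc)
  qed
  then have "filter (\<lambda>x. x \<le> N) (row_entries w i) = filter (\<lambda>m. letter w m = i) [1..<Suc N]"
  proof -
    have "filter (\<lambda>x. x \<le> N) (filter (\<lambda>m. letter w m = i) xs) = filter (\<lambda>m. letter w m = i) (filter (\<lambda>x. x \<le> N) xs)" for xs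
      by (simp add: conj_commute)
    then show ?thesis unfolding row_entries_def
      using \<open>filter (\<lambda>x. x \<le> N) [1..<Suc (length w)] = [1..<Suc N]\<close> by (simp only:)
  qed
  also have "length \<dots> = length (filter (\<lambda>x. x = i) (map (letter w) [1..<Suc N]))"
    by (simp add: filter_map o_def del: upt_Suc)
  also have "\<dots> = count (mset (map (letter w) [1..<Suc N])) i"
  proof -
    have "length (filter (\<lambda>x. x = i) xs) = count (mset xs) i" for xs :: "nat list" by (induction xs) auto
    then show ?thesis .
  qed
  also have "\<dots> = count (mset (drop (length w - N) w)) i"
    unfolding map_letter[OF assms] by simp
  finally show ?thesis .
qed

lemma length_row_entries: "length (row_entries w i) = count (mset w) i"
proof -
  have "filter (\<lambda>x. x \<le> length w) (row_entries w i) = row_entries w i"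
    by (rule filter_True) (auto simp: row_entries_def)
  then show ?thesis using length_filter_row_entries[of "length w" w i] by simp
qed

lemma sorted_row_entries: "sorted_wrt (<) (row_entries w i)"
  unfolding row_entries_def by (rule sorted_wrt_filter) (simp del: upt_Suc)

text \<open>Translates between comparing entries column by column and comparing the numbers of small entries in
two rows.\<close>

lemma nth_le_iff:
  fixes xs :: "nat list"
  assumes "sorted_wrt (<) xs" "j < length xs"
  shows "xs ! j \<le> N \<longleftrightarrow> j < length (filter (\<lambda>x. x \<le> N) xs)"
  using assms
proof (induction xs arbitrary: j)
  case (Cons x xs)
  show ?case
  proof (cases "x \<le> N")
    case True
    then show ?thesis using Cons by (cases j) auto
  next
    case False
    then have "\<forall>y\<in>set xs. \<not> y \<le> N" using Cons.prems by auto
    then show ?thesis using False Cons.prems by (cases j) (auto simp: filter_empty_conv)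
  qed
qed simp

lemma mset_concat_filter:
  "mset (concat (map (\<lambda>i. filter (\<lambda>m. f m = i) xs) [0..<k])) = mset (filter (\<lambda>m. f m < (k::nat)) xs)"
proof (induction k)
  case (Suc k)
  have "mset (filter (\<lambda>m. f m < Suc k) xs) = mset (filter (\<lambda>m. f m < k) xs) + mset (filter (\<lambda>m. f m = k) xs)"
    by (induction xs) auto
  then show ?case using Suc by simp
qed simp

definition part_mset :: "nat list \<Rightarrow> nat multiset" where
  "part_mset lam = (\<Sum>i<length lam. replicate_mset (lam ! i) i)"

lemma count_part_mset: "count (part_mset lam) i = (if i < length lam then lam ! i else 0)"
  unfolding part_mset_def by (simp add: count_sum sum.delta' if_distrib cong: if_cong)

text \<open>The strictly decreasing vector of a partition; its coordinates are the beads.\<close>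

definition vec :: "nat \<Rightarrow> nat list \<Rightarrow> nat multiset" where
  "vec l lam = delta l + part_mset lam"

lemma words_vec: "words l (vec l lam) = {w. lattice_word l w \<and> mset w = part_mset lam}"
  by (auto simp: words_def state_def vec_def)

lemma part_mset_length: "mset w = part_mset lam \<Longrightarrow> length w = sum_list lam"
proof -
  assume "mset w = part_mset lam"
  then have "length w = size (part_mset lam)" by (metis size_mset)
  also have "\<dots> = sum_list lam"
  proof -
    have "size (\<Sum>i<k. replicate_mset (f i) i) = (\<Sum>i<k. f i)" for k :: nat and f
      by (induction k) auto
    then show ?thesis by (simp add: part_mset_def sum_list_sum_nth atLeast0LessThan)
  qed
  finally show ?thesis .
qed

lemma part_mset_letters: "mset w = part_mset lam \<Longrightarrow> x \<in> set w \<Longrightarrow> x < length lam"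
  using count_part_mset[of lam x] by (metis count_greater_zero_iff less_irrefl set_mset_mset)

lemma letter_in: "1 \<le> m \<Longrightarrow> m \<le> length w \<Longrightarrow> letter w m \<in> set w"
  by (simp add: letter_def)

lemma tab_mem:
  assumes "i < length lam"
  shows "m \<in> set (tab lam w ! i) \<longleftrightarrow> 1 \<le> m \<and> m \<le> length w \<and> letter w m = i"
  using assms by (auto simp: tab_def row_entries_def simp del: upt_Suc)

lemma partitions_decreasing:
  assumes "lam \<in> partitions n" "i < j" "j < length lam"
  shows "lam ! j \<le> lam ! i"
  using assms by (auto simp: partitions_def sorted_wrt_iff_nth_less)

lemma partitions_length:
  assumes "lam \<in> partitions n"
  shows "length lam \<le> n"
proof -
  have "length xs \<le> sum_list xs" if "0 \<notin> set xs" for xs :: "nat list"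
    using that by (induction xs) (auto simp: Suc_le_eq)
  then show ?thesis using assms by (auto simp: partitions_def)
qed

lemma strict_dec_state:
  assumes "strict_dec l (state l w)" "Suc i < l"
  shows "count (mset w) (Suc i) \<le> count (mset w) i"
proof -
  have "count (state l w) (Suc i) < count (state l w) i" using assms by (simp add: strict_dec_def)
  then show ?thesis using assms(2) by (simp add: state_def count_delta)
qed

text \<open>Columns increase because every suffix of the word has at least as many letters \<open>i\<close> as letters
\<open>i + 1\<close>.\<close>

lemma tab_SYT:
  assumes lam: "lam \<in> partitions n" and l: "length lam \<le> l" and w: "w \<in> words l (vec l lam)"
  shows "tab lam w \<in> SYT lam"
proof -
  have L: "lattice_word l w" and m: "mset w = part_mset lam" using w by (auto simp: words_vec)
  have len: "length w = sum_list lam" by (rule part_mset_length[OF m])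
  have sh: "shape (tab lam w) = lam"
    by (rule nth_equalityI) (simp_all add: shape_def tab_def length_row_entries m count_part_mset)
  have "mset (concat (tab lam w)) = mset (filter (\<lambda>x. letter w x < length lam) [1..<Suc (length w)])"
    unfolding tab_def row_entries_def by (rule mset_concat_filter)
  also have "filter (\<lambda>x. letter w x < length lam) [1..<Suc (length w)] = [1..<Suc (length w)]"
    using part_mset_letters[OF m letter_in] by (intro filter_True) auto
  finally have c: "mset (concat (tab lam w)) = mset [1..<Suc (sum_list lam)]" by (simp only: len)
  have "column_strict (tab lam w)"
    unfolding column_strict_def
  proof (intro allI impI, elim conjE)
    fix i j assume i: "Suc i < length (tab lam w)" and j: "j < length (tab lam w ! i)" "j < length (tab lam w ! Suc i)"
    have il: "Suc i < length lam" using i by (simp add: tab_def)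
    have ri: "tab lam w ! i = row_entries w i" "tab lam w ! Suc i = row_entries w (Suc i)"
      using il by (simp_all add: tab_def)
    define N where "N = row_entries w (Suc i) ! j"
    have "N \<in> set (row_entries w (Suc i))" using j ri by (simp add: N_def)
    then have N: "N \<le> length w" "letter w N = Suc i" by (auto simp: row_entries_def)
    have "j < length (filter (\<lambda>x. x \<le> N) (row_entries w (Suc i)))"
      using nth_le_iff[OF sorted_row_entries, of j w "Suc i" N] j ri by (simp add: N_def)
    also have "\<dots> \<le> length (filter (\<lambda>x. x \<le> N) (row_entries w i))"
      unfolding length_filter_row_entries[OF N(1)]
      using L il l by (intro strict_dec_state[of l]) (auto simp: lattice_word_iff)
    finally have "row_entries w i ! j \<le> N"
      using nth_le_iff[OF sorted_row_entries, of j w i N] j ri by simp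
    moreover have "row_entries w i ! j \<in> set (row_entries w i)" using j ri by simp
    then have "letter w (row_entries w i ! j) = i" by (auto simp: row_entries_def)
    ultimately show "tab lam w ! i ! j < tab lam w ! Suc i ! j"
      using N(2) unfolding ri N_def[symmetric] by (metis le_neq_implies_less n_not_Suc_n)
  qed
  then show ?thesis
    unfolding SYT_def using sh c by (auto simp: tab_def sorted_row_entries)
qed

lemma SYT_mem:
  assumes "T \<in> SYT lam"
  shows "length T = length lam" "\<And>i. i < length lam \<Longrightarrow> length (T ! i) = lam ! i"
    "\<And>i. i < length lam \<Longrightarrow> sorted_wrt (<) (T ! i)" "distinct (concat T)"
    "set (concat T) = {1..sum_list lam}" "column_strict T"
proof -
  have sh: "shape T = lam" and m: "mset (concat T) = mset [1..<Suc (sum_list lam)]"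
    and s: "\<forall>r\<in>set T. sorted_wrt (<) r" and c: "column_strict T"
    using assms by (auto simp: SYT_def)
  show len: "length T = length lam" using sh by (auto simp: shape_def)
  show "length (T ! i) = lam ! i" if "i < length lam" for i using that unfolding sh[symmetric] shape_def by simp
  show "sorted_wrt (<) (T ! i)" if "i < length lam" for i using s that len by auto
  show "distinct (concat T)" using mset_eq_imp_distinct_iff[OF m] by (simp del: upt_Suc)
  have "set (concat T) = set [1..<Suc (sum_list lam)]" using mset_eq_setD[OF m] .
  then show "set (concat T) = {1..sum_list lam}" by (simp only: set_upt atLeastLessThanSuc_atLeastAtMost)
  show "column_strict T" by (rule c)
qed

lemma distinct_concat_unique:
  assumes "distinct (concat T)" "i < length T" "j < length T" "m \<in> set (T ! i)" "m \<in> set (T ! j)"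
  shows "i = j"
proof (rule ccontr)
  assume "i \<noteq> j"
  have *: False if "a < b" "b < length T" "m \<in> set (T ! a)" "m \<in> set (T ! b)" for a b
  proof -
    have "T = take b T @ T ! b # drop (Suc b) T" using that by (simp add: id_take_nth_drop)
    then have "distinct (concat (take b T) @ T ! b @ concat (drop (Suc b) T))"
      using assms(1) by (metis concat.simps(2) concat_append)
    moreover have "T ! a \<in> set (take b T)"
      using that by (auto simp: in_set_conv_nth intro!: exI[of _ a])
    then have "m \<in> set (concat (take b T))" using that by auto
    ultimately show False using that by auto
  qed
  show False using \<open>i \<noteq> j\<close> *[of i j] *[of j i] assms by (cases "i < j") auto
qed

text \<open>Inverse direction: the row of an entry.\<close>

definition row_of :: "tableau \<Rightarrow> nat \<Rightarrow> nat" where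
  "row_of T m = (THE i. i < length T \<and> m \<in> set (T ! i))"

lemma row_of_eq:
  assumes "T \<in> SYT lam" "i < length T" "m \<in> set (T ! i)"
  shows "row_of T m = i"
  unfolding row_of_def using distinct_concat_unique[OF SYT_mem(4)[OF assms(1)]] assms(2,3)
  by (intro the_equality) auto

text \<open>The word lists the rows of the entries in decreasing order.  Its suffixes are the contents of the
subtableaux with entries up to \<open>N\<close>, which are partitions because columns increase.\<close>

lemma tab_surj:
  assumes lam: "lam \<in> partitions n" and l: "length lam \<le> l" and T: "T \<in> SYT lam"
  shows "T \<in> tab lam ` words l (vec l lam)"
proof -
  note S = SYT_mem[OF T]
  define w where "w = map (row_of T) (rev [1..<Suc (sum_list lam)])"
  have lw: "length w = sum_list lam" by (simp add: w_def del: upt_Suc)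
  have let_eq: "letter w m = row_of T m" if "1 \<le> m" "m \<le> length w" for m
  proof -
    have "letter w m = row_of T (rev [1..<Suc (sum_list lam)] ! (sum_list lam - m))"
      using that lw unfolding letter_def by (subst w_def) (simp del: upt_Suc)
    also have "rev [1..<Suc (sum_list lam)] ! (sum_list lam - m) = m"
      using that lw by (simp add: rev_nth del: upt_Suc)
    finally show ?thesis .
  qed
  have rowset: "set (T ! i) = {m. 1 \<le> m \<and> m \<le> length w \<and> letter w m = i}" if i: "i < length T" for i
  proof (intro equalityI subsetI)
    fix m assume m: "m \<in> set (T ! i)"
    then have "m \<in> set (concat T)" using i by auto
    then have "1 \<le> m" "m \<le> length w" using S(5) lw by auto
    then show "m \<in> {m. 1 \<le> m \<and> m \<le> length w \<and> letter w m = i}"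
      using let_eq row_of_eq[OF T i m] by auto
  next
    fix m assume m: "m \<in> {m. 1 \<le> m \<and> m \<le> length w \<and> letter w m = i}"
    then have "m \<in> set (concat T)" using S(5) lw by auto
    then obtain j where j: "j < length T" "m \<in> set (T ! j)"
      unfolding set_concat by (auto simp: in_set_conv_nth[of _ T])
    then have "j = i" using row_of_eq[OF T j] let_eq m by auto
    then show "m \<in> set (T ! i)" using j by simp
  qed
  have rows: "row_entries w i = T ! i" if i: "i < length T" for i
  proof (rule strict_sorted_equal)
    show "sorted_wrt (<) (row_entries w i)" by (rule sorted_row_entries)
    show "sorted_wrt (<) (T ! i)" using S(1,3) i by auto
    show "set (row_entries w i) = set (T ! i)" unfolding rowset[OF i] by (auto simp: row_entries_def)
  qed
  have Teq: "tab lam w = T"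
    by (rule nth_equalityI) (simp_all add: tab_def S(1) rows)
  have wlet: "x < length lam" if "x \<in> set w" for x
  proof -
    from that obtain m where m: "x = row_of T m" "m \<in> {1..sum_list lam}" by (auto simp: w_def)
    have "m \<in> set (concat T)" using S(5) m(2) by simp
    then obtain j where j: "j < length T" "m \<in> set (T ! j)"
      unfolding set_concat by (auto simp: in_set_conv_nth[of _ T])
    then show ?thesis using row_of_eq[OF T j] m S(1) by simp
  qed
  have "mset w = part_mset lam"
  proof (rule multiset_eqI)
    fix i
    show "count (mset w) i = count (part_mset lam) i"
    proof (cases "i < length lam")
      case True
      then show ?thesis using length_row_entries[of w i] rows[of i] S(1,2) by (simp add: count_part_mset)
    next
      case False
      then show ?thesis using wlet by (auto simp: count_part_mset count_mset_0_iff)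
    qed
  qed
  moreover have "lattice_word l w" unfolding lattice_word_iff
  proof (intro conjI allI)
    show "set w \<subseteq> {..<l}" using wlet l by fastforce
    fix k
    show "strict_dec l (state l (drop k w))" unfolding strict_dec_def
    proof (intro allI impI)
      fix i assume i: "Suc i < l"
      have "count (mset (drop k w)) (Suc i) \<le> count (mset (drop k w)) i"
      proof (cases "Suc i < length lam \<and> k \<le> length w")
        case True
        define N where "N = length w - k"
        have N: "N \<le> length w" "length w - N = k" using True by (auto simp: N_def)
        let ?f = "\<lambda>i. length (filter (\<lambda>x. x \<le> N) (T ! i))"
        have cnt: "count (mset (drop k w)) i = ?f i" if "i < length lam" for i
          using length_filter_row_entries[OF N(1), of i] rows[of i] that S(1) N(2) by simp
        have "?f (Suc i) \<le> ?f i"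
        proof (cases "?f (Suc i)")
          case (Suc j)
          have jl: "j < length (T ! Suc i)" using Suc length_filter_le[of "\<lambda>x. x \<le> N" "T ! Suc i"] by linarith
          then have jl': "j < length (T ! i)"
            using S(2)[of i] S(2)[of "Suc i"] True partitions_decreasing[OF lam, of i "Suc i"] by simp
          have "T ! Suc i ! j \<le> N" using nth_le_iff[OF S(3) jl, of N] True Suc by simp
          moreover have "T ! i ! j < T ! Suc i ! j" using S(6) jl jl' True S(1) by (simp add: column_strict_def)
          ultimately have "T ! i ! j \<le> N" by simp
          then show ?thesis using nth_le_iff[OF S(3) jl', of N] True Suc by simp
        qed simp
        then show ?thesis using cnt True by simp
      next
        case False
        have "count (mset (drop k w)) (Suc i) = 0"
          using False wlet[of "Suc i"] by (auto simp: count_mset_0_iff dest: in_set_dropD)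
        then show ?thesis by linarith
      qed
      then show "count (state l (drop k w)) (Suc i) < count (state l (drop k w)) i"
        using i by (simp add: state_def count_delta)
    qed
  qed
  ultimately have "w \<in> words l (vec l lam)" by (simp add: words_vec)
  then show ?thesis using Teq by blast
qed

lemma tab_inj: "inj_on (tab lam) (words l (vec l lam))"
proof (rule inj_onI)
  fix w w' assume w: "w \<in> words l (vec l lam)" and w': "w' \<in> words l (vec l lam)" and eq: "tab lam w = tab lam w'"
  have m: "mset w = part_mset lam" "mset w' = part_mset lam" using w w' by (auto simp: words_vec)
  have len: "length w = length w'" using part_mset_length m by metis
  have "letter w m = letter w' m" if mm: "1 \<le> m" "m \<le> length w" for m
  proof -
    have "letter w m < length lam" using part_mset_letters[OF m(1) letter_in[OF mm]] .
    from tab_mem[OF this, of m w] tab_mem[OF this, of m w'] eq mm show ?thesis by auto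
  qed
  then show "w = w'"
  proof (intro nth_equalityI len)
    fix i assume H: "\<And>m. 1 \<le> m \<Longrightarrow> m \<le> length w \<Longrightarrow> letter w m = letter w' m" and i: "i < length w"
    show "w ! i = w' ! i" using H[of "length w - i"] i len by (simp add: letter_def)
  qed
qed

lemma maj_tab:
  assumes "w \<in> words l (vec l lam)"
  shows "maj (tab lam w) = wmaj w"
proof -
  have m: "mset w = part_mset lam" using assms by (auto simp: words_vec)
  have lt: "letter w m < length lam" if "1 \<le> m" "m \<le> length w" for m
    using part_mset_letters[OF m letter_in[OF that]] .
  have "descents (tab lam w) = {m. 1 \<le> m \<and> m < length w \<and> letter w m < letter w (Suc m)}"
  proof (intro equalityI subsetI)
    fix j assume "j \<in> descents (tab lam w)"
    then obtain a b where "a < b" "b < length lam" "j \<in> set (tab lam w ! a)" "Suc j \<in> set (tab lam w ! b)"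
      by (auto simp: descents_def tab_def)
    then show "j \<in> {m. 1 \<le> m \<and> m < length w \<and> letter w m < letter w (Suc m)}"
      using tab_mem[of a lam j w] tab_mem[of b lam "Suc j" w] by auto
  next
    fix j assume "j \<in> {m. 1 \<le> m \<and> m < length w \<and> letter w m < letter w (Suc m)}"
    then have j: "1 \<le> j" "j < length w" "letter w j < letter w (Suc j)" by auto
    then have "j \<in> set (tab lam w ! letter w j)" "Suc j \<in> set (tab lam w ! letter w (Suc j))"
      using lt[of j] lt[of "Suc j"] by (simp_all add: tab_mem)
    moreover have "letter w (Suc j) < length (tab lam w)" using lt[of "Suc j"] j by (simp add: tab_def)
    ultimately show "j \<in> descents (tab lam w)" unfolding descents_def using j(3) by blast
  qed
  then show ?thesis by (simp add: maj_def wmaj_eq)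
qed

lemma vec_supp: "length lam \<le> l \<Longrightarrow> set_mset (vec l lam) \<subseteq> {..<l}"
  using set_delta[of l] count_part_mset[of lam]
  by (auto simp: vec_def subset_iff simp flip: count_greater_zero_iff split: if_splits)

lemma vec_strict_dec:
  assumes "lam \<in> partitions n"
  shows "strict_dec l (vec l lam)"
  using partitions_decreasing[OF assms] by (fastforce simp: strict_dec_def vec_def count_delta count_part_mset)

text \<open>The bijection \<open>tab\<close> carries the major index of words to that of tableaux.\<close>

theorem SYT_maj_eq_phi:
  assumes lam: "lam \<in> partitions n" and l: "length lam \<le> l"
  shows "(\<Sum>T\<in>SYT lam. q ^ maj T) = phi q l (vec l lam)"
proof -
  have "tab lam ` words l (vec l lam) = SYT lam"
    using tab_surj[OF assms] tab_SYT[OF assms] by blast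
  then have "(\<Sum>T\<in>SYT lam. q ^ maj T) = (\<Sum>w\<in>words l (vec l lam). q ^ maj (tab lam w))"
    using sum.reindex[OF tab_inj, of "\<lambda>T. q ^ maj T" lam l] by simp
  also have "\<dots> = (\<Sum>w\<in>words l (vec l lam). q ^ wmaj w)"
    by (rule sum.cong) (simp_all add: maj_tab)
  also have "\<dots> = phi q l (vec l lam)"
    by (rule words_maj_eq_phi[OF vec_strict_dec[OF lam] vec_supp[OF l]])
  finally show ?thesis .
qed

section \<open>Injectivity of Robinson--Schensted insertion\<close>

text \<open>The condition on two neighbouring rows of a tableau with increasing columns.\<close>

definition above :: "nat list \<Rightarrow> nat list \<Rightarrow> bool" where
  "above r s \<longleftrightarrow> length s \<le> length r \<and> (\<forall>j<length s. r ! j < s ! j)"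

text \<open>Tableaux with arbitrary distinct entries, as they occur during the insertion.  In contrast to \<open>SYT\<close>, the
shape is not a parameter, and it is a partition by construction.\<close>

definition increasing_tableau :: "tableau \<Rightarrow> bool" where
  "increasing_tableau T \<longleftrightarrow> (\<forall>i<length T. T ! i \<noteq> [] \<and> sorted_wrt (<) (T ! i)) \<and>
     (\<forall>i. Suc i < length T \<longrightarrow> above (T ! i) (T ! Suc i))"

lemma increasing_tableau_Nil [simp]: "increasing_tableau []"
  by (simp add: increasing_tableau_def)

lemma increasing_tableau_Cons:
  "increasing_tableau (r # rs) \<longleftrightarrow> r \<noteq> [] \<and> sorted_wrt (<) r \<and> increasing_tableau rs \<and> (rs \<noteq> [] \<longrightarrow> above r (hd rs))"
proof -
  have 1: "(\<forall>i<length (r # rs). (r # rs) ! i \<noteq> [] \<and> sorted_wrt (<) ((r # rs) ! i)) \<longleftrightarrow>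
      r \<noteq> [] \<and> sorted_wrt (<) r \<and> (\<forall>i<length rs. rs ! i \<noteq> [] \<and> sorted_wrt (<) (rs ! i))"
    by (auto simp: All_less_Suc2)
  have 2: "(\<forall>i. Suc i < length (r # rs) \<longrightarrow> above ((r # rs) ! i) ((r # rs) ! Suc i)) \<longleftrightarrow>
      (rs \<noteq> [] \<longrightarrow> above r (hd rs)) \<and> (\<forall>i. Suc i < length rs \<longrightarrow> above (rs ! i) (rs ! Suc i))"
  proof -
    have "(\<forall>i<length rs. above ((r # rs) ! i) (rs ! i)) \<longleftrightarrow>
      (rs \<noteq> [] \<longrightarrow> above r (hd rs)) \<and> (\<forall>i. Suc i < length rs \<longrightarrow> above (rs ! i) (rs ! Suc i))"
      by (cases rs) (auto simp: All_less_Suc2)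
    then show ?thesis by simp
  qed
  show ?thesis unfolding increasing_tableau_def 1 2 by blast
qed

lemma row_insert_None:
  "row_insert x r = (r', None) \<Longrightarrow> r' = r @ [x] \<and> (\<forall>y\<in>set r. \<not> x < y)"
  by (induction x r arbitrary: r' rule: row_insert.induct) (auto split: if_splits prod.splits)

text \<open>The leftmost entry larger than \<open>x\<close> is bumped.\<close>

lemma row_insert_Some:
  "row_insert x r = (r', Some y) \<Longrightarrow> \<exists>j<length r. y = r ! j \<and> r' = r[j := x] \<and> x < r ! j \<and> (\<forall>i<j. \<not> x < r ! i)"
proof (induction x r arbitrary: r' rule: row_insert.induct)
  case (2 x z zs)
  show ?case
  proof (cases "x < z")
    case True
    then show ?thesis using 2 by (intro exI[of _ 0]) auto
  next
    case False
    then obtain zs' where zs: "row_insert x zs = (zs', Some y)" "r' = z # zs'"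
      using 2 by (auto split: prod.splits)
    from "2.IH"[OF False zs(1)] obtain j where
      "j < length zs" "y = zs ! j" "zs' = zs[j := x]" "x < zs ! j" "\<forall>i<j. \<not> x < zs ! i" by blast
    then show ?thesis using False zs(2) by (intro exI[of _ "Suc j"]) (auto simp: All_less_Suc2)
  qed
qed simp

lemma sorted_nth_less:
  "sorted_wrt (<) (r :: nat list) \<Longrightarrow> i < j \<Longrightarrow> j < length r \<Longrightarrow> r ! i < r ! j"
  by (simp add: sorted_wrt_iff_nth_less)

lemma sorted_update:
  fixes r :: "nat list"
  assumes "sorted_wrt (<) r" "j < length r" "x < r ! j" "\<forall>i<j. r ! i < x"
  shows "sorted_wrt (<) (r[j := x])"
  unfolding sorted_wrt_iff_nth_less
proof (intro allI impI)
  fix a b assume ab: "a < b" "b < length (r[j := x])"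
  have "r ! a < r ! b" using sorted_nth_less[OF assms(1)] ab by simp
  moreover have "x < r ! b" if "a = j" using sorted_nth_less[OF assms(1), of j b] that ab assms(3) by simp
  ultimately show "r[j := x] ! a < r[j := x] ! b" using ab assms by (auto simp: nth_list_update)
qed

text \<open>The bumped entry moves weakly to the left in the next row, since the entry below the bumping
position is larger than it.\<close>

lemma above_insert:
  assumes rs: "above r s" "sorted_wrt (<) r" and j: "j < length r" "y = r ! j" "x < y"
    and ins: "row_insert y s = (s', b)"
  shows "above (r[j := x]) s'"
proof (cases b)
  case None
  with ins have s': "s' = s @ [y]" "\<forall>z\<in>set s. \<not> y < z" using row_insert_None by auto
  have "\<not> j < length s"
  proof
    assume "j < length s"
    then have "r ! j < s ! j" "s ! j \<in> set s" using rs(1) by (auto simp: above_def)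
    then show False using s'(2) j(2) by auto
  qed
  then have ls: "length s \<le> j" by simp
  have "r[j := x] ! i < s' ! i" if "i < length s'" for i
  proof (cases "i < length s")
    case True
    then show ?thesis using ls rs(1) j(1) by (auto simp: s' nth_append above_def)
  next
    case False
    then have "i = length s" using that s' by simp
    then show ?thesis using ls j sorted_nth_less[OF rs(2), of i j] by (cases "i = j") (auto simp: s' nth_append)
  qed
  then show ?thesis using ls j(1) by (simp add: above_def s')
next
  case (Some z)
  with ins row_insert_Some obtain k where k: "k < length s" "s' = s[k := y]" "y < s ! k" "\<forall>i<k. \<not> y < s ! i"
    by blast
  have kj: "k \<le> j"
  proof (rule ccontr)
    assume "\<not> k \<le> j"
    then have "\<not> y < s ! j" "j < length s" using k by auto
    then show False using rs(1) j by (auto simp: above_def)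
  qed
  have "r[j := x] ! i < s' ! i" if i: "i < length s" for i
  proof -
    have *: "r ! i < s ! i" using rs(1) i by (simp add: above_def)
    have "r ! k < y" if "k < j" using sorted_nth_less[OF rs(2) that j(1)] j(2) by simp
    then show ?thesis using * i k kj j by (cases "i = k"; cases "i = j") auto
  qed
  then show ?thesis using rs(1) k by (simp add: above_def)
qed

lemma add_mset_nth_update: "j < length r \<Longrightarrow> add_mset (r ! j) (mset (r[j := x])) = add_mset x (mset r)"
  by (simp add: mset_update)

lemma tab_insert_tableau:
  assumes "increasing_tableau T" "distinct (x # concat T)" "tab_insert x T = (T', i)"
  shows "increasing_tableau T' \<and> mset (concat T') = add_mset x (mset (concat T)) \<and> T' \<noteq> [] \<and> i \<le> length T \<and>
    hd T' = (case T of [] \<Rightarrow> [x] | r # _ \<Rightarrow> fst (row_insert x r))"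
  using assms
proof (induction x T arbitrary: T' i rule: tab_insert.induct)
  case (1 x)
  then show ?case by (auto simp: increasing_tableau_Cons)
next
  case (2 x r rs)
  have T: "r \<noteq> []" "sorted_wrt (<) r" "increasing_tableau rs" "rs \<noteq> [] \<Longrightarrow> above r (hd rs)"
    using "2.prems"(1) by (auto simp: increasing_tableau_Cons)
  obtain r' b where r': "row_insert x r = (r', b)" by fastforce
  show ?case
  proof (cases b)
    case None
    then have eq: "r' = r @ [x]" "\<forall>y\<in>set r. \<not> x < y" using row_insert_None r' by auto
    have T': "T' = r' # rs" "i = 0" using "2.prems"(3) r' None by auto
    have "y < x" if "y \<in> set r" for y
    proof -
      have "x \<noteq> y" using that "2.prems"(2) by auto
      with eq(2) that show ?thesis by (meson linorder_neqE_nat)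
    qed
    then have "sorted_wrt (<) r'" using T(2) eq by (simp add: sorted_wrt_append)
    moreover have "above r' (hd rs)" if "rs \<noteq> []" using T(4)[OF that] by (auto simp: above_def eq nth_append)
    ultimately show ?thesis using T r' by (auto simp: T' increasing_tableau_Cons eq)
  next
    case (Some y)
    obtain j where j: "j < length r" "y = r ! j" "r' = r[j := x]" "x < r ! j" "\<forall>i<j. \<not> x < r ! i"
      using row_insert_Some r' Some by blast
    obtain rs' k where rs': "tab_insert y rs = (rs', k)" by fastforce
    have T': "T' = r' # rs'" "i = Suc k" using "2.prems"(3) r' Some rs' by auto
    have ym: "y \<in> set r" using j by simp
    have "distinct (y # concat rs)" using "2.prems"(2) ym by auto
    from "2.IH"[OF r'[symmetric] Some T(3) this rs'] have IH:
      "increasing_tableau rs'" "mset (concat rs') = add_mset y (mset (concat rs))" "rs' \<noteq> []" "k \<le> length rs"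
      "hd rs' = (case rs of [] \<Rightarrow> [y] | r # _ \<Rightarrow> fst (row_insert y r))" by auto
    have lt: "\<forall>i<j. r ! i < x"
    proof (intro allI impI)
      fix i assume i: "i < j"
      have "r ! i \<in> set r" using i j(1) by simp
      then have "r ! i \<noteq> x" using "2.prems"(2) by auto
      then show "r ! i < x" using j(5) i by (meson linorder_neqE_nat)
    qed
    have s: "sorted_wrt (<) r'" unfolding j(3) by (rule sorted_update[OF T(2) j(1,4) lt])
    have "above r' (hd rs')"
    proof (cases rs)
      case Nil
      have "r' ! 0 < y" using j lt by (cases "j = 0") auto
      then show ?thesis using IH(5) Nil j by (auto simp: above_def)
    next
      case (Cons u us)
      obtain u' b' where u': "row_insert y u = (u', b')" by fastforce
      have "above r u" using T(4) Cons by simp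
      from above_insert[OF this T(2) j(1,2) _ u', of x] show ?thesis using IH(5) Cons u' j by simp
    qed
    moreover have "mset (concat T') = add_mset x (mset (concat (r # rs)))"
      using add_mset_nth_update[OF j(1), of x] IH(2) j by (simp add: T')
    moreover have "r' \<noteq> []" using j by auto
    ultimately show ?thesis using s IH r' by (simp add: T' increasing_tableau_Cons)
  qed
qed

text \<open>Reverse bumping: the position of the bump is the last place where the new row is smaller than the
bumped entry, so it can be recovered.\<close>

lemma row_insert_Some_inj:
  fixes t r :: "nat list"
  assumes "sorted_wrt (<) t" "sorted_wrt (<) r" "row_insert x t = (u, Some a)" "row_insert y r = (u, Some a)"
  shows "x = y \<and> t = r"
proof -
  obtain j where j: "j < length t" "a = t ! j" "u = t[j := x]" "x < t ! j" using row_insert_Some[OF assms(3)] by blast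
  obtain k where k: "k < length r" "a = r ! k" "u = r[k := y]" "y < r ! k" using row_insert_Some[OF assms(4)] by blast
  have len: "length t = length r" using j(3) k(3) by (metis length_list_update)
  have jk: "j = k"
  proof (rule ccontr)
    assume "j \<noteq> k"
    then consider "j < k" | "k < j" by linarith
    then show False
    proof cases
      case 1
      have "u ! k = t ! k" using j(3) 1 by simp
      moreover have "t ! k > a" using sorted_nth_less[OF assms(1) 1] k(1) len j(2) by simp
      moreover have "u ! k = y" using k(1,3) by simp
      ultimately show False using k(2,4) by simp
    next
      case 2
      have "u ! j = r ! j" using k(3) 2 by simp
      moreover have "r ! j > a" using sorted_nth_less[OF assms(2) 2] j(1) len k(2) by simp
      moreover have "u ! j = x" using j(1,3) by simp
      ultimately show False using j(2,4) by simp
    qed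
  qed
  have "x = y" using j k jk by (metis nth_list_update_eq)
  moreover have "t = u[j := a]" unfolding j(2,3) by simp
  moreover have "r = u[k := a]" unfolding k(2,3) by simp
  ultimately show ?thesis using jk by simp
qed

text \<open>The index of the row with the new cell decides where the reverse bumping starts.\<close>

lemma tab_insert_inj:
  assumes "increasing_tableau T" "increasing_tableau R" "tab_insert x T = (U, i)" "tab_insert y R = (U, i)"
  shows "x = y \<and> T = R"
  using assms
proof (induction x T arbitrary: y R U i rule: tab_insert.induct)
  case (1 x)
  then have U: "U = [[x]]" "i = 0" by auto
  show ?case
  proof (cases R)
    case Nil
    then show ?thesis using 1 U by auto
  next
    case (Cons r rs)
    obtain r' b where r': "row_insert y r = (r', b)" by fastforce
    have "r \<noteq> []" using 1 Cons by (simp add: increasing_tableau_Cons)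
    then show ?thesis using 1 U Cons r' row_insert_None[of y r r'] by (cases b) (auto split: prod.splits)
  qed
next
  case (2 x t ts)
  have T: "t \<noteq> []" "sorted_wrt (<) t" "increasing_tableau ts" using "2.prems"(1) by (auto simp: increasing_tableau_Cons)
  obtain t' b where t': "row_insert x t = (t', b)" by fastforce
  show ?case
  proof (cases R)
    case Nil
    then show ?thesis using "2.prems" T t' row_insert_None[of x t t'] by (cases b) (auto split: prod.splits)
  next
    case (Cons r rs)
    have R: "sorted_wrt (<) r" "increasing_tableau rs" using "2.prems"(2) Cons by (auto simp: increasing_tableau_Cons)
    obtain r' c where r': "row_insert y r = (r', c)" by fastforce
    show ?thesis
    proof (cases b)
      case None
      then have U: "U = t' # ts" "i = 0" using "2.prems"(3) t' by auto
      then have c: "c = None" using "2.prems"(4) Cons r' by (cases c) (auto split: prod.splits)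
      then have "U = r' # rs" using "2.prems"(4) Cons r' by auto
      then show ?thesis using U row_insert_None[of x t t'] row_insert_None[of y r r'] t' r' None c Cons by auto
    next
      case (Some a)
      obtain us k where us: "tab_insert a ts = (us, k)" by fastforce
      then have U: "U = t' # us" "i = Suc k" using "2.prems"(3) t' Some by auto
      then obtain a' where c: "c = Some a'" using "2.prems"(4) Cons r' by (cases c) auto
      obtain vs k' where vs: "tab_insert a' rs = (vs, k')" by fastforce
      then have U': "U = r' # vs" "i = Suc k'" using "2.prems"(4) Cons r' c by auto
      have "a = a' \<and> ts = rs"
        using "2.IH"[OF t'[symmetric] Some T(3) R(2) us, of a'] vs U U' by simp
      then show ?thesis using row_insert_Some_inj[OF T(2) R(1), of x t' a y] t' r' Some c U U' Cons by auto
    qed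
  qed
qed

lemma concat_update:
  "i < length Q \<Longrightarrow> mset (concat (Q[i := Q ! i @ [k]])) = add_mset k (mset (concat Q))"
  by (induction Q arbitrary: i) (auto split: nat.splits simp: nth_Cons')

lemma mset_add_cell: "mset (concat (add_cell k i Q)) = add_mset k (mset (concat Q))"
  using concat_update[of i Q k] by (simp add: add_cell_def)

lemma add_cell_tableau:
  assumes Q: "increasing_tableau Q" "\<And>x. x \<in> set (concat Q) \<Longrightarrow> x < k" "i \<le> length Q"
    and P: "shape (add_cell k i Q) = shape P" "increasing_tableau P"
  shows "increasing_tableau (add_cell k i Q)"
proof -
  let ?T = "add_cell k i Q"
  have len: "length P = length ?T" using P(1) by (metis length_map shape_def)
  have lrow: "length (?T ! a) = length (P ! a)" if "a < length ?T" for a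
    using P(1) that len by (metis nth_map shape_def)
  have mem: "Q ! a ! j < k" if "a < length Q" "j < length (Q ! a)" for a j
  proof (rule Q(2))
    show "Q ! a ! j \<in> set (concat Q)" unfolding set_concat using that by (intro UN_I[of "Q ! a"]) auto
  qed
  have row: "?T ! a = (if a = i then (if i < length Q then Q ! a else []) @ [k] else Q ! a)" if "a < length ?T" for a
    using that Q(3) by (auto simp: add_cell_def nth_append nth_list_update)
  have lt: "length ?T = max (length Q) (Suc i)" using Q(3) by (auto simp: add_cell_def)
  have old: "a < length Q" if "a < length ?T" "a \<noteq> i" for a using that lt Q(3) by auto
  show ?thesis
    unfolding increasing_tableau_def
  proof (intro conjI allI impI)
    fix a assume a: "a < length ?T"
    show "?T ! a \<noteq> []" unfolding row[OF a] using Q(1) old[OF a] by (auto simp: increasing_tableau_def)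
    have "sorted_wrt (<) (Q ! a @ [k])" if "a < length Q"
      using Q(1) that mem[OF that] by (auto simp: increasing_tableau_def sorted_wrt_append in_set_conv_nth)
    then show "sorted_wrt (<) (?T ! a)" unfolding row[OF a] using Q(1) old[OF a] by (auto simp: increasing_tableau_def)
  next
    fix a assume a: "Suc a < length ?T"
    have "above (P ! a) (P ! Suc a)" using P(2) a len by (simp add: increasing_tableau_def)
    then have l: "length (?T ! Suc a) \<le> length (?T ! a)" using lrow[OF a] lrow[of a] a by (simp add: above_def)
    have aQ: "a < length Q" using a lt Q(3) by auto
    have "?T ! a ! j < ?T ! Suc a ! j" if j: "j < length (?T ! Suc a)" for j
    proof (cases "Suc a < length Q \<and> j < length (Q ! Suc a)")
      case True
      then have ab: "above (Q ! a) (Q ! Suc a)" using Q(1) by (simp add: increasing_tableau_def)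
      then have "?T ! a ! j = Q ! a ! j" using True aQ a row[of a] by (auto simp: above_def nth_append)
      moreover have "?T ! Suc a ! j = Q ! Suc a ! j" using True a row[of "Suc a"] by (auto simp: nth_append)
      ultimately show ?thesis using ab True by (simp add: above_def)
    next
      case False
      have ai: "Suc a = i"
      proof (rule ccontr)
        assume "Suc a \<noteq> i"
        then show False using False old[OF a] row[OF a] j by auto
      qed
      then have "?T ! Suc a ! j = k" using False j row[OF a] by (auto simp: nth_append less_Suc_eq split: if_splits)
      moreover have "?T ! a = Q ! a" using row[of a] a ai by auto
      ultimately show ?thesis using mem[OF aQ, of j] j l by simp
    qed
    then show "above (?T ! a) (?T ! Suc a)" using l by (simp add: above_def)
  qed
qed

text \<open>The new entry \<open>k\<close> can be located; removing it gives back \<open>i\<close> and \<open>Q\<close>.\<close>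

lemma add_cell_inj:
  assumes Q: "increasing_tableau Q" "k \<notin> set (concat Q)" "i \<le> length Q"
    and R: "increasing_tableau R" "k \<notin> set (concat R)" "j \<le> length R"
    and eq: "add_cell k i Q = add_cell k j R"
  shows "i = j \<and> Q = R"
proof -
  have row: "add_cell k i Q ! a = (if a = i then (if i < length Q then Q ! a else []) @ [k] else Q ! a)"
    if "a < length (add_cell k i Q)" "i \<le> length Q" for a i Q
    using that by (auto simp: add_cell_def nth_append nth_list_update)
  have lt: "length (add_cell k i Q) = max (length Q) (Suc i)" if "i \<le> length Q" for i Q
    using that by (auto simp: add_cell_def)
  have kin: "k \<in> set (add_cell k i Q ! a) \<longleftrightarrow> a = i"
    if "a < length (add_cell k i Q)" "i \<le> length Q" "k \<notin> set (concat Q)" for a i Q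
  proof -
    have "a < length Q" if "a \<noteq> i" using that \<open>a < length (add_cell k i Q)\<close> lt[OF \<open>i \<le> length Q\<close>] \<open>i \<le> length Q\<close> by auto
    then have "k \<notin> set (Q ! a)" if "a \<noteq> i" using that \<open>k \<notin> set (concat Q)\<close> by auto
    then show ?thesis using row[OF that(1,2)] by auto
  qed
  have i: "i < length (add_cell k i Q)" using lt Q by simp
  then have "k \<in> set (add_cell k i Q ! i)" using kin[of i i Q] Q by simp
  then have ij: "i = j" using kin[of i j R] i R eq by simp
  have l: "length Q = length R"
  proof (rule ccontr)
    assume "length Q \<noteq> length R"
    moreover have "max (length Q) (Suc i) = max (length R) (Suc i)" using lt[of i Q] lt[of j R] Q R eq ij by simp
    ultimately consider "length Q = i" "length R = Suc i" | "length R = i" "length Q = Suc i"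
      using Q R ij by linarith
    then show False
    proof cases
      case 1
      then have "add_cell k i Q ! i = [k]" "add_cell k j R ! i = R ! i @ [k]" using row[of i i Q] row[of i j R] i eq Q R ij by auto
      then have "R ! i = []" using eq by simp
      then show False using R(1) 1 by (simp add: increasing_tableau_def)
    next
      case 2
      then have "add_cell k i Q ! i = Q ! i @ [k]" "add_cell k j R ! i = [k]" using row[of i i Q] row[of i j R] i eq Q R ij by auto
      then have "Q ! i = []" using eq by simp
      then show False using Q(1) 2 by (simp add: increasing_tableau_def)
    qed
  qed
  have "Q = R"
  proof (rule nth_equalityI[OF l])
    fix a assume a: "a < length Q"
    then have "a < length (add_cell k i Q)" using lt Q by simp
    then show "Q ! a = R ! a" using row[of a i Q] row[of a j R] eq ij l a Q R by (auto split: if_splits)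
  qed
  then show ?thesis using ij by simp
qed

lemma RS_tableaux:
  assumes "inj_on \<sigma> {1..k}"
  shows "increasing_tableau (fst (RS k \<sigma>)) \<and> mset (concat (fst (RS k \<sigma>))) = image_mset \<sigma> (mset [1..<Suc k]) \<and>
    increasing_tableau (snd (RS k \<sigma>)) \<and> mset (concat (snd (RS k \<sigma>))) = mset [1..<Suc k]"
  using assms
proof (induction k)
  case (Suc k)
  obtain P Q where PQ: "RS k \<sigma> = (P, Q)" by fastforce
  obtain P' i where P': "tab_insert (\<sigma> (Suc k)) P = (P', i)" by fastforce
  have "inj_on \<sigma> {1..k}" using Suc.prems by (rule inj_on_subset) auto
  from Suc.IH[OF this] have IH: "increasing_tableau P" "mset (concat P) = image_mset \<sigma> (mset [1..<Suc k])"
    "increasing_tableau Q" "mset (concat Q) = mset [1..<Suc k]" by (auto simp: PQ)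
  have "distinct (map \<sigma> [1..<Suc (Suc k)])"
    unfolding distinct_map using Suc.prems
    by (simp only: set_upt distinct_upt atLeastLessThanSuc_atLeastAtMost simp_thms)
  moreover have "mset (\<sigma> (Suc k) # concat P) = mset (map \<sigma> [1..<Suc (Suc k)])"
    using IH(2) by simp
  ultimately have "distinct (\<sigma> (Suc k) # concat P)" using mset_eq_imp_distinct_iff by blast
  from tab_insert_tableau[OF IH(1) this P'] have T: "increasing_tableau P'"
    "mset (concat P') = add_mset (\<sigma> (Suc k)) (mset (concat P))" "i \<le> length P" by auto
  have shPQ: "shape Q = shape P" using sh_eq_shape_recording[of k \<sigma>] PQ by (simp add: sh_def)
  then have "length Q = length P" by (metis length_map shape_def)
  moreover have "x < Suc k" if "x \<in> set (concat Q)" for x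
    using mset_eq_setD[OF IH(4)] that by (auto simp del: set_concat upt_Suc)
  ultimately have "increasing_tableau (add_cell (Suc k) i Q)"
    using add_cell_tableau[OF IH(3) _ _ shape_tab_insert[OF P' shPQ] T(1)] T(3) by simp
  then show ?case using T IH PQ P' by (simp add: mset_add_cell)
qed simp

text \<open>The recording tableau tells where the last cell was added, and then the last insertion can be undone.\<close>

lemma RS_inj:
  assumes "inj_on \<sigma> {1..k}" "inj_on \<tau> {1..k}" "RS k \<sigma> = RS k \<tau>" "m \<in> {1..k}"
  shows "\<sigma> m = \<tau> m"
  using assms
proof (induction k arbitrary: m)
  case (Suc k)
  have inj: "inj_on \<sigma> {1..k}" "inj_on \<tau> {1..k}"
    using Suc.prems(1,2) by (auto elim!: inj_on_subset)
  obtain P Q where PQ: "RS k \<sigma> = (P, Q)" by fastforce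
  obtain P' i where P': "tab_insert (\<sigma> (Suc k)) P = (P', i)" by fastforce
  obtain R S where RS: "RS k \<tau> = (R, S)" by fastforce
  obtain R' j where R': "tab_insert (\<tau> (Suc k)) R = (R', j)" by fastforce
  have eq: "P' = R'" "add_cell (Suc k) i Q = add_cell (Suc k) j S"
    using Suc.prems(3) PQ P' RS R' by auto
  note T1 = RS_tableaux[OF inj(1)] note T2 = RS_tableaux[OF inj(2)]
  have dist: "distinct (\<sigma> (Suc k) # concat P)" "i \<le> length Q" "Suc k \<notin> set (concat Q)"
    if "inj_on \<sigma> {1..Suc k}" "RS k \<sigma> = (P, Q)" "tab_insert (\<sigma> (Suc k)) P = (P', i)" for \<sigma> P Q P' i
  proof -
    have "inj_on \<sigma> {1..k}" using that(1) by (rule inj_on_subset) auto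
    note T = RS_tableaux[OF this, unfolded that(2) fst_conv snd_conv]
    have "distinct (map \<sigma> [1..<Suc (Suc k)])"
      unfolding distinct_map using that(1)
      by (simp only: set_upt distinct_upt atLeastLessThanSuc_atLeastAtMost simp_thms)
    moreover have "mset (\<sigma> (Suc k) # concat P) = mset (map \<sigma> [1..<Suc (Suc k)])"
      using T by simp
    ultimately show d: "distinct (\<sigma> (Suc k) # concat P)" using mset_eq_imp_distinct_iff by blast
    have "shape Q = shape P" using sh_eq_shape_recording[of k \<sigma>] that(2) by (simp add: sh_def)
    then have "length Q = length P" by (metis length_map shape_def)
    then show "i \<le> length Q" using tab_insert_tableau[OF _ d that(3)] T by simp
    have "mset (concat Q) = mset [1..<Suc k]" using T by blast
    from mset_eq_setD[OF this] show "Suc k \<notin> set (concat Q)" by (auto simp del: set_concat upt_Suc)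
  qed
  have ij: "i = j \<and> Q = S"
    by (rule add_cell_inj[of _ "Suc k"]) (use T1 T2 PQ RS eq dist[OF Suc.prems(1) PQ P'] dist[OF Suc.prems(2) RS R'] in auto)
  have "\<sigma> (Suc k) = \<tau> (Suc k) \<and> P = R"
    by (rule tab_insert_inj) (use T1 T2 PQ RS P' R' eq ij in auto)
  then show ?case using Suc.IH[OF inj] Suc.prems(4) PQ RS ij by (cases "m = Suc k") auto
qed simp

lemma increasing_tableau_SYT:
  assumes T: "increasing_tableau T" and m: "mset (concat T) = mset [1..<Suc n]"
  shows "T \<in> SYT (shape T)" "shape T \<in> partitions n"
proof -
  have "length (concat T) = n" using mset_eq_length[OF m] by (simp del: upt_Suc)
  then have sl: "sum_list (shape T) = n" by (simp add: shape_def length_concat)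
  have "column_strict T" using T by (auto simp: column_strict_def increasing_tableau_def above_def)
  moreover have "\<forall>r\<in>set T. sorted_wrt (<) r" using T by (auto simp: increasing_tableau_def in_set_conv_nth)
  ultimately show "T \<in> SYT (shape T)" using m sl by (simp add: SYT_def)
  have dec: "length (T ! j) \<le> length (T ! i)" if "i < j" "j < length T" for i j
    using that
  proof (induction j)
    case (Suc j)
    have "length (T ! Suc j) \<le> length (T ! j)" using T Suc.prems by (auto simp: increasing_tableau_def above_def)
    then show ?case using Suc by (cases "i = j") auto
  qed simp
  then have "sorted_wrt (\<ge>) (shape T)" by (auto simp: sorted_wrt_iff_nth_less shape_def)
  moreover have "0 \<notin> set (shape T)"
    using T by (auto simp: shape_def increasing_tableau_def in_set_conv_nth)
  ultimately show "shape T \<in> partitions n" using sl by (simp add: partitions_def)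
qed

lemma permutes_mset:
  assumes "\<sigma> permutes {1..n}"
  shows "image_mset \<sigma> (mset [1..<Suc n]) = mset [1..<Suc n]"
proof -
  have "mset [1..<Suc n] = mset_set {1..n}"
    by (metis atLeastLessThanSuc_atLeastAtMost mset_upt)
  moreover have "image_mset \<sigma> (mset_set {1..n}) = mset_set {1..n}"
    using image_mset_mset_set[OF permutes_inj_on[OF assms]] permutes_image[OF assms] by simp
  ultimately show ?thesis by (simp only:)
qed

text \<open>Only injectivity of the correspondence is used here.  Surjectivity will follow from counting.\<close>

theorem sh_count_le:
  shows "sh n \<in> \<SS> n \<rightarrow> partitions n"
    and "card {\<sigma>\<in>\<SS> n. sh n \<sigma> = lam} \<le> (card (SYT lam))\<^sup>2"
proof -
  have inj: "inj_on \<sigma> {1..n}" if "\<sigma> \<in> \<SS> n" for \<sigma> using that by (auto simp: \<SS>_def permutes_inj_on)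
  have P: "fst (RS n \<sigma>) \<in> SYT (sh n \<sigma>)" "sh n \<sigma> \<in> partitions n" "snd (RS n \<sigma>) \<in> SYT (sh n \<sigma>)"
    if s: "\<sigma> \<in> \<SS> n" for \<sigma>
  proof -
    note T = RS_tableaux[OF inj[OF s]]
    have m: "mset (concat (fst (RS n \<sigma>))) = mset [1..<Suc n]"
      using T permutes_mset[of \<sigma> n] s by (simp add: \<SS>_def del: upt_Suc)
    show "fst (RS n \<sigma>) \<in> SYT (sh n \<sigma>)" "sh n \<sigma> \<in> partitions n"
      using increasing_tableau_SYT[OF _ m] T by (auto simp: sh_def)
    show "snd (RS n \<sigma>) \<in> SYT (sh n \<sigma>)"
      using increasing_tableau_SYT(1)[of "snd (RS n \<sigma>)" n] T by (simp add: sh_eq_shape_recording)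
  qed
  show "sh n \<in> \<SS> n \<rightarrow> partitions n" using P by blast
  have "inj_on (RS n) {\<sigma>\<in>\<SS> n. sh n \<sigma> = lam}"
  proof (rule inj_onI)
    fix \<sigma> \<tau> assume s: "\<sigma> \<in> {\<sigma>\<in>\<SS> n. sh n \<sigma> = lam}" and t: "\<tau> \<in> {\<sigma>\<in>\<SS> n. sh n \<sigma> = lam}" and eq: "RS n \<sigma> = RS n \<tau>"
    show "\<sigma> = \<tau>"
    proof
      fix m show "\<sigma> m = \<tau> m"
      proof (cases "m \<in> {1..n}")
        case True
        then show ?thesis using RS_inj[OF inj inj eq] s t by blast
      next
        case False
        then show ?thesis using s t by (auto simp: \<SS>_def permutes_not_in)
      qed
    qed
  qed
  moreover have "RS n ` {\<sigma>\<in>\<SS> n. sh n \<sigma> = lam} \<subseteq> SYT lam \<times> SYT lam"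
  proof
    fix z assume "z \<in> RS n ` {\<sigma>\<in>\<SS> n. sh n \<sigma> = lam}"
    then obtain \<sigma> where s: "\<sigma> \<in> \<SS> n" "sh n \<sigma> = lam" "z = RS n \<sigma>" by blast
    show "z \<in> SYT lam \<times> SYT lam" using P(1)[OF s(1)] P(3)[OF s(1)] s by (simp add: mem_Times_iff)
  qed
  ultimately have "card {\<sigma>\<in>\<SS> n. sh n \<sigma> = lam} \<le> card (SYT lam \<times> SYT lam)"
    by (rule card_inj_on_le) (simp add: finite_SYT)
  then show "card {\<sigma>\<in>\<SS> n. sh n \<sigma> = lam} \<le> (card (SYT lam))\<^sup>2"
    by (simp add: card_cartesian_product power2_eq_square)
qed

section \<open>Permutations fixed by a power of the rotation\<close>

lemma long_cycle_permutes: "long_cycle n permutes {1..n}"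
  unfolding long_cycle_def using cycle_permutes[of "[1..<Suc n]"]
  by (simp only: set_upt atLeastLessThanSuc_atLeastAtMost)

lemma long_cycle_power:
  assumes "i < n"
  shows "(long_cycle n ^^ k) (Suc i) = Suc ((k + i) mod n)"
proof -
  have "map (long_cycle n ^^ k) [1..<Suc n] = rotate k [1..<Suc n]"
    unfolding long_cycle_def by (rule cyclic_rotation) (simp del: upt_Suc)
  then have "map (long_cycle n ^^ k) [1..<Suc n] ! i = rotate k [1..<Suc n] ! i" by simp
  moreover have "(k + i) mod n < n" using assms by simp
  ultimately show ?thesis using assms by (simp add: nth_rotate del: upt_Suc)
qed

lemma rot_in: "\<sigma> \<in> \<SS> n \<Longrightarrow> rot n \<sigma> \<in> \<SS> n"
  unfolding \<SS>_def rot_def using long_cycle_permutes[of n]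
  by (auto intro!: permutes_compose permutes_inv)

lemma rot_power: "(rot n ^^ k) \<sigma> = (long_cycle n ^^ k) \<circ> \<sigma> \<circ> inv_into UNIV (long_cycle n ^^ k)"
proof (induction k)
  case (Suc k)
  have b: "bij (long_cycle n)" "bij (long_cycle n ^^ k)"
    using long_cycle_permutes[of n] by (auto intro: permutes_bij permutes_funpow)
  have "inv_into UNIV (long_cycle n ^^ Suc k) = inv_into UNIV (long_cycle n ^^ k) \<circ> inv_into UNIV (long_cycle n)"
    by (simp add: o_inv_distrib b)
  note i = this
  have "(rot n ^^ Suc k) \<sigma> = rot n ((rot n ^^ k) \<sigma>)" by simp
  also have "\<dots> = (long_cycle n ^^ Suc k) \<circ> \<sigma> \<circ> inv_into UNIV (long_cycle n ^^ Suc k)"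
    unfolding Suc i rot_def by (simp only: funpow.simps o_assoc)
  finally show ?case .
qed simp

text \<open>The fixed points of a power of a conjugation are the elements of a centralizer.\<close>

lemma rot_fixed_iff: "(rot n ^^ k) \<sigma> = \<sigma> \<longleftrightarrow> (\<forall>i. (long_cycle n ^^ k) (\<sigma> i) = \<sigma> ((long_cycle n ^^ k) i))"
proof -
  have b: "bij (long_cycle n ^^ k)"
    using long_cycle_permutes[of n] by (auto intro: permutes_bij permutes_funpow)
  let ?c = "long_cycle n ^^ k"
  have "(rot n ^^ k) \<sigma> = \<sigma> \<longleftrightarrow> (\<forall>j. ?c (\<sigma> (inv_into UNIV ?c j)) = \<sigma> j)"
    unfolding rot_power by (simp add: fun_eq_iff)
  also have "\<dots> \<longleftrightarrow> (\<forall>i. ?c (\<sigma> i) = \<sigma> (?c i))"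
    using b by (metis bij_inv_eq_iff)
  finally show ?thesis .
qed

lemma rot_order:
  assumes "\<sigma> \<in> \<SS> n"
  shows "(rot n ^^ n) \<sigma> = \<sigma>"
proof -
  have c: "(long_cycle n ^^ n) j = j" for j
  proof (cases "j \<in> {1..n}")
    case True
    then obtain i where "j = Suc i" "i < n" by (cases j) auto
    then show ?thesis by (simp add: long_cycle_power)
  next
    case False
    then show ?thesis using permutes_not_in[OF permutes_funpow[OF long_cycle_permutes]] by blast
  qed
  show ?thesis unfolding rot_fixed_iff by (simp add: c)
qed

lemma finite_SS: "finite (\<SS> n)"
  unfolding \<SS>_def by (simp add: finite_permutations)

text \<open>A permutation commuting with the \<open>g\<close>-th power of the long cycle is determined by its values on one
representative of every cycle, that is on \<open>1, \<dots>, g\<close>.\<close>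

lemma commuting_values:
  assumes "\<sigma> \<in> \<SS> n" "(rot n ^^ g) \<sigma> = \<sigma>" "n = g * r" "i < n" "g > 0"
  shows "\<sigma> (Suc i) = Suc ((g * (i div g) + (\<sigma> (Suc (i mod g)) - 1)) mod n)"
proof -
  have fix1: "(rot n ^^ (g * t)) \<sigma> = \<sigma>" for t
  proof (induction t)
    case (Suc t)
    then show ?case using assms(2) by (simp add: funpow_add)
  qed simp
  have im: "i mod g < n" using assms(4) by (meson le_less_trans mod_less_eq_dividend)
  have "Suc (i mod g) \<in> {1..n}" using im by simp
  then have "\<sigma> (Suc (i mod g)) \<in> {1..n}" using assms(1) by (simp only: \<SS>_def mem_Collect_eq permutes_in_image)
  then obtain s where s: "\<sigma> (Suc (i mod g)) = Suc s" "s < n" by (cases "\<sigma> (Suc (i mod g))") auto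
  let ?c = "long_cycle n ^^ (g * (i div g))"
  have "?c (Suc (i mod g)) = Suc i" using long_cycle_power[OF im, of "g * (i div g)"] assms(4) by simp
  then have "\<sigma> (Suc i) = ?c (\<sigma> (Suc (i mod g)))" using fix1[of "i div g"] unfolding rot_fixed_iff by metis
  also have "\<dots> = Suc ((g * (i div g) + s) mod n)" unfolding s(1) by (rule long_cycle_power[OF s(2)])
  finally show ?thesis using s by simp
qed

lemma add_mod_cancel:
  fixes x y :: nat
  assumes "x < r" "y < r" "(b + x) mod r = (b + y) mod r"
  shows "x = y"
proof -
  have "x = y" if "x \<le> y" "y < r" "(b + x) mod r = (b + y) mod r" for x y :: nat
  proof -
    have "r dvd (b + y) - (b + x)" using that mod_eq_dvd_iff_nat[of "b + x" "b + y" r] by simp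
    then have "r dvd y - x" by simp
    then show ?thesis using that by (auto dest!: dvd_imp_le)
  qed
  then show ?thesis using assms by (metis nat_le_linear)
qed

text \<open>The \<open>g\<close>-th power of the long cycle consists of \<open>g\<close> cycles of length \<open>r\<close>; its centralizer is the wreath
product of a cyclic group of order \<open>r\<close> with the symmetric group on the \<open>g\<close> cycles.  An element is a pair
of a permutation \<open>a\<close> of the cycles and a family \<open>b\<close> of rotations of the cycles.\<close>

theorem card_rot_fixed:
  assumes "n = g * r" "n \<ge> 1"
  shows "card {\<sigma> \<in> \<SS> n. (rot n ^^ g) \<sigma> = \<sigma>} = fact g * r ^ g"
proof -
  have g: "g > 0" and r: "r > 0" using assms by (auto intro: gr0I)
  let ?X = "{\<sigma> \<in> \<SS> n. (rot n ^^ g) \<sigma> = \<sigma>}"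
  let ?Y = "{a. a permutes {..<g}} \<times> ({..<g} \<rightarrow>\<^sub>E {..<r})"
  \<comment> \<open>With positions \<open>0, \<dots>, n - 1\<close>, the residue \<open>i mod g\<close> names the cycle and \<open>i div g\<close> the place on it.\<close>
  define F where "F = (\<lambda>(a, b) i. a (i mod g) + g * ((b (i mod g) + i div g) mod r) :: nat)"
  define join_pair where "join_pair = (\<lambda>ab j. if j \<in> {1..n} then Suc (F ab (j - 1)) else j)"
  define split_perm where "split_perm = (\<lambda>\<sigma>. (\<lambda>i. if i < g then (\<sigma> (Suc i) - 1) mod g else i,
     \<lambda>i\<in>{..<g}. (\<sigma> (Suc i) - 1) div g))"
  have divlt: "i div g < r" if "i < n" for i
    using that assms(1) by (simp add: less_mult_imp_div_less mult.commute)
  have Fmod: "F (a, b) i mod g = a (i mod g)" and Fdiv: "F (a, b) i div g = (b (i mod g) + i div g) mod r"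
    and Flt: "F (a, b) i < n" if "(a, b) \<in> ?Y" for a b i
  proof -
    have a: "a (i mod g) < g" using that g permutes_in_image[of a "{..<g}" "i mod g"] by auto
    then show "F (a, b) i mod g = a (i mod g)" "F (a, b) i div g = (b (i mod g) + i div g) mod r"
      by (simp_all add: F_def)
    have "(b (i mod g) + i div g) mod r \<le> r - 1" using r by (simp add: less_Suc_eq_le[symmetric])
    then have "g * ((b (i mod g) + i div g) mod r) \<le> g * (r - 1)" by simp
    moreover have "g * (r - 1) + g = n" using r assms(1) by (cases r) auto
    ultimately show "F (a, b) i < n" using a unfolding F_def split_conv by linarith
  qed
  have Finj: "i = j" if ab: "(a, b) \<in> ?Y" and "i < n" "j < n" "F (a, b) i = F (a, b) j" for a b i j
  proof -
    have "a (i mod g) = a (j mod g)" using Fmod[OF ab, of i] Fmod[OF ab, of j] that by simp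
    then have m: "i mod g = j mod g" using ab permutes_inj[of a "{..<g}"] by (auto dest: injD)
    have "F (a, b) i div g = F (a, b) j div g" using that(4) by (rule arg_cong)
    then have "(b (i mod g) + i div g) mod r = (b (i mod g) + j div g) mod r"
      unfolding Fdiv[OF ab] m .
    from add_mod_cancel[OF divlt[OF that(2)] divlt[OF that(3)] this] have d: "i div g = j div g" .
    have "i = i div g * g + i mod g" by (simp only: div_mult_mod_eq)
    also have "\<dots> = j div g * g + j mod g" by (simp only: d m)
    finally show ?thesis by (simp only: div_mult_mod_eq)
  qed
  have backX: "join_pair ab \<in> ?X" if ab: "ab \<in> ?Y" for ab
  proof -
    obtain a b where abp: "ab = (a, b)" by (cases ab)
    note ab' = ab[unfolded abp]
    have "join_pair ab permutes {1..n}"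
    proof (rule bij_imp_permutes)
      have inj: "inj_on (join_pair ab) {1..n}"
      proof (rule inj_onI)
        fix i j assume ij: "i \<in> {1..n}" "j \<in> {1..n}" "join_pair ab i = join_pair ab j"
        then have "F (a, b) (i - 1) = F (a, b) (j - 1)" by (simp add: join_pair_def abp)
        with Finj[OF ab', of "i - 1" "j - 1"] ij have "i - 1 = j - 1" by auto
        then show "i = j" using ij by auto
      qed
      moreover have "join_pair ab ` {1..n} \<subseteq> {1..n}" using Flt[OF ab'] by (auto simp: join_pair_def abp Suc_le_eq)
      ultimately show "bij_betw (join_pair ab) {1..n} {1..n}"
        by (simp add: bij_betw_def endo_inj_surj)
    qed (auto simp: join_pair_def)
    moreover have "(rot n ^^ g) (join_pair ab) = join_pair ab"
      unfolding rot_fixed_iff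
    proof
      fix j
      show "(long_cycle n ^^ g) (join_pair ab j) = join_pair ab ((long_cycle n ^^ g) j)"
      proof (cases "j \<in> {1..n}")
        case True
        then obtain i where i: "j = Suc i" "i < n" by (cases j) auto
        let ?i = "(g + i) mod n"
        have "?i < n" using i by simp
        have e1: "?i mod g = i mod g" using assms(1) by (simp add: mod_mult2_eq)
        have e2: "?i div g = Suc (i div g) mod r" using assms(1) g by (simp add: mod_mult2_eq)
        have "(long_cycle n ^^ g) (join_pair ab j) = Suc ((g + F (a, b) i) mod n)"
          using long_cycle_power[OF Flt[OF ab']] i by (simp add: join_pair_def abp)
        moreover have "join_pair ab ((long_cycle n ^^ g) j) = Suc (F (a, b) ?i)"
          using long_cycle_power[OF i(2)] i \<open>?i < n\<close> by (simp add: join_pair_def abp Suc_le_eq)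
        moreover have "(g + F (a, b) i) mod n = F (a, b) ?i"
        proof -
          have "(g + F (a, b) i) mod n = g * ((g + F (a, b) i) div g mod r) + (g + F (a, b) i) mod g"
            unfolding assms(1) by (rule mod_mult2_eq)
          also have "(g + F (a, b) i) div g = Suc ((b (i mod g) + i div g) mod r)"
            using Fdiv[OF ab', of i] g by simp
          also have "(g + F (a, b) i) mod g = a (i mod g)" using Fmod[OF ab', of i] by simp
          finally show ?thesis by (simp add: F_def e1 e2 mod_Suc_eq mod_add_right_eq)
        qed
        ultimately show ?thesis by simp
      next
        case False
        then have "(long_cycle n ^^ g) j = j"
          using permutes_not_in[OF permutes_funpow[OF long_cycle_permutes]] by blast
        then show ?thesis using False by (auto simp: join_pair_def)
      qed
    qed
    ultimately show ?thesis by (simp add: \<SS>_def)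
  qed
  have vals: "\<sigma> (Suc i) \<in> {1..n}" if "\<sigma> \<in> ?X" "i < n" for \<sigma> i
    using that permutes_in_image[of \<sigma> "{1..n}" "Suc i"] by (simp add: \<SS>_def)
  have gn: "i < n" if "i < g" for i using that r assms(1) by (cases r) auto
  have bf: "join_pair (split_perm \<sigma>) = \<sigma>" if s: "\<sigma> \<in> ?X" for \<sigma>
  proof
    fix j
    show "join_pair (split_perm \<sigma>) j = \<sigma> j"
    proof (cases "j \<in> {1..n}")
      case True
      then obtain i where i: "j = Suc i" "i < n" by (cases j) auto
      let ?s = "\<sigma> (Suc (i mod g)) - 1"
      have ig: "i mod g < g" using g by simp
      have "\<sigma> j = Suc ((g * (i div g) + ?s) mod n)"
        using commuting_values[of \<sigma> n g r i] s i assms(1) g by simp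
      also have "(g * (i div g) + ?s) mod n = g * ((g * (i div g) + ?s) div g mod r) + (g * (i div g) + ?s) mod g"
        unfolding assms(1) by (rule mod_mult2_eq)
      also have "\<dots> = F (split_perm \<sigma>) i" using g ig by (simp add: F_def split_perm_def add.commute)
      finally show ?thesis using i by (simp add: join_pair_def)
    next
      case False
      then show ?thesis using s by (auto simp: join_pair_def \<SS>_def permutes_not_in)
    qed
  qed
  have forthY: "split_perm \<sigma> \<in> ?Y" if s: "\<sigma> \<in> ?X" for \<sigma>
  proof -
    have p: "\<sigma> permutes {1..n}" using s by (simp add: \<SS>_def)
    have "bij_betw (\<lambda>i. (\<sigma> (Suc i) - 1) mod g) {..<g} {..<g}"
    proof -
      have inj: "inj_on (\<lambda>i. (\<sigma> (Suc i) - 1) mod g) {..<g}"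
      proof (rule inj_onI)
        fix u v assume uv: "u \<in> {..<g}" "v \<in> {..<g}" "(\<sigma> (Suc u) - 1) mod g = (\<sigma> (Suc v) - 1) mod g"
        let ?a = "\<sigma> (Suc u) - 1" let ?b = "\<sigma> (Suc v) - 1"
        have lt: "?a < n" "?b < n" using vals[OF s] gn uv by (force simp: less_eq_Suc_le)+
        have dl: "?a div g < r" "?b div g < r" using divlt lt by auto
        \<comment> \<open>If \<open>u\<close> and \<open>v\<close> were sent to the same cycle, then moving \<open>u\<close> along its cycle by \<open>t\<close> would give a
          position with the same value as \<open>v\<close>.\<close>
        define t where "t = (?b div g + (r - ?a div g)) mod r"
        define i where "i = u + g * t"
        have tr: "t < r" using r by (simp add: t_def)
        have "t \<le> r - 1" using tr by linarith
        then have "g * t \<le> g * (r - 1)" by (rule mult_le_mono2)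
        moreover have "g * (r - 1) + g = n" using r assms(1) by (cases r) auto
        moreover have "u < g" using uv by simp
        ultimately have "i < n" unfolding i_def by linarith
        then have i: "i < n" "i mod g = u" "i div g = t" using \<open>u < g\<close> by (auto simp: i_def)
        have "\<sigma> (Suc i) = Suc ((g * t + ?a) mod n)"
          using commuting_values[of \<sigma> n g r i] s i assms(1) g by simp
        also have "(g * t + ?a) mod n = g * ((g * t + ?a) div g mod r) + (g * t + ?a) mod g"
          unfolding assms(1) by (rule mod_mult2_eq)
        also have "(g * t + ?a) div g mod r = (?a div g + (?b div g + (r - ?a div g))) mod r"
          using g by (simp add: t_def mod_add_right_eq add.commute)
        also have "?a div g + (?b div g + (r - ?a div g)) = ?b div g + r" using dl by simp
        also have "(?b div g + r) mod r = ?b div g" using dl by simp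
        also have "(g * t + ?a) mod g = ?b mod g" using uv by simp
        also have "g * (?b div g) + ?b mod g = ?b" by simp
        also have "Suc ?b = \<sigma> (Suc v)" using vals[OF s gn, of v] uv by auto
        finally have "Suc i = Suc v" using permutes_inj[OF p] by (auto dest: injD)
        then show "u = v" using i uv by auto
      qed
      moreover have "(\<lambda>i. (\<sigma> (Suc i) - 1) mod g) ` {..<g} \<subseteq> {..<g}" using g by auto
      ultimately show ?thesis by (simp add: bij_betw_def endo_inj_surj)
    qed
    then have "bij_betw (fst (split_perm \<sigma>)) {..<g} {..<g}"
      by (rule bij_betw_cong[THEN iffD1, rotated]) (simp add: split_perm_def)
    then have "fst (split_perm \<sigma>) permutes {..<g}" by (rule bij_imp_permutes) (simp add: split_perm_def)
    moreover have "snd (split_perm \<sigma>) \<in> {..<g} \<rightarrow>\<^sub>E {..<r}"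
    proof -
      have "(\<sigma> (Suc i) - 1) div g < r" if "i < g" for i
        using vals[OF s gn[OF that]] by (intro divlt) auto
      then show ?thesis by (auto simp: split_perm_def)
    qed
    ultimately show ?thesis by (simp add: mem_Times_iff)
  qed
  have fb: "split_perm (join_pair ab) = ab" if ab: "ab \<in> ?Y" for ab
  proof -
    obtain a b where abp: "ab = (a, b)" by (cases ab)
    note ab' = ab[unfolded abp]
    have bv: "join_pair ab (Suc i) - 1 = F (a, b) i" if "i < g" for i
      using gn[OF that] by (simp add: join_pair_def abp)
    have b: "b i < r" if "i < g" for i using ab' that by auto
    have "fst (split_perm (join_pair ab)) i = a i" for i
    proof -
      have "fst (split_perm (join_pair ab)) i = (if i < g then (join_pair ab (Suc i) - 1) mod g else i)"
        by (simp add: split_perm_def)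
      also have "\<dots> = (if i < g then a (i mod g) else i)" by (simp only: bv Fmod[OF ab'] cong: if_cong)
      also have "\<dots> = a i"
      proof (cases "i < g")
        case False
        have "a permutes {..<g}" using ab' by simp
        from permutes_not_in[OF this, of i] False show ?thesis by simp
      qed simp
      finally show ?thesis .
    qed
    moreover have "snd (split_perm (join_pair ab)) i = b i" for i
    proof -
      have "snd (split_perm (join_pair ab)) i = (if i < g then (join_pair ab (Suc i) - 1) div g else undefined)"
        by (simp add: split_perm_def)
      also have "\<dots> = (if i < g then (b (i mod g) + i div g) mod r else undefined)" by (simp only: bv Fdiv[OF ab'] cong: if_cong)
      also have "\<dots> = b i"
      proof (cases "i < g")
        case True
        then show ?thesis using b[OF True] by simp
      next
        case False
        have "b \<in> {..<g} \<rightarrow>\<^sub>E {..<r}" using ab' by simp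
        from PiE_arb[OF this, of i] False show ?thesis by simp
      qed
      finally show ?thesis .
    qed
    ultimately show ?thesis unfolding abp by (simp add: prod_eq_iff fun_eq_iff)
  qed
  have "bij_betw split_perm ?X ?Y"
    by (rule bij_betw_byWitness[where f' = join_pair]) (use bf fb forthY backX in blast)+
  then have "card ?X = card ?Y" by (rule bij_betw_same_card)
  also have "\<dots> = fact g * r ^ g"
    by (simp add: card_cartesian_product card_permutations card_PiE)
  finally show ?thesis .
qed

section \<open>Invariant statistics of a cyclic action\<close>

text \<open>The set is cut into pieces of the prescribed sizes one after the other.\<close>

lemma fibres_of_given_size_exist:
  assumes "finite \<Lambda>" "finite A" "(\<Sum>x\<in>\<Lambda>. c x) = card A"
  shows "\<exists>h. h \<in> A \<rightarrow> \<Lambda> \<and> (\<forall>x\<in>\<Lambda>. card {a\<in>A. h a = x} = c x)"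
  using assms
proof (induction \<Lambda> arbitrary: A rule: finite_induct)
  case empty
  then show ?case by auto
next
  case (insert x \<Lambda>)
  have "c x \<le> card A" using insert by simp
  then obtain B where B: "B \<subseteq> A" "card B = c x" "finite B" by (rule obtain_subset_with_card_n)
  have "card (A - B) = sum c \<Lambda>" using B insert by (simp add: card_Diff_subset)
  then obtain h where h: "h \<in> (A - B) \<rightarrow> \<Lambda>" "\<forall>y\<in>\<Lambda>. card {a\<in>A - B. h a = y} = c y"
    using insert.IH[of "A - B"] insert.prems by auto
  define h' where "h' a = (if a \<in> B then x else h a)" for a
  have "{a\<in>A. h' a = x} = B" using B h insert.hyps by (auto simp: h'_def)
  moreover have "{a\<in>A. h' a = y} = {a\<in>A - B. h a = y}" if "y \<in> \<Lambda>" for y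
    using that insert.hyps B by (auto simp: h'_def)
  moreover have "h' a \<in> insert x \<Lambda>" if "a \<in> A" for a
    using h(1) that by (cases "a \<in> B") (auto simp: h'_def Pi_iff)
  ultimately show ?case using h(2) B by (intro exI[of _ h']) auto
qed

definition orb :: "('a \<Rightarrow> 'a) \<Rightarrow> 'a \<Rightarrow> 'a set" where
  "orb \<rho> x = range (\<lambda>i. (\<rho> ^^ i) x)"

context
  fixes \<rho> :: "'a \<Rightarrow> 'a" and X :: "'a set" and n :: nat
  assumes fin: "finite X" and maps: "\<And>x. x \<in> X \<Longrightarrow> \<rho> x \<in> X"
    and ord: "\<And>x. x \<in> X \<Longrightarrow> (\<rho> ^^ n) x = x" and n: "n \<ge> 1"
begin

lemma funpow_maps: "x \<in> X \<Longrightarrow> (\<rho> ^^ i) x \<in> X"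
  by (induction i) (auto simp: maps)

lemma funpow_mult_fixed: "(\<rho> ^^ p) x = x \<Longrightarrow> (\<rho> ^^ (p * k)) x = x"
  by (induction k) (simp_all add: funpow_add)

lemma orb_least_power:
  assumes x: "x \<in> X"
  shows "orb \<rho> x = (\<lambda>i. (\<rho> ^^ i) x) ` {..<least_power \<rho> x}" "card (orb \<rho> x) = least_power \<rho> x"
proof -
  let ?p = "least_power \<rho> x"
  have p: "(\<rho> ^^ ?p) x = x" "?p > 0" using least_powerI[OF ord[OF x]] n by auto
  show eq: "orb \<rho> x = (\<lambda>i. (\<rho> ^^ i) x) ` {..<?p}"
  proof (intro equalityI subsetI)
    fix y assume "y \<in> orb \<rho> x"
    then obtain i where i: "y = (\<rho> ^^ i) x" by (auto simp: orb_def)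
    have "(\<rho> ^^ (i mod ?p + ?p * (i div ?p))) x = (\<rho> ^^ (i mod ?p)) x"
      by (simp only: funpow_add o_apply funpow_mult_fixed[OF p(1)])
    then have "y = (\<rho> ^^ (i mod ?p)) x" using i by simp
    then show "y \<in> (\<lambda>i. (\<rho> ^^ i) x) ` {..<?p}" using p(2) by auto
  qed (auto simp: orb_def)
  have "inj_on (\<lambda>i. (\<rho> ^^ i) x) {..<?p}"
  proof (rule linorder_inj_onI')
    fix i j assume ij: "i \<in> {..<?p}" "j \<in> {..<?p}" "i < j"
    show "(\<rho> ^^ i) x \<noteq> (\<rho> ^^ j) x"
    proof
      assume e: "(\<rho> ^^ i) x = (\<rho> ^^ j) x"
      have "(\<rho> ^^ (?p - j + i)) x = (\<rho> ^^ (?p - j + j)) x" by (simp only: funpow_add o_apply e)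
      then have "(\<rho> ^^ (?p - j + i)) x = x" using ij p by simp
      moreover have "?p - j + i > 0" "?p - j + i < ?p" using ij by auto
      ultimately show False using least_power_le[of "?p - j + i" \<rho> x] by simp
    qed
  qed
  then show "card (orb \<rho> x) = ?p" unfolding eq by (simp add: card_image)
qed

lemma fixed_iff_card_orb_dvd:
  assumes x: "x \<in> X"
  shows "(\<rho> ^^ d) x = x \<longleftrightarrow> card (orb \<rho> x) dvd d"
proof -
  have p: "(\<rho> ^^ least_power \<rho> x) x = x" using least_powerI[OF ord[OF x]] n by auto
  show ?thesis unfolding orb_least_power(2)[OF x]
    using least_power_minimal[of d \<rho> x] funpow_mult_fixed[OF p] by (auto elim!: dvdE)
qed

lemma orb_subset: "x \<in> X \<Longrightarrow> orb \<rho> x \<subseteq> X"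
  by (auto simp: orb_def funpow_maps)

lemma orb_eq:
  assumes x: "x \<in> X" and y: "y \<in> orb \<rho> x"
  shows "orb \<rho> y = orb \<rho> x"
proof -
  obtain i where i: "y = (\<rho> ^^ i) x" using y by (auto simp: orb_def)
  \<comment> \<open>Modulo \<open>n\<close> the exponent \<open>n * i - i\<close> is \<open>- i\<close>.\<close>
  have "(\<rho> ^^ j) x = (\<rho> ^^ (j + n * i - i)) y" for j
  proof -
    have "i \<le> n * i" using n by simp
    then have "i \<le> j + n * i" by (rule trans_le_add2)
    then have e: "j + n * i - i + i = j + n * i" by (rule le_add_diff_inverse2)
    have "(\<rho> ^^ (j + n * i - i)) y = (\<rho> ^^ (j + n * i - i + i)) x"
      unfolding i by (simp only: funpow_add o_apply)
    also have "\<dots> = (\<rho> ^^ (j + n * i)) x" by (simp only: e)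
    also have "\<dots> = (\<rho> ^^ j) x" by (simp only: funpow_add o_apply funpow_mult_fixed[OF ord[OF x]])
    finally show ?thesis by simp
  qed
  then have "orb \<rho> x \<subseteq> orb \<rho> y" by (auto simp: orb_def)
  moreover have "orb \<rho> y \<subseteq> orb \<rho> x"
  proof
    fix z assume "z \<in> orb \<rho> y"
    then obtain j where "z = (\<rho> ^^ j) ((\<rho> ^^ i) x)" by (auto simp: orb_def i)
    then have "z = (\<rho> ^^ (j + i)) x" by (simp add: funpow_add)
    then show "z \<in> orb \<rho> x" by (auto simp: orb_def)
  qed
  ultimately show ?thesis by blast
qed

lemma self_in_orb: "x \<in> orb \<rho> x"
  unfolding orb_def by (rule range_eqI[of _ _ 0]) simp

lemma card_by_orbits:
  "card {x\<in>X. P (orb \<rho> x)} = (\<Sum>C\<in>{C\<in>orb \<rho> ` X. P C}. card C)"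
proof -
  have "{x\<in>X. P (orb \<rho> x)} = \<Union>{C\<in>orb \<rho> ` X. P C}"
  proof (intro equalityI subsetI)
    fix x assume "x \<in> \<Union>{C\<in>orb \<rho> ` X. P C}"
    then obtain y where y: "y \<in> X" "P (orb \<rho> y)" "x \<in> orb \<rho> y" by auto
    then show "x \<in> {x\<in>X. P (orb \<rho> x)}" using orb_eq[OF y(1,3)] orb_subset[OF y(1)] by auto
  qed (use self_in_orb in auto)
  also have "card \<dots> = (\<Sum>C\<in>{C\<in>orb \<rho> ` X. P C}. card C)"
  proof (rule card_Union_disjoint)
    show "pairwise disjnt {C \<in> orb \<rho> ` X. P C}"
      unfolding pairwise_def disjnt_def
    proof (intro ballI impI, rule ccontr)
      fix C1 C2 assume CC: "C1 \<in> {C \<in> orb \<rho> ` X. P C}" "C2 \<in> {C \<in> orb \<rho> ` X. P C}" "C1 \<noteq> C2" "C1 \<inter> C2 \<noteq> {}"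
      then obtain x y z where "x \<in> X" "y \<in> X" "C1 = orb \<rho> x" "C2 = orb \<rho> y" "z \<in> orb \<rho> x" "z \<in> orb \<rho> y" by blast
      then show False using orb_eq[of x z] orb_eq[of y z] CC(3) by simp
    qed
    show "\<And>C. C \<in> {C \<in> orb \<rho> ` X. P C} \<Longrightarrow> finite C"
      using orb_subset fin by (auto intro: finite_subset)
  qed
  finally show ?thesis .
qed

text \<open>The fixed point numbers determine the orbit numbers of every size by inversion over divisors, so the
hypothesis says that the rotation has \<open>\<Sum>lam. o_num lam k\<close> orbits of size \<open>k\<close>.  These are then
distributed among the values \<open>lam\<close>, and a statistic which is constant on orbits results.\<close>

theorem invariant_statistic_exists:
  fixes o_num :: "'b \<Rightarrow> nat \<Rightarrow> nat"
  assumes L: "finite \<Lambda>"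
    and cnt: "\<And>d. d dvd n \<Longrightarrow> card {x\<in>X. (\<rho> ^^ d) x = x} = (\<Sum>lam\<in>\<Lambda>. \<Sum>k | k dvd d. k * o_num lam k)"
  shows "\<exists>st. st \<in> X \<rightarrow> \<Lambda> \<and> (\<forall>x\<in>X. st (\<rho> x) = st x) \<and>
    (\<forall>lam\<in>\<Lambda>. \<forall>d. d dvd n \<longrightarrow> card {x\<in>X. st x = lam \<and> (\<rho> ^^ d) x = x} = (\<Sum>k | k dvd d. k * o_num lam k))"
proof -
  let ?Orb = "\<lambda>k. {C\<in>orb \<rho> ` X. card C = k}"
  have finO: "finite (orb \<rho> ` X)" using fin by simp
  have findvd: "finite {k. k dvd d}" if "d dvd n" for d
    using that n by (intro finite_divisors_nat) (auto intro: dvd_pos_nat)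
  have split: "(\<Sum>C\<in>{C\<in>orb \<rho> ` X. Q C \<and> card C dvd d}. card C) = (\<Sum>k | k dvd d. k * card {C\<in>?Orb k. Q C})"
    if "d dvd n" for d Q
  proof -
    let ?A = "{C\<in>orb \<rho> ` X. Q C \<and> card C dvd d}"
    have "(\<Sum>C\<in>?A. card C) = (\<Sum>k | k dvd d. \<Sum>C\<in>{C\<in>?A. card C = k}. card C)"
      by (rule sum.group[symmetric]) (use finO findvd[OF that] in auto)
    also have "\<dots> = (\<Sum>k | k dvd d. k * card {C\<in>?Orb k. Q C})"
    proof (rule sum.cong[OF refl])
      fix k assume "k \<in> {k. k dvd d}"
      then have "{C\<in>?A. card C = k} = {C\<in>?Orb k. Q C}" by auto
      then show "(\<Sum>C\<in>{C\<in>?A. card C = k}. card C) = k * card {C\<in>?Orb k. Q C}" by simp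
    qed
    finally show ?thesis .
  qed
  have total: "card {x\<in>X. (\<rho> ^^ d) x = x} = (\<Sum>k | k dvd d. k * card (?Orb k))" if "d dvd n" for d
  proof -
    have "{x\<in>X. (\<rho> ^^ d) x = x} = {x\<in>X. card (orb \<rho> x) dvd d}" using fixed_iff_card_orb_dvd by blast
    then show ?thesis using card_by_orbits[of "\<lambda>C. card C dvd d"] split[OF that, of "\<lambda>_. True"] by simp
  qed
  have orbs: "card (?Orb k) = (\<Sum>lam\<in>\<Lambda>. o_num lam k)" if "k dvd n" for k
    using that
  proof (induction k rule: less_induct)
    case (less k)
    have k0: "k > 0" using less.prems n by (auto intro: dvd_pos_nat)
    have div: "{j. j dvd k} = insert k {j. j dvd k \<and> j < k}" using k0 by (auto dest: dvd_imp_le)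
    have fj: "finite {j. j dvd k \<and> j < k}" by simp
    have "(\<Sum>j | j dvd k. j * card (?Orb j)) = (\<Sum>j | j dvd k. j * (\<Sum>lam\<in>\<Lambda>. o_num lam j))"
      using total[OF less.prems] cnt[OF less.prems] by (simp add: sum_distrib_left sum.swap[of _ _ \<Lambda>])
    moreover have "(\<Sum>j | j dvd k \<and> j < k. j * card (?Orb j)) = (\<Sum>j | j dvd k \<and> j < k. j * (\<Sum>lam\<in>\<Lambda>. o_num lam j))"
      by (rule sum.cong[OF refl]) (use less dvd_trans in auto)
    ultimately have "k * card (?Orb k) = k * (\<Sum>lam\<in>\<Lambda>. o_num lam k)"
      unfolding div using fj by simp
    then show ?case using k0 by simp
  qed
  have "\<exists>h. h \<in> ?Orb k \<rightarrow> \<Lambda> \<and> (\<forall>lam\<in>\<Lambda>. card {C\<in>?Orb k. h C = lam} = o_num lam k)" if "k dvd n" for k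
    using orbs[OF that] finO by (intro fibres_of_given_size_exist[OF L]) auto
  note ex = this
  define Q where "Q k h \<longleftrightarrow> h \<in> ?Orb k \<rightarrow> \<Lambda> \<and> (\<forall>lam\<in>\<Lambda>. card {C\<in>?Orb k. h C = lam} = o_num lam k)" for k h
  \<comment> \<open>A distribution of the orbits is chosen for every orbit size separately.\<close>
  define h where "h k = (SOME h. Q k h)" for k
  have Qh: "Q k (h k)" if "k dvd n" for k
    unfolding h_def using ex[OF that] by (intro someI_ex[of "Q k"]) (simp only: Q_def)
  have h: "\<And>k. k dvd n \<Longrightarrow> h k \<in> ?Orb k \<rightarrow> \<Lambda>"
    "\<And>k lam. k dvd n \<Longrightarrow> lam \<in> \<Lambda> \<Longrightarrow> card {C\<in>?Orb k. h k C = lam} = o_num lam k"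
    using Qh unfolding Q_def by blast+
  define st where "st x = h (card (orb \<rho> x)) (orb \<rho> x)" for x
  have dn: "card (orb \<rho> x) dvd n" if "x \<in> X" for x using fixed_iff_card_orb_dvd[OF that, of n] ord[OF that] by simp
  have "st x \<in> \<Lambda>" if "x \<in> X" for x using h(1)[OF dn[OF that]] that unfolding st_def by blast
  moreover have "st (\<rho> x) = st x" if "x \<in> X" for x
  proof -
    have "\<rho> x \<in> orb \<rho> x" unfolding orb_def by (rule range_eqI[of _ _ 1]) simp
    then show ?thesis using orb_eq[OF that] by (simp add: st_def)
  qed
  moreover have "card {x\<in>X. st x = lam \<and> (\<rho> ^^ d) x = x} = (\<Sum>k | k dvd d. k * o_num lam k)"
    if "lam \<in> \<Lambda>" "d dvd n" for lam d
  proof -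
    have "{x\<in>X. st x = lam \<and> (\<rho> ^^ d) x = x} = {x\<in>X. h (card (orb \<rho> x)) (orb \<rho> x) = lam \<and> card (orb \<rho> x) dvd d}"
      using fixed_iff_card_orb_dvd by (auto simp: st_def)
    then have "card {x\<in>X. st x = lam \<and> (\<rho> ^^ d) x = x} = (\<Sum>k | k dvd d. k * card {C\<in>?Orb k. h (card C) C = lam})"
      using card_by_orbits[of "\<lambda>C. h (card C) C = lam \<and> card C dvd d"] split[OF that(2), of "\<lambda>C. h (card C) C = lam"] by simp
    also have "\<dots> = (\<Sum>k | k dvd d. k * o_num lam k)"
    proof (rule sum.cong[OF refl])
      fix k assume "k \<in> {k. k dvd d}"
      then have "k dvd n" using that dvd_trans by blast
      moreover have "{C\<in>?Orb k. h (card C) C = lam} = {C\<in>?Orb k. h k C = lam}" by auto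
      ultimately show "k * card {C\<in>?Orb k. h (card C) C = lam} = k * o_num lam k" using h(2) that by simp
    qed
    finally show ?thesis .
  qed
  ultimately show ?thesis by (intro exI[of _ st]) auto
qed

end

section \<open>Orbit numbers from fixed point numbers\<close>

lemma dvd_ge1: "m dvd (k::nat) \<Longrightarrow> k \<ge> 1 \<Longrightarrow> m \<ge> 1"
  by (cases m) auto

text \<open>The number of orbits of size \<open>k\<close> in an action of the cyclic group of order \<open>n\<close> for which the \<open>d\<close>-th power
of the generator has \<open>a d\<close> fixed points, for all \<open>d dvd n\<close>, provided that such an action exists.  Its values
are real numbers as long as this is not known.\<close>

function orbit_count :: "(nat \<Rightarrow> real) \<Rightarrow> nat \<Rightarrow> real" where
  "orbit_count a k = (a k - (\<Sum>j\<in>{j. j dvd k \<and> j < k}. real j * orbit_count a j)) / real k"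
  by pat_completeness auto
termination by (relation "measure snd") auto

declare orbit_count.simps [simp del]

lemma divisors_insert: "k \<ge> 1 \<Longrightarrow> {j. j dvd k} = insert k {j. j dvd k \<and> j < (k::nat)}"
  by (auto dest: dvd_imp_le)

lemma orbit_count_sum:
  assumes "k \<ge> 1"
  shows "(\<Sum>j | j dvd k. real j * orbit_count a j) = a k"
  unfolding divisors_insert[OF assms] using assms by (simp add: orbit_count.simps[of a k])

text \<open>A single fixed point is one orbit of size one.\<close>

lemma orbit_count_one:
  assumes "k \<ge> 1" "\<And>d. d dvd k \<Longrightarrow> a d = 1"
  shows "orbit_count a k = (if k = 1 then 1 else 0)"
  using assms
proof (induction k rule: less_induct)
  case (less k)
  have "(\<Sum>j | j dvd k \<and> j < k. real j * orbit_count a j) = (\<Sum>j | j dvd k \<and> j < k. if j = 1 then 1 else 0)"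
  proof (rule sum.cong[OF refl])
    fix j assume j: "j \<in> {j. j dvd k \<and> j < k}"
    then have "j \<ge> 1" using less.prems(1) dvd_ge1 by blast
    moreover have "a d = 1" if "d dvd j" for d using less.prems(2) that j dvd_trans by blast
    ultimately show "real j * orbit_count a j = (if j = 1 then 1 else 0)" using less.IH[of j] j by auto
  qed
  also have "\<dots> = (if k = 1 then 0 else 1)"
    using less.prems(1) by (auto simp: sum.delta')
  finally show ?case using less.prems by (simp add: orbit_count.simps[of a k])
qed

lemma sum_UN_le:
  fixes f :: "nat \<Rightarrow> real"
  assumes "finite P" "\<And>p. p \<in> P \<Longrightarrow> finite (S p)" "\<And>x. x \<in> (\<Union>p\<in>P. S p) \<Longrightarrow> f x \<ge> 0"
  shows "sum f (\<Union>p\<in>P. S p) \<le> (\<Sum>p\<in>P. sum f (S p))"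
  using assms
proof (induction P rule: finite_induct)
  case (insert p P)
  have "sum f (S p \<union> (\<Union>p\<in>P. S p)) = sum f (S p) + sum f (\<Union>p\<in>P. S p) - sum f (S p \<inter> (\<Union>p\<in>P. S p))"
    by (rule sum_Un) (use insert in auto)
  moreover have "sum f (S p \<inter> (\<Union>p\<in>P. S p)) \<ge> 0" by (rule sum_nonneg) (use insert in auto)
  moreover have "sum f (\<Union>p\<in>P. S p) \<le> (\<Sum>p\<in>P. sum f (S p))" by (rule insert.IH) (use insert in auto)
  ultimately show ?case using insert by simp
qed simp

text \<open>Every proper divisor of \<open>k\<close> divides \<open>k div p\<close> for some prime \<open>p\<close>.  So the points in smaller
orbits are at most \<open>\<Sum>p. a (k div p)\<close> in number.\<close>

lemma orbit_count_nonneg_step: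
  assumes k: "k \<ge> 1" and nonneg: "\<And>j. j dvd k \<Longrightarrow> j < k \<Longrightarrow> orbit_count a j \<ge> 0"
    and le: "(\<Sum>p | prime p \<and> p dvd k. a (k div p)) \<le> a k"
  shows "orbit_count a k \<ge> 0"
proof -
  let ?P = "{p. prime p \<and> p dvd k}"
  let ?f = "\<lambda>j. real j * orbit_count a j"
  have finP: "finite ?P" using k by (intro finite_subset[OF _ finite_divisors_nat[of k]]) auto
  have fin: "finite {j. j dvd d}" if "d dvd k" for d
    using dvd_ge1[OF that k] by (intro finite_divisors_nat) auto
  have kp: "k div p dvd k" "k div p < k" if "p \<in> ?P" for p
  proof -
    have "k = k div p * p" using that by simp
    then show "k div p dvd k" by (metis dvd_triv_left)
    show "k div p < k" using that k prime_gt_1_nat[of p] by (intro div_less_dividend) auto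
  qed
  have pos: "?f j \<ge> 0" if "j dvd k" "j < k" for j using nonneg[OF that] by simp
  have "{j. j dvd k \<and> j < k} \<subseteq> (\<Union>p\<in>?P. {j. j dvd k div p})"
  proof
    fix j assume "j \<in> {j. j dvd k \<and> j < k}"
    then obtain m where m: "k = j * m" "m \<noteq> 1" by (auto elim!: dvdE)
    then obtain p where p: "prime p" "p dvd m" using prime_factor_nat by blast
    then have "j dvd k div p" using m k prime_gt_0_nat[OF p(1)] by (auto elim!: dvdE simp: mult.assoc)
    moreover have "p \<in> ?P" using p m by auto
    ultimately show "j \<in> (\<Union>p\<in>?P. {j. j dvd k div p})" by blast
  qed
  moreover have U: "j dvd k \<and> j < k" if jU: "j \<in> (\<Union>p\<in>?P. {j. j dvd k div p})" for j
  proof -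
    obtain p where p: "p \<in> ?P" "j dvd k div p" using jU by blast
    then have "j \<le> k div p" using dvd_ge1[OF kp(1)[OF p(1)] k] by (intro dvd_imp_le) auto
    then show ?thesis using kp[OF p(1)] p(2) dvd_trans by (auto intro: le_less_trans)
  qed
  ultimately have eq: "{j. j dvd k \<and> j < k} = (\<Union>p\<in>?P. {j. j dvd k div p})" by blast
  have "(\<Sum>j | j dvd k \<and> j < k. ?f j) \<le> (\<Sum>p\<in>?P. \<Sum>j | j dvd k div p. ?f j)"
    unfolding eq
  proof (rule sum_UN_le[OF finP])
    show "finite {j. j dvd k div p}" if "p \<in> ?P" for p using fin[OF kp(1)[OF that]] .
    show "0 \<le> ?f j" if "j \<in> (\<Union>p\<in>?P. {j. j dvd k div p})" for j using U[OF that] pos by blast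
  qed
  also have "\<dots> = (\<Sum>p\<in>?P. a (k div p))"
  proof (rule sum.cong[OF refl])
    fix p assume p: "p \<in> ?P"
    have "k div p \<ge> 1" by (rule dvd_ge1[OF kp(1)[OF p] k])
    then show "(\<Sum>j | j dvd k div p. ?f j) = a (k div p)" by (rule orbit_count_sum)
  qed
  also have "\<dots> \<le> a k" by (rule le)
  finally show ?thesis using k by (simp add: orbit_count.simps[of a k])
qed

text \<open>The usual comparison with \<open>1 / (i (i + 1))\<close>.\<close>

lemma sum_inverse_squares_le: "(\<Sum>i\<in>{1..Suc N}. 1 / (real i)\<^sup>2) \<le> 2 - 1 / real (Suc N)"
proof (induction N)
  case (Suc N)
  have "1 / (real (Suc (Suc N)))\<^sup>2 \<le> 1 / (real (Suc N) * real (Suc (Suc N)))"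
    unfolding power2_eq_square by (intro divide_left_mono mult_right_mono) auto
  also have "\<dots> = 1 / real (Suc N) - 1 / real (Suc (Suc N))" by (simp add: field_simps)
  finally show ?case using Suc by simp
qed simp

text \<open>With \<open>p = 2 i + 1\<close> this is a quarter of a sum of inverse squares, which is at most \<open>2\<close>.\<close>

lemma sum_odd_primes_le:
  assumes "finite S" "\<And>p. p \<in> S \<Longrightarrow> odd p \<and> p \<ge> 3"
  shows "(\<Sum>p\<in>S. 1 / (real p - 1)\<^sup>2) \<le> 1 / 2"
proof -
  let ?h = "\<lambda>p. p div 2"
  have inj: "inj_on ?h S" using assms(2) by (intro inj_onI) (metis odd_two_times_div_two_succ)
  have "?h ` S \<subseteq> {..Max (?h ` S)}" using assms(1) by auto
  then obtain N where N: "?h ` S \<subseteq> {..N}" by blast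
  have sub: "?h ` S \<subseteq> {1..N}" using N assms(2) by force
  have "(\<Sum>p\<in>S. 1 / (real p - 1)\<^sup>2) = (\<Sum>p\<in>S. 1 / 4 * (1 / (real (?h p))\<^sup>2))"
  proof (rule sum.cong[OF refl])
    fix p assume "p \<in> S"
    then have "p = 2 * ?h p + 1" using assms(2) by (metis odd_two_times_div_two_succ)
    then have "real p - 1 = 2 * real (?h p)" by linarith
    then show "1 / (real p - 1)\<^sup>2 = 1 / 4 * (1 / (real (?h p))\<^sup>2)" by (simp add: power2_eq_square)
  qed
  also have "\<dots> = 1 / 4 * (\<Sum>i\<in>?h ` S. 1 / (real i)\<^sup>2)"
    by (simp add: sum_distrib_left sum.reindex[OF inj] o_def)
  also have "\<dots> \<le> 1 / 4 * (\<Sum>i\<in>{1..N}. 1 / (real i)\<^sup>2)"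
    by (intro mult_left_mono sum_mono2 sub) auto
  also have "\<dots> \<le> 1 / 4 * (\<Sum>i\<in>{1..Suc N}. 1 / (real i)\<^sup>2)"
    by (intro mult_left_mono sum_mono2) auto
  also have "\<dots> \<le> 1 / 4 * (2 - 1 / real (Suc N))" by (intro mult_left_mono sum_inverse_squares_le) auto
  also have "\<dots> \<le> 1 / 4 * 2" by (intro mult_left_mono) auto
  finally show ?thesis by simp
qed

text \<open>By \<open>ribbon_ratio\<close> the odd primes contribute at most half of the right-hand side.  If \<open>2\<close> is the only
prime divisor, then the trivial bound \<open>ribbon_paths_le\<close> suffices; otherwise \<open>k div 2 \<ge> 3\<close> and
\<open>domino_ratio\<close> gives \<open>4/9\<close>, which is less than the other half.\<close>

lemma prime_ribbon_sum_le:
  assumes B: "B \<subseteq> {..<2*l}" and r: "r > 0" and k: "k \<ge> 1" and F: "paths r k {..<l} B \<noteq> 1"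
  shows "(\<Sum>p | prime p \<and> p dvd k. (real (paths (p * r) (k div p) {..<l} B))\<^sup>2) \<le> (real (paths r k {..<l} B))\<^sup>2"
proof -
  let ?S = "{p. prime p \<and> p dvd k}"
  let ?F = "paths r k {..<l} B"
  let ?R = "\<lambda>p. paths (p * r) (k div p) {..<l} B"
  have fin: "finite B" using B by (rule finite_subset) simp
  have finS: "finite ?S" using k by (intro finite_subset[OF _ finite_divisors_nat[of k]]) auto
  have RF: "?R p \<le> ?F" if "p \<in> ?S" for p
    using ribbon_paths_le[OF fin r, of p "k div p" "{..<l}"] that by simp
  show ?thesis
  proof (cases "?F = 0")
    case True
    then have "?R p = 0" if "p \<in> ?S" for p using RF[OF that] by simp
    then show ?thesis by simp
  next
    case False
    then have F2: "?F \<ge> 2" using F by linarith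
    have odd: "(\<Sum>p\<in>?S - {2}. (real (?R p))\<^sup>2) \<le> (real ?F)\<^sup>2 / 2"
    proof -
      have op: "odd p \<and> p \<ge> 3" if "p \<in> ?S - {2}" for p
        using that prime_odd_nat[of p] prime_ge_2_nat[of p] by (cases "p = 2") auto
      have "(\<Sum>p\<in>?S - {2}. (real (?R p))\<^sup>2) \<le> (\<Sum>p\<in>?S - {2}. (real ?F)\<^sup>2 * (1 / (real p - 1)\<^sup>2))"
      proof (rule sum_mono)
        fix p assume p: "p \<in> ?S - {2}"
        have "(p - 1) * ?R p \<le> ?F"
          using ribbon_ratio[OF B _ _ r, of p "k div p"] F2 p op[OF p] by simp
        then have "real ((p - 1) * ?R p) \<le> real ?F" by (rule of_nat_mono)
        then have "real (?R p) * (real p - 1) \<le> real ?F" using op[OF p] by (simp add: of_nat_diff mult.commute)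
        then have "(real (?R p) * (real p - 1))\<^sup>2 \<le> (real ?F)\<^sup>2" using op[OF p] by (intro power_mono) auto
        moreover have "(real p - 1)\<^sup>2 > 0" using op[OF p] by (intro zero_less_power) auto
        ultimately show "(real (?R p))\<^sup>2 \<le> (real ?F)\<^sup>2 * (1 / (real p - 1)\<^sup>2)"
          by (simp add: pos_le_divide_eq power_mult_distrib)
      qed
      also have "\<dots> = (real ?F)\<^sup>2 * (\<Sum>p\<in>?S - {2}. 1 / (real p - 1)\<^sup>2)" by (simp only: sum_distrib_left)
      also have "\<dots> \<le> (real ?F)\<^sup>2 * (1 / 2)"
        by (intro mult_left_mono sum_odd_primes_le) (use finS op in auto)
      finally show ?thesis by simp
    qed
    show ?thesis
    proof (cases "2 \<in> ?S")
      case False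
      then have "?S - {2} = ?S" by auto
      with odd have "(\<Sum>p\<in>?S. (real (?R p))\<^sup>2) \<le> (real ?F)\<^sup>2 / 2" by simp
      also have "\<dots> \<le> (real ?F)\<^sup>2" by simp
      finally show ?thesis .
    next
      case True
      have split: "(\<Sum>p\<in>?S. (real (?R p))\<^sup>2) = (real (?R 2))\<^sup>2 + (\<Sum>p\<in>?S - {2}. (real (?R p))\<^sup>2)"
        by (rule sum.remove[OF finS True])
      show ?thesis
      proof (cases "?S - {2} = {}")
        case e: True
        have "(real (?R 2))\<^sup>2 \<le> (real ?F)\<^sup>2" using RF[OF True] by (intro power_mono) auto
        then show ?thesis unfolding split e by simp
      next
        case False
        then obtain q where q: "prime q" "q dvd k" "q \<noteq> 2" by auto
        have q3: "odd q" "q \<ge> 3" using q prime_odd_nat[of q] prime_ge_2_nat[of q] by auto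
        have k2: "k = 2 * (k div 2)" using True by auto
        have "coprime q 2" using q3 by simp
        then have "q dvd k div 2" using q(2) k2 by (metis coprime_dvd_mult_right_iff)
        moreover have "k div 2 > 0" using k k2 by linarith
        ultimately have "k div 2 \<ge> 3" using q3 dvd_imp_le[of q "k div 2"] by linarith
        then have "3 * ?R 2 \<le> 2 * ?F"
          using domino_ratio[OF B _ _ r, of "k div 2"] F2 k2 by simp
        then have "real (?R 2) \<le> 2 / 3 * real ?F" by linarith
        then have "(real (?R 2))\<^sup>2 \<le> (2 / 3 * real ?F)\<^sup>2" by (intro power_mono) auto
        also have "\<dots> \<le> (real ?F)\<^sup>2 / 2" by (simp add: power_mult_distrib power_divide)
        finally show ?thesis unfolding split using odd by simp
      qed
    qed
  qed
qed

text \<open>If there is exactly one \<open>r\<close>-ribbon tableau, then there is exactly one for all multiples of \<open>r\<close> and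
the predicted action is trivial; otherwise \<open>prime_ribbon_sum_le\<close> is available.\<close>

theorem orbit_count_paths_nonneg:
  assumes B: "B \<subseteq> {..<2*l}" and n: "n \<ge> 1" and k: "k dvd n"
  shows "orbit_count (\<lambda>d. real ((paths (n div d) d {..<l} B)\<^sup>2)) k \<ge> 0"
  using k
proof (induction k rule: less_induct)
  case (less k)
  let ?a = "\<lambda>d. real ((paths (n div d) d {..<l} B)\<^sup>2)"
  define r where "r = n div k"
  have k: "k \<ge> 1" by (rule dvd_ge1[OF less.prems n])
  have nr: "n = r * k" using less.prems by (simp add: r_def)
  then have r: "r > 0" using n by (cases r) auto
  show ?case
  proof (cases "paths r k {..<l} B = 1")
    case True
    have "?a d = 1" if d: "d dvd k" for d
    proof -
      define j where "j = k div d"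
      have kj: "k = j * d" using d by (simp add: j_def)
      then have jd: "j > 0" "d > 0" using k by (auto intro: gr0I)
      have "n = (j * r) * d" unfolding nr kj by (simp only: mult_ac)
      then have "n div d = j * r" using jd by simp
      then show ?thesis using unique_path_ribbons[OF B True[unfolded kj] r jd(1)] by simp
    qed
    then show ?thesis using orbit_count_one[OF k, of ?a] by simp
  next
    case False
    show ?thesis
    proof (rule orbit_count_nonneg_step[OF k])
      show "0 \<le> orbit_count ?a j" if "j dvd k" "j < k" for j
        using less.IH[OF that(2)] that(1) less.prems dvd_trans by blast
      have "(\<Sum>p | prime p \<and> p dvd k. ?a (k div p)) = (\<Sum>p | prime p \<and> p dvd k. (real (paths (p * r) (k div p) {..<l} B))\<^sup>2)"
      proof (rule sum.cong[OF refl])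
        fix p assume p: "p \<in> {p. prime p \<and> p dvd k}"
        define j where "j = k div p"
        have kj: "k = p * j" using p by (simp add: j_def)
        then have "j > 0" using k by (intro gr0I) auto
        moreover have "n = (p * r) * j" unfolding nr kj by (simp only: mult_ac)
        ultimately have "n div j = p * r" by simp
        then show "?a (k div p) = (real (paths (p * r) (k div p) {..<l} B))\<^sup>2" by (simp add: j_def)
      qed
      also have "\<dots> \<le> (real (paths r k {..<l} B))\<^sup>2" by (rule prime_ribbon_sum_le[OF B r k False])
      also have "\<dots> = ?a k" by (simp add: r_def)
      finally show "(\<Sum>p | prime p \<and> p dvd k. ?a (k div p)) \<le> ?a k" .
    qed
  qed
qed

lemma codivisor_dvd: "k dvd n \<Longrightarrow> n div k dvd (n::nat)"
  by (metis dvd_div_mult_self dvd_triv_left)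

lemma codivisor_codivisor:
  assumes "k dvd n" "n \<ge> 1"
  shows "n div (n div k) = (k::nat)"
proof -
  obtain m where m: "n = k * m" using assms(1) by (auto elim: dvdE)
  then have "k > 0" "m > 0" using assms(2) by (auto intro: gr0I)
  then show ?thesis using m by simp
qed

lemma sum_roots_of_unity:
  fixes \<xi> :: complex
  assumes n: "n \<ge> 1" and root: "\<xi> ^ n = 1" and prim: "\<And>j. 0 < j \<Longrightarrow> j < n \<Longrightarrow> \<xi> ^ j \<noteq> 1"
    and k: "k dvd n"
  shows "(\<Sum>d | d < n \<and> k dvd d. \<xi> ^ (d * j)) = (if (n div k) dvd j then of_nat (n div k) else 0)"
proof -
  define m where "m = n div k"
  have nm: "n = k * m" using k by (simp add: m_def)
  have pos: "k > 0" "m > 0" using n nm by (auto intro: gr0I)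
  have "{d. d < n \<and> k dvd d} = (\<lambda>t. k * t) ` {..<m}" using pos nm by (auto elim!: dvdE)
  moreover have "inj_on (\<lambda>t. k * t) {..<m}" using pos by (auto simp: inj_on_def)
  ultimately have "(\<Sum>d | d < n \<and> k dvd d. \<xi> ^ (d * j)) = (\<Sum>t<m. (\<xi> ^ (k * j)) ^ t)"
    by (simp add: sum.reindex power_mult[symmetric] mult_ac)
  also have "\<dots> = (if m dvd j then of_nat m else 0)"
  proof (cases "m dvd j")
    case True
    then obtain t where "j = m * t" by (auto elim: dvdE)
    then have "\<xi> ^ (k * j) = 1" using root nm by (simp add: power_mult mult.assoc[symmetric])
    then show ?thesis using True by simp
  next
    case False
    have ne: "\<xi> ^ (k * j) \<noteq> 1"
    proof
      assume one: "\<xi> ^ (k * j) = 1"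
      have "\<xi> ^ (k * j) = \<xi> ^ ((k * j) mod n) * (\<xi> ^ n) ^ ((k * j) div n)"
        by (simp only: power_mult[symmetric] power_add[symmetric]) simp
      then have "\<xi> ^ ((k * j) mod n) = 1" using one root by simp
      moreover have "(k * j) mod n < n" using n by simp
      ultimately have "(k * j) mod n = 0" using prim[of "(k * j) mod n"] by auto
      then have "k * m dvd k * j" using nm by (simp add: mod_eq_0_iff_dvd)
      then show False using pos False by simp
    qed
    have "(\<xi> ^ (k * j)) ^ m = (\<xi> ^ n) ^ j" unfolding nm power_mult[symmetric] by (simp only: mult_ac)
    then have "(\<xi> ^ (k * j)) ^ m = 1" using root by simp
    then show ?thesis using ne False by (simp add: geometric_sum)
  qed
  finally show ?thesis by (simp add: m_def)
qed

text \<open>A sum of \<open>n\<close>-th roots of unity, seen as a character of the cyclic group, contains every linear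
character with an integral multiplicity.  If the values depend only on \<open>gcd d n\<close>, then the
multiplicity of the \<open>j\<close>-th linear character is \<open>\<Sum>m. orbit_count a (n div m)\<close>
over the common divisors \<open>m\<close> of \<open>j\<close> and \<open>n\<close>, and the single summands are recovered by induction
over the divisors \<open>j\<close>.\<close>

theorem orbit_count_Ints:
  fixes \<xi> :: complex
  assumes n: "n \<ge> 1" and root: "\<xi> ^ n = 1" and prim: "\<And>j. 0 < j \<Longrightarrow> j < n \<Longrightarrow> \<xi> ^ j \<noteq> 1"
    and I: "finite I" and a: "\<And>d. (\<Sum>i\<in>I. \<xi> ^ (d * e i)) = of_real (a (gcd d n))"
    and k: "k dvd n"
  shows "orbit_count a k \<in> \<int>"
proof -
  have findvd: "finite {k. k dvd n}" using n by (intro finite_divisors_nat) auto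
  have main: "(\<Sum>m | m dvd j \<and> m dvd n. orbit_count a (n div m)) = real (card {i\<in>I. n dvd (e i + (n * j - j))})" for j
  proof -
    \<comment> \<open>A natural number representing \<open>- j\<close> modulo \<open>n\<close>.\<close>
    define J where "J = n * j - j"
    have dj: "m dvd J \<longleftrightarrow> m dvd j" if "m dvd n" for m
    proof -
      have "j \<le> n * j" "m dvd n * j" using n that by auto
      then show ?thesis unfolding J_def by (metis dvd_diff_nat dvd_diffD1)
    qed
    have "(\<Sum>d<n. (\<Sum>i\<in>I. \<xi> ^ (d * e i)) * \<xi> ^ (d * J)) = (\<Sum>d<n. \<Sum>i\<in>I. \<xi> ^ (d * (e i + J)))"
      by (simp only: sum_distrib_right distrib_left power_add)
    also have "\<dots> = (\<Sum>i\<in>I. \<Sum>d<n. \<xi> ^ (d * (e i + J)))" by (rule sum.swap)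
    also have "\<dots> = (\<Sum>i\<in>I. if n dvd e i + J then of_nat n else 0)"
      using sum_roots_of_unity[OF n root prim, of 1] by (simp add: lessThan_def cong: if_cong)
    also have "\<dots> = of_nat n * of_nat (card {i\<in>I. n dvd (e i + J)})"
      using I by (simp add: sum.If_cases Int_def mult.commute)
    finally have L: "(\<Sum>d<n. (\<Sum>i\<in>I. \<xi> ^ (d * e i)) * \<xi> ^ (d * J)) = of_nat n * of_nat (card {i\<in>I. n dvd (e i + J)})" .
    \<comment> \<open>The same sum, with the character expanded into orbits of size \<open>k\<close>, that is into the functions
      which are \<open>k\<close> on multiples of \<open>k\<close> and zero elsewhere.\<close>
    have "(\<Sum>d<n. (\<Sum>i\<in>I. \<xi> ^ (d * e i)) * \<xi> ^ (d * J))
       = (\<Sum>d<n. \<Sum>k | k dvd n. if k dvd d then of_real (real k * orbit_count a k) * \<xi> ^ (d * J) else 0)"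
    proof (rule sum.cong[OF refl])
      fix d
      have g: "gcd d n \<ge> 1" using n by (simp add: Suc_le_eq)
      have e: "{k. k dvd gcd d n} = {k\<in>{k. k dvd n}. k dvd d}" by auto
      have "a (gcd d n) = (\<Sum>k\<in>{k\<in>{k. k dvd n}. k dvd d}. real k * orbit_count a k)"
        unfolding e[symmetric] by (rule orbit_count_sum[OF g, symmetric])
      also have "\<dots> = (\<Sum>k | k dvd n. if k dvd d then real k * orbit_count a k else 0)"
        by (rule sum.inter_filter[OF findvd])
      finally have ag: "a (gcd d n) = (\<Sum>k | k dvd n. if k dvd d then real k * orbit_count a k else 0)" .
      show "(\<Sum>i\<in>I. \<xi> ^ (d * e i)) * \<xi> ^ (d * J)
        = (\<Sum>k | k dvd n. if k dvd d then of_real (real k * orbit_count a k) * \<xi> ^ (d * J) else 0)"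
        unfolding a ag of_real_sum sum_distrib_right by (rule sum.cong[OF refl]) simp
    qed
    also have "\<dots> = (\<Sum>k | k dvd n. \<Sum>d<n. if k dvd d then of_real (real k * orbit_count a k) * \<xi> ^ (d * J) else 0)"
      by (rule sum.swap)
    also have "\<dots> = (\<Sum>k | k dvd n. of_real (real k * orbit_count a k) * (if (n div k) dvd j then of_nat (n div k) else 0))"
    proof (rule sum.cong[OF refl])
      fix k assume k: "k \<in> {k. k dvd n}"
      have "(\<Sum>d<n. if k dvd d then of_real (real k * orbit_count a k) * \<xi> ^ (d * J) else 0)
        = (\<Sum>d | d < n \<and> k dvd d. of_real (real k * orbit_count a k) * \<xi> ^ (d * J))"
        by (simp add: sum.inter_filter[symmetric])
      also have "\<dots> = of_real (real k * orbit_count a k) * (\<Sum>d | d < n \<and> k dvd d. \<xi> ^ (d * J))"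
        by (simp add: sum_distrib_left)
      also have "(\<Sum>d | d < n \<and> k dvd d. \<xi> ^ (d * J)) = (if (n div k) dvd j then of_nat (n div k) else 0)"
        using sum_roots_of_unity[OF n root prim, of k J] k dj[of "n div k"] codivisor_dvd[of k n] by simp
      finally show "(\<Sum>d<n. if k dvd d then of_real (real k * orbit_count a k) * \<xi> ^ (d * J) else 0)
        = of_real (real k * orbit_count a k) * (if (n div k) dvd j then of_nat (n div k) else 0)" .
    qed
    also have "\<dots> = (\<Sum>k | k dvd n. of_nat n * (if (n div k) dvd j then of_real (orbit_count a k) else 0))"
    proof (rule sum.cong[OF refl])
      fix k assume "k \<in> {k. k dvd n}"
      then have "(of_nat n :: complex) = of_nat k * of_nat (n div k)" by (simp flip: of_nat_mult)
      then show "of_real (real k * orbit_count a k) * (if (n div k) dvd j then of_nat (n div k) else 0)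
        = of_nat n * (if (n div k) dvd j then of_real (orbit_count a k) else (0::complex))" by simp
    qed
    also have "\<dots> = of_nat n * (\<Sum>m | m dvd n. if m dvd j then of_real (orbit_count a (n div m)) else 0)"
      unfolding sum_distrib_left[symmetric]
    proof (intro arg_cong2[where f = "(*)"] refl sum.reindex_bij_witness[where i = "\<lambda>m. n div m" and j = "\<lambda>m. n div m"], goal_cases)
      case (5 k)
      then show ?case using codivisor_codivisor[of k n] n by simp
    qed (use n codivisor_codivisor codivisor_dvd in auto)
    also have "(\<Sum>m | m dvd n. if m dvd j then of_real (orbit_count a (n div m)) else 0)
      = of_real (\<Sum>m | m dvd j \<and> m dvd n. orbit_count a (n div m))"
      using findvd by (simp add: sum.inter_filter[symmetric] conj_commute)
    finally have "of_nat n * of_nat (card {i\<in>I. n dvd (e i + J)})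
      = (of_nat n * of_real (\<Sum>m | m dvd j \<and> m dvd n. orbit_count a (n div m)) :: complex)"
      unfolding L .
    then have "of_real (\<Sum>m | m dvd j \<and> m dvd n. orbit_count a (n div m)) = (of_real (real (card {i\<in>I. n dvd (e i + J)})) :: complex)"
      using n by simp
    then show ?thesis by (simp only: of_real_eq_iff J_def)
  qed
  have "orbit_count a (n div j) \<in> \<int>" if "j dvd n" for j
    using that
  proof (induction j rule: less_induct)
    case (less j)
    have j: "j \<ge> 1" by (rule dvd_ge1[OF less.prems n])
    have "{m. m dvd j \<and> m dvd n} = insert j {m. m dvd j \<and> m < j}"
      using less.prems divisors_insert[OF j] dvd_trans by blast
    then have "orbit_count a (n div j) + (\<Sum>m | m dvd j \<and> m < j. orbit_count a (n div m)) \<in> \<int>"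
      using main[of j] by simp
    moreover have "(\<Sum>m | m dvd j \<and> m < j. orbit_count a (n div m)) \<in> \<int>"
      using less dvd_trans by (intro Ints_sum) blast
    ultimately show ?case by (metis Ints_diff add_diff_cancel_right')
  qed
  from this[OF codivisor_dvd[OF k]] show ?thesis using codivisor_codivisor[OF k n] by simp
qed

section \<open>Partitions as bead sets\<close>

text \<open>The beads of a partition of \<open>n\<close>, always with \<open>n\<close> beads, which is enough for \<open>n\<close> parts.\<close>

definition beta :: "nat \<Rightarrow> nat list \<Rightarrow> nat set" where
  "beta n lam = count (vec n lam) ` {..<n}"

lemma size_vec: "size (vec l lam) = \<Sum>{..<l} + sum_list lam"
proof -
  obtain w where "mset w = part_mset lam" using ex_mset by blast
  then have "size (part_mset lam) = sum_list lam" using part_mset_length by (metis size_mset)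
  then show ?thesis by (simp add: vec_def size_delta)
qed

lemma beta_level:
  assumes lam: "lam \<in> partitions n"
  shows "beta n lam \<in> level n n"
proof -
  have inj: "inj_on (count (vec n lam)) {..<n}" by (rule strict_dec_inj[OF vec_strict_dec[OF lam]])
  have "sum_list lam = n" using lam by (simp add: partitions_def)
  then have "(\<Sum>i<n. count (vec n lam) i) = \<Sum>{..<n} + n"
    using size_supp[OF vec_supp[OF partitions_length[OF lam]]] size_vec by simp
  then show ?thesis using inj by (simp add: level_def beta_def card_image sum.reindex)
qed

text \<open>The largest bead stands at most \<open>s\<close> above its initial position.\<close>

lemma level_subset:
  assumes "B \<in> level l s" "s \<le> l"
  shows "B \<subseteq> {..<2*l}"
proof
  fix b assume b: "b \<in> B"
  have B: "finite B" "card B = l" "\<Sum>B = \<Sum>{..<l} + s" using assms by (auto simp: level_def)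
  obtain l' where l': "l = Suc l'" using B b by (cases l) auto
  have "\<Sum>{..<l'} \<le> \<Sum>(B - {b})" using sum_lessThan_card_le[of "B - {b}"] B b l' by simp
  moreover have "\<Sum>B = b + \<Sum>(B - {b})" using B b by (simp add: sum.remove[of _ b "\<lambda>x. x"])
  ultimately have "b \<le> l' + s" using B l' by (simp add: lessThan_Suc)
  then show "b \<in> {..<2*l}" using assms(2) l' by simp
qed

lemma strict_sorted_desc_eq:
  fixes f g :: "nat \<Rightarrow> nat"
  assumes "\<And>i j. i < j \<Longrightarrow> j < n \<Longrightarrow> f j < f i" "\<And>i j. i < j \<Longrightarrow> j < n \<Longrightarrow> g j < g i"
    and "f ` {..<n} = g ` {..<n}" "i < n"
  shows "f i = g i"
proof -
  have "sorted_wrt (<) (rev (map h [0..<n]))" if "\<And>i j. i < j \<Longrightarrow> j < n \<Longrightarrow> h j < h i" for h :: "nat \<Rightarrow> nat"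
    unfolding sorted_wrt_rev by (subst sorted_wrt_iff_nth_less) (use that in simp)
  from strict_sorted_equal[OF this[of g] this[of f]] assms(1-3)
  have "rev (map f [0..<n]) = rev (map g [0..<n])" by (simp add: atLeast0LessThan)
  then show ?thesis using assms(4) by simp
qed

lemma beta_inj: "inj_on (beta n) (partitions n)"
proof (rule inj_onI)
  fix lam mu assume lam: "lam \<in> partitions n" and mu: "mu \<in> partitions n" and eq: "beta n lam = beta n mu"
  have c: "count (vec n lam) i = count (vec n mu) i" if "i < n" for i
    by (rule strict_sorted_desc_eq[OF _ _ eq[unfolded beta_def] that])
       (use strict_dec_less vec_strict_dec[OF lam] vec_strict_dec[OF mu] in blast)+
  have p: "count (part_mset lam) i = count (part_mset mu) i" if "i < n" for i
    using c[OF that] by (simp add: vec_def)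
  have pos: "rho ! i > 0" if "rho \<in> partitions n" "i < length rho" for rho i
    using that by (auto simp: partitions_def in_set_conv_nth intro: gr0I)
  have le: "length rho \<le> length tau"
    if r: "rho \<in> partitions n" "tau \<in> partitions n" and e: "\<And>i. i < n \<Longrightarrow> count (part_mset rho) i = count (part_mset tau) i" for rho tau
  proof (rule ccontr)
    assume "\<not> length rho \<le> length tau"
    then have i: "length tau < length rho" by simp
    then have "length tau < n" using partitions_length[OF r(1)] by simp
    from e[OF this] show False using pos[OF r(1) i] i by (simp add: count_part_mset)
  qed
  have len: "length lam = length mu" using le[OF lam mu p] le[OF mu lam p[symmetric]] by simp
  show "lam = mu"
  proof (rule nth_equalityI[OF len])
    fix i assume "i < length lam"
    moreover then have "i < n" using partitions_length[OF lam] by simp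
    ultimately show "lam ! i = mu ! i" using p[of i] len by (simp add: count_part_mset)
  qed
qed

text \<open>The beads are sorted decreasingly, the vector \<open>(n - 1, \<dots>, 1, 0)\<close> is subtracted, and trailing zeros
are cut off.\<close>

lemma beta_surj:
  assumes B: "B \<in> level n n"
  shows "\<exists>lam\<in>partitions n. beta n lam = B"
proof -
  have Bp: "finite B" "card B = n" "\<Sum>B = \<Sum>{..<n} + n" using B by (auto simp: level_def)
  define xs where "xs = rev (sorted_list_of_set B)"
  have len: "length xs = n" using Bp by (simp add: xs_def)
  have setx: "set xs = B" using Bp by (simp add: xs_def)
  have dec: "xs ! j < xs ! i" if "i < j" "j < n" for i j
  proof -
    have "sorted_wrt (>) xs" using Bp by (simp add: xs_def sorted_wrt_rev)
    then show ?thesis using that len by (simp add: sorted_wrt_iff_nth_less)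
  qed
  have ge: "n - 1 - i \<le> xs ! i" if "i < n" for i
    using that
  proof (induction "n - 1 - i" arbitrary: i)
    case (Suc k)
    have k: "k = n - 1 - Suc i" "Suc i < n" using Suc(2) by arith+
    have "k \<le> xs ! Suc i" using Suc(1)[OF k] by (simp only: k(1))
    moreover have "xs ! Suc i < xs ! i" using dec k by simp
    ultimately show ?case using Suc(2) by simp
  qed simp
  define ms where "ms = map (\<lambda>i. xs ! i - (n - 1 - i)) [0..<n]"
  have lm: "length ms = n" by (simp add: ms_def)
  have msn: "ms ! i + (n - 1 - i) = xs ! i" if "i < n" for i using ge[OF that] that by (simp add: ms_def)
  have msdec: "ms ! j \<le> ms ! i" if "i \<le> j" "j < n" for i j
    using that
  proof (induction j)
    case (Suc j)
    show ?case
    proof (cases "i = Suc j")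
      case False
      have "xs ! Suc j < xs ! j" using dec Suc.prems by simp
      then have "ms ! Suc j \<le> ms ! j" using msn[of j] msn[of "Suc j"] Suc.prems by simp
      then show ?thesis using Suc False by simp
    qed simp
  qed simp
  \<comment> \<open>The list \<open>ms\<close> has length \<open>n\<close>; partitions have no zero entries.\<close>
  define lam where "lam = takeWhile (\<lambda>x. x > 0) ms"
  have ll: "length lam \<le> n" using length_takeWhile_le[of "\<lambda>x. x > 0" ms] lm by (simp add: lam_def)
  have lnth: "lam ! i = ms ! i" if "i < length lam" for i using that by (simp add: lam_def takeWhile_nth)
  have tail: "ms ! i = 0" if "length lam \<le> i" "i < n" for i
  proof -
    have "ms ! length lam = 0" using nth_length_takeWhile[of "\<lambda>x. x > 0" ms] that lm by (simp add: lam_def)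
    then show ?thesis using msdec[OF that] by simp
  qed
  have cnt: "count (part_mset lam) i = ms ! i" if "i < n" for i
    using lnth[of i] tail[OF _ that] by (auto simp: count_part_mset)
  have vec: "count (vec n lam) i = xs ! i" if "i < n" for i
    using cnt[OF that] msn[OF that] that by (simp add: vec_def count_delta)
  have "beta n lam = (\<lambda>i. xs ! i) ` {..<n}" unfolding beta_def using vec by auto
  also have "\<dots> = B" using setx len by (auto simp: set_conv_nth)
  finally have bB: "beta n lam = B" .
  have "(\<Sum>i<n. count (vec n lam) i) = \<Sum>B"
  proof -
    have "inj_on (count (vec n lam)) {..<n}"
      using Bp(2) bB by (intro eq_card_imp_inj_on) (auto simp: beta_def)
    then have "\<Sum>(beta n lam) = (\<Sum>i<n. count (vec n lam) i)" by (simp add: beta_def sum.reindex)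
    then show ?thesis using bB by simp
  qed
  then have "size (vec n lam) = \<Sum>{..<n} + n" using size_supp[OF vec_supp[OF ll]] Bp(3) by simp
  then have "sum_list lam = n" using size_vec[of n lam] by simp
  moreover have "sorted_wrt (\<ge>) lam"
    unfolding sorted_wrt_iff_nth_less using lnth msdec ll by auto
  moreover have "0 \<notin> set lam" using set_takeWhileD[of 0 "\<lambda>x. x > 0" ms] by (auto simp: lam_def)
  ultimately have "lam \<in> partitions n" by (simp add: partitions_def)
  then show ?thesis using bB by blast
qed

lemma beta_bij: "bij_betw (beta n) (partitions n) (level n n)"
  unfolding bij_betw_def using beta_inj beta_level beta_surj by blast

lemma finite_partitions: "finite (partitions n)"
  using bij_betw_finite[OF beta_bij] finite_level by blast

text \<open>The common value of \<open>f\<^sup>\<lambda>(\<xi>\<^sup>m)\<^sup>2\<close> for all \<open>m\<close> with \<open>gcd m n = d\<close>, and the number of elements of the fibre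
over \<open>\<lambda>\<close> that the \<open>d\<close>-th power of the rotation will fix.\<close>

definition fixed_count :: "nat \<Rightarrow> nat list \<Rightarrow> nat \<Rightarrow> nat" where
  "fixed_count n lam d = (paths (n div d) d {..<n} (beta n lam))\<^sup>2"

lemma maj_squared:
  fixes q :: complex
  assumes "lam \<in> partitions n" "n = r * d" "r > 0" "q ^ r = 1" "\<And>j. 0 < j \<Longrightarrow> j < r \<Longrightarrow> q ^ j \<noteq> 1"
  shows "(\<Sum>T\<in>SYT lam. q ^ maj T)\<^sup>2 = of_nat ((paths r d {..<n} (beta n lam))\<^sup>2)"
proof -
  have l: "length lam \<le> n" by (rule partitions_length[OF assms(1)])
  have "sum_list lam = n" using assms(1) by (simp add: partitions_def)
  then have sz: "size (vec n lam) = \<Sum>{..<n} + r * d" using assms(2) by (simp add: size_vec)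
  show ?thesis
    unfolding SYT_maj_eq_phi[OF assms(1) l] beta_def
    by (rule phi_squared[OF assms(3,4,5) vec_supp[OF l] sz vec_strict_dec[OF assms(1)]])
qed

lemma sum_fixed_count:
  assumes "d dvd n" "n \<ge> 1"
  shows "(\<Sum>lam\<in>partitions n. fixed_count n lam d) = fact d * (n div d) ^ d"
proof -
  have n: "(n div d) * d = n" using assms(1) by simp
  then have r: "n div d > 0" using assms(2) by (intro gr0I) auto
  have "(\<Sum>lam\<in>partitions n. fixed_count n lam d) = (\<Sum>B\<in>level n n. (paths (n div d) d {..<n} B)\<^sup>2)"
    unfolding fixed_count_def by (rule sum.reindex_bij_betw[OF beta_bij])
  then show ?thesis using sum_paths_squared[of "n div d" d n] n r by simp
qed

lemma power_eq_1_iff_dvd: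
  fixes \<xi> :: complex
  assumes "n \<ge> 1" "primitive_root_of_unity n \<xi>"
  shows "\<xi> ^ k = 1 \<longleftrightarrow> n dvd k"
proof
  assume one: "\<xi> ^ k = 1"
  have root: "\<xi> ^ n = 1" using assms(2) by (simp add: primitive_root_of_unity_def)
  have "\<xi> ^ k = \<xi> ^ (k mod n) * (\<xi> ^ n) ^ (k div n)"
    by (simp only: power_mult[symmetric] power_add[symmetric]) simp
  then have "\<xi> ^ (k mod n) = 1" using one root by simp
  moreover have "k mod n < n" using assms(1) by simp
  ultimately have "k mod n = 0" using assms(2) by (auto simp: primitive_root_of_unity_def)
  then show "n dvd k" by (simp add: mod_eq_0_iff_dvd)
next
  assume "n dvd k"
  then show "\<xi> ^ k = 1" using assms(2) by (auto simp: primitive_root_of_unity_def power_mult elim!: dvdE)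
qed

text \<open>The root of unity \<open>\<xi>\<^sup>m\<close> has order \<open>n div gcd m n\<close>.\<close>

lemma maj_squared_power:
  fixes \<xi> :: complex
  assumes lam: "lam \<in> partitions n" and n: "n \<ge> 1" and \<xi>: "primitive_root_of_unity n \<xi>"
  shows "(\<Sum>T\<in>SYT lam. (\<xi> ^ m) ^ maj T)\<^sup>2 = of_nat (fixed_count n lam (gcd m n))"
  unfolding fixed_count_def
proof (rule maj_squared[OF lam])
  let ?g = "gcd m n"
  have g: "?g > 0" using n by simp
  show "n = n div ?g * ?g" by simp
  show "n div ?g > 0" using n by (simp add: div_greater_zero_iff gcd_le2_nat)
  have "m * (n div ?g) = n * (m div ?g)"
    by (metis dvd_div_mult gcd_dvd1 gcd_dvd2 mult.commute)
  then show "(\<xi> ^ m) ^ (n div ?g) = 1"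
    unfolding power_mult[symmetric] power_eq_1_iff_dvd[OF n \<xi>] by simp
  show "(\<xi> ^ m) ^ j \<noteq> 1" if j: "0 < j" "j < n div ?g" for j
  proof
    assume "(\<xi> ^ m) ^ j = 1"
    then have "n dvd m * j" unfolding power_mult[symmetric] power_eq_1_iff_dvd[OF n \<xi>] .
    moreover have "m * j = (m div ?g) * j * ?g" by (metis dvd_div_mult_self gcd_dvd1 mult.assoc mult.commute)
    moreover have "n = (n div ?g) * ?g" by simp
    ultimately have "(n div ?g) * ?g dvd (m div ?g) * j * ?g" by metis
    then have "n div ?g dvd (m div ?g) * j" unfolding dvd_times_right_cancel_iff[OF gr_implies_not_zero[OF g]] .
    moreover have "coprime (n div ?g) (m div ?g)"
      using div_gcd_coprime[of m n] n by (simp add: coprime_commute)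
    ultimately have "n div ?g dvd j" by (simp add: coprime_dvd_mult_right_iff)
    then show False using j by (auto dest: dvd_imp_le)
  qed
qed

lemma primitive_root_exists:
  assumes "n \<ge> 1"
  obtains \<xi> where "primitive_root_of_unity n \<xi>"
proof
  let ?c = "\<lambda>k. cis (2 * pi * real k / real n)"
  have bij: "bij_betw ?c {..<n} {z. z ^ n = 1}" using assms by (intro bij_betw_roots_unity) simp
  have pow: "cis (2 * pi / real n) ^ k = ?c k" for k by (simp add: DeMoivre mult_ac)
  show "primitive_root_of_unity n (cis (2 * pi / real n))"
    unfolding primitive_root_of_unity_def
  proof (intro conjI allI impI)
    show "cis (2 * pi / real n) ^ n = 1" unfolding pow using assms by simp
    fix k assume k: "0 < k \<and> k < n"
    show "cis (2 * pi / real n) ^ k \<noteq> 1"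
    proof
      assume "cis (2 * pi / real n) ^ k = 1"
      then have "?c k = ?c 0" unfolding pow by simp
      then have "k = 0" by (rule inj_onD[OF bij_betw_imp_inj_on[OF bij]]) (use k in auto)
      then show False using k by simp
    qed
  qed
qed

text \<open>The square of \<open>f\<^sup>\<lambda>\<close> is a sum of powers of \<open>q\<close> over pairs of tableaux, so \<open>orbit_count_Ints\<close> applies;
the other half is \<open>orbit_count_paths_nonneg\<close>.\<close>

theorem orbit_numbers_exist:
  assumes lam: "lam \<in> partitions n" and n: "n \<ge> 1"
  shows "\<exists>o_num. \<forall>d. d dvd n \<longrightarrow> fixed_count n lam d = (\<Sum>k | k dvd d. k * o_num k)"
proof -
  let ?a = "\<lambda>d. real (fixed_count n lam d)"
  have B: "beta n lam \<subseteq> {..<2*n}" using level_subset[OF beta_level[OF lam]] by simp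
  have nonneg: "orbit_count ?a k \<ge> 0" if "k dvd n" for k
    using orbit_count_paths_nonneg[OF B n that] by (simp add: fixed_count_def)
  obtain \<xi> where \<xi>: "primitive_root_of_unity n \<xi>" using primitive_root_exists[OF n] .
  have ints: "orbit_count ?a k \<in> \<int>" if "k dvd n" for k
  proof (rule orbit_count_Ints[OF n _ _ _ _ that, where \<xi> = \<xi> and I = "SYT lam \<times> SYT lam" and e = "\<lambda>(T, T'). maj T + maj T'"])
    show "\<xi> ^ n = 1" using \<xi> by (simp add: primitive_root_of_unity_def)
    show "\<And>j. 0 < j \<Longrightarrow> j < n \<Longrightarrow> \<xi> ^ j \<noteq> 1" using \<xi> by (simp add: primitive_root_of_unity_def)
    show "finite (SYT lam \<times> SYT lam)" by (simp add: finite_SYT)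
    fix d
    have "(\<Sum>i\<in>SYT lam \<times> SYT lam. \<xi> ^ (d * (case i of (T, T') \<Rightarrow> maj T + maj T')))
      = (\<Sum>T\<in>SYT lam. (\<xi> ^ d) ^ maj T)\<^sup>2"
      by (simp add: power2_eq_square sum_product sum.cartesian_product case_prod_unfold power_mult power_add)
    then show "(\<Sum>i\<in>SYT lam \<times> SYT lam. \<xi> ^ (d * (case i of (T, T') \<Rightarrow> maj T + maj T'))) = of_real (?a (gcd d n))"
      using maj_squared_power[OF lam n \<xi>, of d] by simp
  qed
  define o_num where "o_num k = nat \<lfloor>orbit_count ?a k\<rfloor>" for k
  have o: "real (o_num k) = orbit_count ?a k" if "k dvd n" for k
    using ints[OF that] nonneg[OF that] by (auto simp: o_num_def elim!: Ints_cases)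
  have "fixed_count n lam d = (\<Sum>k | k dvd d. k * o_num k)" if d: "d dvd n" for d
  proof -
    have "real (\<Sum>k | k dvd d. k * o_num k) = (\<Sum>k | k dvd d. real k * orbit_count ?a k)"
      unfolding of_nat_sum of_nat_mult using o d dvd_trans by (intro sum.cong) auto
    also have "\<dots> = ?a d" by (rule orbit_count_sum[OF dvd_ge1[OF d n]])
    finally show ?thesis by linarith
  qed
  then show ?thesis by blast
qed

lemma poly_of_nat_add:
  "poly (map_poly of_nat (p + q)) x = poly (map_poly of_nat p) x + poly (map_poly of_nat q) (x :: complex)"
  by (induction p q rule: poly_induct2) (simp_all add: map_poly_pCons algebra_simps)

lemma poly_of_nat_smult:
  "poly (map_poly of_nat (smult c p)) x = of_nat c * poly (map_poly of_nat p) (x :: complex)"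
  by (induction p) (simp_all add: map_poly_pCons algebra_simps)

lemma poly_of_nat_mult:
  "poly (map_poly of_nat (p * q)) x = poly (map_poly of_nat p) x * poly (map_poly of_nat q) (x :: complex)"
  by (induction p) (simp_all add: map_poly_pCons poly_of_nat_add poly_of_nat_smult algebra_simps)

lemma poly_of_nat_sum:
  "poly (map_poly of_nat (\<Sum>i\<in>A. f i)) x = (\<Sum>i\<in>A. poly (map_poly of_nat (f i)) (x :: complex))"
  by (induction A rule: infinite_finite_induct) (simp_all add: poly_of_nat_add)

lemma poly_fpoly:
  "poly (map_poly of_nat ((fpoly lam)\<^sup>2)) x = (\<Sum>T\<in>SYT lam. x ^ maj T)\<^sup>2" for x :: complex
  by (simp add: power2_eq_square poly_of_nat_mult fpoly_def poly_of_nat_sum map_poly_monom poly_monom)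

section \<open>Assembling the statistic\<close>

text \<open>Since \<open>\<rho>\<close> has order dividing \<open>n\<close> and \<open>\<xi>\<^sup>n = 1\<close>, integral exponents reduce to natural exponents
modulo \<open>n\<close> on both sides.\<close>

lemma exhibits_cyclic_sievingI:
  assumes fin: "finite X" and maps: "\<And>x. x \<in> X \<Longrightarrow> \<rho> x \<in> X"
    and ord: "\<And>x. x \<in> X \<Longrightarrow> (\<rho> ^^ n) x = x" and n: "n \<ge> 1"
    and cnt: "\<And>\<xi> m. primitive_root_of_unity n \<xi> \<Longrightarrow>
      of_nat (card {x\<in>X. (\<rho> ^^ m) x = x}) = poly (map_poly of_nat f) (\<xi> ^ m)"
  shows "exhibits_cyclic_sieving n X \<rho> f"
proof -
  let ?G = "BijGroup X" and ?r = "restrict \<rho> X"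
  interpret G: group ?G by (rule group_BijGroup)
  have it: "(\<rho> ^^ i) x \<in> X" if "x \<in> X" for i x using that by (induction i) (auto simp: maps)
  have "inj_on \<rho> X"
  proof (rule inj_onI)
    fix x y assume xy: "x \<in> X" "y \<in> X" "\<rho> x = \<rho> y"
    obtain m where m: "n = Suc m" using n by (cases n) auto
    have "(\<rho> ^^ n) x = (\<rho> ^^ n) y" unfolding m funpow_Suc_right o_apply xy(3) ..
    then show "x = y" using ord xy by simp
  qed
  then have "bij_betw ?r X X"
    unfolding bij_betw_def using endo_inj_surj[OF fin _ \<open>inj_on \<rho> X\<close>] maps by (auto simp: inj_on_def)
  then have r: "?r \<in> carrier ?G" by (simp add: BijGroup_def Bij_def)
  have unit: "\<one>\<^bsub>?G\<^esub> = restrict (\<lambda>x. x) X" unfolding BijGroup_def by simp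
  have carr: "carrier ?G = Bij X" unfolding BijGroup_def by simp
  have mult: "f \<otimes>\<^bsub>?G\<^esub> g = compose X f g" if "f \<in> Bij X" "g \<in> Bij X" for f g
    using that unfolding BijGroup_def by simp
  have pow: "?r [^]\<^bsub>?G\<^esub> m = restrict (\<rho> ^^ m) X" for m :: nat
  proof (induction m)
    case 0
    show ?case unfolding G.nat_pow_0 unit by (rule restrict_ext) simp
  next
    case (Suc m)
    have c: "restrict (\<rho> ^^ m) X \<in> Bij X" using G.nat_pow_closed[OF r, of m] unfolding Suc carr .
    have "?r [^]\<^bsub>?G\<^esub> Suc m = compose X (restrict (\<rho> ^^ m) X) ?r"
      unfolding G.nat_pow_Suc Suc by (rule mult[OF c r[unfolded carr]])
    also have "\<dots> = restrict (\<rho> ^^ Suc m) X"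
      by (auto simp: compose_def restrict_def fun_eq_iff maps funpow_swap1)
    finally show ?case .
  qed
  have one: "?r [^]\<^bsub>?G\<^esub> n = \<one>\<^bsub>?G\<^esub>"
    unfolding pow unit by (rule restrict_ext) (rule ord)
  have ipow: "?r [^]\<^bsub>?G\<^esub> d = restrict (\<rho> ^^ nat (d mod int n)) X" for d :: int
  proof -
    have d: "d = int n * (d div int n) + int (nat (d mod int n))" using n by simp
    have "?r [^]\<^bsub>?G\<^esub> (int n * (d div int n)) = \<one>\<^bsub>?G\<^esub>"
      unfolding G.int_pow_pow[OF r, symmetric] int_pow_int one by (rule G.int_pow_one)
    then have "?r [^]\<^bsub>?G\<^esub> (int n * (d div int n) + int (nat (d mod int n)))
      = ?r [^]\<^bsub>?G\<^esub> int (nat (d mod int n))"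
      unfolding G.int_pow_mult[OF r] by (simp only: G.l_one[OF G.int_pow_closed[OF r]])
    then show ?thesis unfolding d[symmetric] int_pow_int pow .
  qed
  have powi: "\<xi> powi d = \<xi> ^ nat (d mod int n)" if \<xi>: "primitive_root_of_unity n \<xi>" for \<xi> and d :: int
  proof -
    have root: "\<xi> ^ n = 1" using \<xi> by (simp add: primitive_root_of_unity_def)
    then have nz: "\<xi> \<noteq> 0" using n by (auto simp: power_0_left)
    have d: "d = int n * (d div int n) + int (nat (d mod int n))" using n by simp
    have "\<xi> powi (int n * (d div int n)) = 1" unfolding power_int_mult by (simp add: root)
    then have "\<xi> powi (int n * (d div int n) + int (nat (d mod int n))) = \<xi> powi int (nat (d mod int n))"
      by (simp only: power_int_add[OF disjI1[OF nz]] mult_1)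
    then show ?thesis unfolding d[symmetric] power_int_of_nat .
  qed
  show ?thesis
    unfolding exhibits_cyclic_sieving_def
  proof (intro conjI allI impI)
    fix \<xi> d assume \<xi>: "primitive_root_of_unity n \<xi>"
    have "{x\<in>X. (?r [^]\<^bsub>?G\<^esub> (d::int)) x = x} = {x\<in>X. (\<rho> ^^ nat (d mod int n)) x = x}"
      unfolding ipow by auto
    then show "of_nat (card {x\<in>X. (?r [^]\<^bsub>?G\<^esub> d) x = x}) = poly (map_poly of_nat f) (\<xi> powi d)"
      using cnt[OF \<xi>] powi[OF \<xi>] by simp
  qed (use fin r one in auto)
qed

lemma sum_eq_if_fibres_eq:
  fixes g :: "'b \<Rightarrow> 'c :: comm_monoid_add"
  assumes "finite S" "finite \<Lambda>" "s \<in> S \<rightarrow> \<Lambda>" "t \<in> S \<rightarrow> \<Lambda>"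
    and card: "\<And>x. x \<in> \<Lambda> \<Longrightarrow> card {a\<in>S. s a = x} = card {a\<in>S. t a = x}"
  shows "(\<Sum>a\<in>S. g (s a)) = (\<Sum>a\<in>S. g (t a))"
proof -
  have "(\<Sum>a\<in>S. g (s a)) = (\<Sum>x\<in>\<Lambda>. \<Sum>a | a \<in> S \<and> s a = x. g (s a))"
    by (rule sum.group[symmetric]) (use assms in auto)
  also have "\<dots> = (\<Sum>x\<in>\<Lambda>. \<Sum>a | a \<in> S \<and> t a = x. g (t a))"
  proof (rule sum.cong[OF refl])
    fix x assume x: "x \<in> \<Lambda>"
    obtain h where h: "bij_betw h {a\<in>S. s a = x} {a\<in>S. t a = x}"
      using finite_same_card_bij[OF _ _ card[OF x]] assms(1) by auto
    have "(\<Sum>a | a \<in> S \<and> s a = x. g (s a)) = (\<Sum>a | a \<in> S \<and> s a = x. g x)" by (rule sum.cong) auto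
    also have "\<dots> = (\<Sum>a | a \<in> S \<and> t a = x. g x)" using sum.reindex_bij_betw[OF h, of "\<lambda>_. g x"] by simp
    also have "\<dots> = (\<Sum>a | a \<in> S \<and> t a = x. g (t a))" by (rule sum.cong) auto
    finally show "(\<Sum>a | a \<in> S \<and> s a = x. g (s a)) = (\<Sum>a | a \<in> S \<and> t a = x. g (t a))" .
  qed
  also have "\<dots> = (\<Sum>a\<in>S. g (t a))"
    by (rule sum.group) (use assms in auto)
  finally show ?thesis .
qed

lemma card_SYT_squared:
  assumes "lam \<in> partitions n" "n \<ge> 1"
  shows "(card (SYT lam))\<^sup>2 = fixed_count n lam n"
proof -
  have "(of_nat ((card (SYT lam))\<^sup>2) :: complex) = of_nat ((paths 1 n {..<n} (beta n lam))\<^sup>2)"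
    using maj_squared[OF assms(1), of 1 n 1] by simp
  then show ?thesis using assms(2) by (simp only: of_nat_eq_iff) (simp add: fixed_count_def)
qed

text \<open>The upper bounds from the injectivity of Robinson--Schensted have the sum \<open>n!\<close>, as \<open>sum_paths_squared\<close>
shows for \<open>r = 1\<close>.  So all of them are attained.\<close>

theorem sh_count:
  assumes "lam \<in> partitions n" "n \<ge> 1"
  shows "card {\<sigma>\<in>\<SS> n. sh n \<sigma> = lam} = fixed_count n lam n"
proof -
  let ?c = "\<lambda>lam. card {\<sigma>\<in>\<SS> n. sh n \<sigma> = lam}"
  have le: "?c mu \<le> fixed_count n mu n" if "mu \<in> partitions n" for mu
    using sh_count_le(2)[of n mu] card_SYT_squared[OF that assms(2)] by simp
  have "(\<Sum>mu\<in>partitions n. ?c mu) = card (\<SS> n)"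
    using sum.group[OF finite_SS[of n] finite_partitions[of n], of "sh n" "\<lambda>_. 1 :: nat"] sh_count_le(1) by auto
  also have "\<dots> = (\<Sum>mu\<in>partitions n. fixed_count n mu n)"
    using sum_fixed_count[of n n] assms(2) by (simp add: \<SS>_def card_permutations)
  finally have eq: "(\<Sum>mu\<in>partitions n. ?c mu) = (\<Sum>mu\<in>partitions n. fixed_count n mu n)" .
  show ?thesis
  proof (rule ccontr)
    assume "?c lam \<noteq> fixed_count n lam n"
    then have "?c lam < fixed_count n lam n" using le[OF assms(1)] by simp
    then have "(\<Sum>mu\<in>partitions n. ?c mu) < (\<Sum>mu\<in>partitions n. fixed_count n mu n)"
      using le assms(1) finite_partitions by (intro sum_strict_mono_ex1) auto
    then show False using eq by simp
  qed
qed

theorem corollary53: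
  fixes n :: nat
  assumes "n \<ge> 1"
  shows "\<exists>st :: (nat \<Rightarrow> nat) \<Rightarrow> nat list.
    st \<in> \<SS> n \<rightarrow> partitions n \<and>
    (\<forall>\<sigma>\<in>\<SS> n. st (rot n \<sigma>) = st \<sigma>) \<and>
    (\<Sum>\<sigma>\<in>\<SS> n. schur (st \<sigma>)) = (\<Sum>\<sigma>\<in>\<SS> n. schur (sh n \<sigma>)) \<and>
    (\<forall>lam\<in>partitions n.
       exhibits_cyclic_sieving n {\<sigma>\<in>\<SS> n. st \<sigma> = lam} (rot n) ((fpoly lam)\<^sup>2))"
proof -
  obtain o_num where o_num: "\<And>lam d. lam \<in> partitions n \<Longrightarrow> d dvd n \<Longrightarrow>
      fixed_count n lam d = (\<Sum>k | k dvd d. k * o_num lam k)"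
    using orbit_numbers_exist[OF _ assms] by metis
  have total: "card {\<sigma>\<in>\<SS> n. (rot n ^^ d) \<sigma> = \<sigma>} = (\<Sum>lam\<in>partitions n. \<Sum>k | k dvd d. k * o_num lam k)"
    if d: "d dvd n" for d
  proof -
    have "n = d * (n div d)" using d by simp
    then have "card {\<sigma>\<in>\<SS> n. (rot n ^^ d) \<sigma> = \<sigma>} = fact d * (n div d) ^ d"
      by (rule card_rot_fixed[OF _ assms])
    also have "\<dots> = (\<Sum>lam\<in>partitions n. fixed_count n lam d)" by (rule sum_fixed_count[OF d assms, symmetric])
    also have "\<dots> = (\<Sum>lam\<in>partitions n. \<Sum>k | k dvd d. k * o_num lam k)"
      by (rule sum.cong[OF refl]) (rule o_num[OF _ d])
    finally show ?thesis .
  qed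
  obtain st where st: "st \<in> \<SS> n \<rightarrow> partitions n" "\<And>\<sigma>. \<sigma> \<in> \<SS> n \<Longrightarrow> st (rot n \<sigma>) = st \<sigma>"
    and cnt: "\<And>lam d. lam \<in> partitions n \<Longrightarrow> d dvd n \<Longrightarrow>
      card {\<sigma>\<in>\<SS> n. st \<sigma> = lam \<and> (rot n ^^ d) \<sigma> = \<sigma>} = (\<Sum>k | k dvd d. k * o_num lam k)"
    using invariant_statistic_exists[OF finite_SS rot_in rot_order assms finite_partitions total] by blast
  have fixed: "card {\<sigma>\<in>\<SS> n. st \<sigma> = lam \<and> (rot n ^^ d) \<sigma> = \<sigma>} = fixed_count n lam d"
    if "lam \<in> partitions n" "d dvd n" for lam d using cnt[OF that] o_num[OF that] by simp
  have "(\<Sum>\<sigma>\<in>\<SS> n. schur (st \<sigma>)) = (\<Sum>\<sigma>\<in>\<SS> n. schur (sh n \<sigma>))"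
  proof (rule sum_eq_if_fibres_eq[OF finite_SS finite_partitions st(1) sh_count_le(1)])
    fix lam assume lam: "lam \<in> partitions n"
    have "{\<sigma>\<in>\<SS> n. st \<sigma> = lam} = {\<sigma>\<in>\<SS> n. st \<sigma> = lam \<and> (rot n ^^ n) \<sigma> = \<sigma>}" using rot_order by auto
    then show "card {\<sigma>\<in>\<SS> n. st \<sigma> = lam} = card {\<sigma>\<in>\<SS> n. sh n \<sigma> = lam}"
      using fixed[OF lam, of n] sh_count[OF lam assms] by simp
  qed
  moreover have "exhibits_cyclic_sieving n {\<sigma>\<in>\<SS> n. st \<sigma> = lam} (rot n) ((fpoly lam)\<^sup>2)"
    if lam: "lam \<in> partitions n" for lam
  proof (rule exhibits_cyclic_sievingI[OF _ _ _ assms])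
    show "finite {\<sigma>\<in>\<SS> n. st \<sigma> = lam}" using finite_SS by simp
    show "\<And>\<sigma>. \<sigma> \<in> {\<sigma>\<in>\<SS> n. st \<sigma> = lam} \<Longrightarrow> rot n \<sigma> \<in> {\<sigma>\<in>\<SS> n. st \<sigma> = lam}" using st(2) rot_in by auto
    show "\<And>\<sigma>. \<sigma> \<in> {\<sigma>\<in>\<SS> n. st \<sigma> = lam} \<Longrightarrow> (rot n ^^ n) \<sigma> = \<sigma>" using rot_order by auto
    fix \<xi> :: complex and m assume \<xi>: "primitive_root_of_unity n \<xi>"
    have "(rot n ^^ m) \<sigma> = \<sigma> \<longleftrightarrow> (rot n ^^ gcd m n) \<sigma> = \<sigma>" if s: "\<sigma> \<in> \<SS> n" for \<sigma>
      using fixed_iff_card_orb_dvd[OF finite_SS rot_in rot_order assms s] rot_order[OF s] by simp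
    then have "{\<sigma>\<in>{\<sigma>\<in>\<SS> n. st \<sigma> = lam}. (rot n ^^ m) \<sigma> = \<sigma>}
      = {\<sigma>\<in>\<SS> n. st \<sigma> = lam \<and> (rot n ^^ gcd m n) \<sigma> = \<sigma>}" by auto
    then show "of_nat (card {\<sigma>\<in>{\<sigma>\<in>\<SS> n. st \<sigma> = lam}. (rot n ^^ m) \<sigma> = \<sigma>})
      = poly (map_poly of_nat ((fpoly lam)\<^sup>2)) (\<xi> ^ m)"
      using fixed[OF lam, of "gcd m n"] maj_squared_power[OF lam assms \<xi>, of m] by (simp add: poly_fpoly)
  qed
  ultimately show ?thesis using st by blast
qed

end
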